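(* Let $f:M_0\to M_0$ be an Euler diffeomorphism arising from a time-periodic velocity field $X$ whose initial vorticity $\omega_0=\operatorname{curl}X(\cdot,0)$ has finitely many critical points. Then $h_{top}(f)=0$.
   Context: **Protocols.** Let $C_0$ be a fixed smooth simple closed curve in the plane (Euclidean metric), $D$ the closed region it bounds, $\epsilon>0$ and $m\ge 0$. A stirring protocol is a collection of smooth paths $\alpha_i:[0,\infty)\to D$, $i=1,\dots,m$, such that for each $t$ the closed disks of radius $\epsilon$ centered at the $\alpha_i(t)$ are pairwise disjoint and disjoint from $C_0$. The fluid region $M_t$ is $D$ minus the open $\epsilon$-disks about the $\alpha_i(t)$; $C_{it}$ is the circle of radius $\epsilon$ about $\alpha_i(t)$; set $C_{0t}=C_0$ and $\dot\alpha_0\equiv0$. The protocol is $T$-periodic if $\alpha_i(t+T)=\alpha_{\sigma(i)}(t)$ for all $t$ and some permutation $\sigma$ of $\{1,\dots,m\}$. **Fluid motions.** A fluid motion $(M_t,\phi_t)$ is a smooth one-parameter family of diffeomorphisms $\phi_t:M_0\to M_t$ with $\phi_0=\mathrm{id}$. Its velocity field $X$ is defined by $X(\phi_t(z),t)=\partial_t\phi_t(z)$; it satisfies $X\cdot\mathbf n_i=\dot\alpha_i\cdot\mathbf n_i$ on $C_{it}$ ($\mathbf n_i$ the unit normal). Velocity fields are assumed $C^k$ for some $k\ge3$. The motion is incompressible if $\operatorname{div}X=0$; it is incompressible Euler, and compatible with the protocol, if moreover there is a smooth family of smooth functions $p_t:M_t\to\mathbb R$ with $\partial_tX+\nabla_XX=-\nabla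 p_t$. **Euler diffeomorphism.** A diffeomorphism $f:M_0\to M_0$ is an Euler diffeomorphism if $f=\phi_T$ for some $T>0$ and some incompressible Euler fluid motion $(M_t,\phi_t)$ whose velocity field is $T$-periodic ($X(\cdot,t+T)=X(\cdot,t)$ for all $t$) and compatible with a $T$-periodic stirring protocol. $h_{top}$ denotes topological entropy. *)

theory Defs
  imports "HOL-Analysis.Analysis" "HOL-Library.Extended_Nat"
begin

text \<open>
  The Euclidean plane is \<^typ>\<open>complex\<close>, used as a two-dimensional real inner product space:
  \<^term>\<open>1 :: complex\<close> and \<^term>\<open>\<i>\<close> are the coordinate directions.
\<close>

text \<open>Differentiability classes on an open set.  The iterated derivatives are taken direction by
  direction, so that the recursion stays within a single type.\<close>

fun higher_differentiable_on ::
  "'a::real_normed_vector set \<Rightarrow> ('a \<Rightarrow> 'b::real_normed_vector) \<Rightarrow> nat \<Rightarrow> bool" where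
  "higher_differentiable_on U g 0 \<longleftrightarrow> continuous_on U g"
| "higher_differentiable_on U g (Suc n) \<longleftrightarrow>
     (\<forall>x\<in>U. g differentiable (at x)) \<and>
     (\<forall>v. higher_differentiable_on U (\<lambda>x. frechet_derivative g (at x) v) n)"

text \<open>Class \<open>C\<^sup>k\<close>, with \<open>k = \<infinity>\<close> allowed, on an arbitrary set (below always a manifold with boundary or
  corners): the function extends locally to a \<open>C\<^sup>k\<close> function on an open set.\<close>

definition Ck_on ::
  "enat \<Rightarrow> 'a::real_normed_vector set \<Rightarrow> ('a \<Rightarrow> 'b::real_normed_vector) \<Rightarrow> bool" where
  "Ck_on k S f \<longleftrightarrow>
     (\<forall>x\<in>S. \<exists>U g. open U \<and> x \<in> U \<and>
        (\<forall>n. enat n \<le> k \<longrightarrow> higher_differentiable_on U g n) \<and>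
        (\<forall>y\<in>S \<inter> U. g y = f y))"

definition Ck_diffeomorphism ::
  "enat \<Rightarrow> complex set \<Rightarrow> complex set \<Rightarrow> (complex \<Rightarrow> complex) \<Rightarrow> bool" where
  "Ck_diffeomorphism k A B f \<longleftrightarrow>
     bij_betw f A B \<and> Ck_on k A f \<and> Ck_on k B (inv_into A f)"

text \<open>Vector calculus on a closed region \<open>S\<close> with smooth boundary.  There derivatives within \<open>S\<close>
  are unique, and at boundary points they are the one-sided ones.\<close>

definition divergence :: "complex set \<Rightarrow> (complex \<Rightarrow> complex) \<Rightarrow> complex \<Rightarrow> real" where
  "divergence S F z =
     Re (frechet_derivative F (at z within S) 1) + Im (frechet_derivative F (at z within S) \<i>)"

definition curl :: "complex set \<Rightarrow> (complex \<Rightarrow> complex) \<Rightarrow> complex \<Rightarrow> real" where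
  "curl S F z =
     Im (frechet_derivative F (at z within S) 1) - Re (frechet_derivative F (at z within S) \<i>)"

definition grad :: "complex set \<Rightarrow> (complex \<Rightarrow> real) \<Rightarrow> complex \<Rightarrow> complex" where
  "grad S g z =
     Complex (frechet_derivative g (at z within S) 1) (frechet_derivative g (at z within S) \<i>)"

definition critical_points :: "complex set \<Rightarrow> (complex \<Rightarrow> real) \<Rightarrow> complex set" where
  "critical_points S g = {z \<in> S. (g has_derivative (\<lambda>_. 0)) (at z within S)}"


text \<open>A regular \<open>1\<close>-periodic parametrization \<open>c\<close>; the curve itself is \<^term>\<open>range c\<close>.\<close>

definition smooth_simple_closed_curve :: "(real \<Rightarrow> complex) \<Rightarrow> bool" where
  "smooth_simple_closed_curve c \<longleftrightarrow>
     Ck_on \<infinity> UNIV c \<and> (\<forall>s. c (s + 1) = c s) \<and> inj_on c {0..<1} \<and>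
     (\<forall>s. vector_derivative c (at s) \<noteq> 0)"

definition bounded_region :: "(real \<Rightarrow> complex) \<Rightarrow> complex set" where
  "bounded_region c = range c \<union> inside (range c)"

definition stirring_protocol ::
  "(real \<Rightarrow> complex) \<Rightarrow> real \<Rightarrow> nat \<Rightarrow> (nat \<Rightarrow> real \<Rightarrow> complex) \<Rightarrow> bool" where
  "stirring_protocol c \<epsilon> m \<alpha> \<longleftrightarrow>
     smooth_simple_closed_curve c \<and> \<epsilon> > 0 \<and>
     (\<forall>i\<in>{1..m}. Ck_on \<infinity> {0..} (\<alpha> i)) \<and>
     (\<forall>t\<ge>0. \<forall>i\<in>{1..m}.
        \<alpha> i t \<in> bounded_region c \<and>
        cball (\<alpha> i t) \<epsilon> \<inter> range c = {} \<and>
        (\<forall>j\<in>{1..m}. i \<noteq> j \<longrightarrow> cball (\<alpha> i t) \<epsilon> \<inter> cball (\<alpha> j t) \<epsilon> = {}))"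

definition periodic_protocol :: "real \<Rightarrow> nat \<Rightarrow> (nat \<Rightarrow> real \<Rightarrow> complex) \<Rightarrow> bool" where
  "periodic_protocol T m \<alpha> \<longleftrightarrow>
     (\<exists>\<sigma>. \<sigma> permutes {1..m} \<and> (\<forall>i\<in>{1..m}. \<forall>t\<ge>0. \<alpha> i (t + T) = \<alpha> (\<sigma> i) t))"

definition fluid_region ::
  "(real \<Rightarrow> complex) \<Rightarrow> real \<Rightarrow> nat \<Rightarrow> (nat \<Rightarrow> real \<Rightarrow> complex) \<Rightarrow> real \<Rightarrow> complex set" where
  "fluid_region c \<epsilon> m \<alpha> t = bounded_region c - (\<Union>i\<in>{1..m}. ball (\<alpha> i t) \<epsilon>)"


text \<open>A moving region is a map \<open>M\<close> from times to subsets of the plane; only times \<open>t \<ge> 0\<close> matter.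
  A time-dependent function is written with the time as first argument, e.g. \<open>X t z\<close>.\<close>

definition spacetime :: "(real \<Rightarrow> complex set) \<Rightarrow> (complex \<times> real) set" where
  "spacetime M = {(z, t). 0 \<le> t \<and> z \<in> M t}"

definition fluid_motion ::
  "enat \<Rightarrow> (real \<Rightarrow> complex set) \<Rightarrow> (real \<Rightarrow> complex \<Rightarrow> complex) \<Rightarrow> bool" where
  "fluid_motion k M \<phi> \<longleftrightarrow>
     Ck_on k (M 0 \<times> {0..}) (\<lambda>(z, t). \<phi> t z) \<and>
     (\<forall>t\<ge>0. Ck_diffeomorphism k (M 0) (M t) (\<phi> t)) \<and>
     (\<forall>z\<in>M 0. \<phi> 0 z = z)"

definition velocity_field ::
  "enat \<Rightarrow> (real \<Rightarrow> complex set) \<Rightarrow> (real \<Rightarrow> complex \<Rightarrow> complex) \<Rightarrow>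
   (real \<Rightarrow> complex \<Rightarrow> complex) \<Rightarrow> bool" where
  "velocity_field k M \<phi> X \<longleftrightarrow>
     Ck_on k (spacetime M) (\<lambda>(z, t). X t z) \<and>
     (\<forall>t\<ge>0. \<forall>z\<in>M 0. ((\<lambda>s. \<phi> s z) has_vector_derivative X t (\<phi> t z)) (at t within {0..}))"

text \<open>\<open>X \<bullet> \<n>\<^sub>i = \<alpha>'\<^sub>i \<bullet> \<n>\<^sub>i\<close> on every boundary circle, and \<open>X \<bullet> \<n>\<^sub>0 = 0\<close> on the outer boundary.  The
  unit normals are determined up to sign, which does not affect the equations.\<close>

definition boundary_condition ::
  "(real \<Rightarrow> complex) \<Rightarrow> real \<Rightarrow> nat \<Rightarrow> (nat \<Rightarrow> real \<Rightarrow> complex) \<Rightarrow>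
   (real \<Rightarrow> complex \<Rightarrow> complex) \<Rightarrow> bool" where
  "boundary_condition c \<epsilon> m \<alpha> X \<longleftrightarrow>
     (\<forall>t\<ge>0.
        (\<forall>s. X t (c s) \<bullet> sgn (\<i> * vector_derivative c (at s)) = 0) \<and>
        (\<forall>i\<in>{1..m}. \<forall>z\<in>sphere (\<alpha> i t) \<epsilon>.
           X t z \<bullet> sgn (z - \<alpha> i t) =
           vector_derivative (\<alpha> i) (at t within {0..}) \<bullet> sgn (z - \<alpha> i t)))"

definition incompressible ::
  "(real \<Rightarrow> complex set) \<Rightarrow> (real \<Rightarrow> complex \<Rightarrow> complex) \<Rightarrow> bool" where
  "incompressible M X \<longleftrightarrow> (\<forall>t\<ge>0. \<forall>z\<in>M t. divergence (M t) (X t) z = 0)"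

text \<open>A boundary point of \<open>M t\<close> may lie outside \<open>M s\<close> for \<open>s\<close> near \<open>t\<close>, so the time
  derivative is the derivative in the direction \<open>(0, 1)\<close> within the space-time region.\<close>

definition time_derivative ::
  "(real \<Rightarrow> complex set) \<Rightarrow> (real \<Rightarrow> complex \<Rightarrow> complex) \<Rightarrow> real \<Rightarrow> complex \<Rightarrow> complex" where
  "time_derivative M X t z =
     frechet_derivative (\<lambda>(w, s). X s w) (at (z, t) within spacetime M) (0, 1)"

definition convective_derivative ::
  "(real \<Rightarrow> complex set) \<Rightarrow> (real \<Rightarrow> complex \<Rightarrow> complex) \<Rightarrow> real \<Rightarrow> complex \<Rightarrow> complex" where
  "convective_derivative M X t z = frechet_derivative (X t) (at z within M t) (X t z)"

text \<open>For a \<open>C\<^sup>k\<close> velocity field the equation makes the pressure gradient \<open>C\<^sup>k\<^sup>-\<^sup>1\<close>; the family of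
  pressures is asked to be of that class and no better.\<close>

definition euler_equation ::
  "enat \<Rightarrow> (real \<Rightarrow> complex set) \<Rightarrow> (real \<Rightarrow> complex \<Rightarrow> complex) \<Rightarrow> bool" where
  "euler_equation k M X \<longleftrightarrow>
     (\<exists>p. Ck_on (k - 1) (spacetime M) (\<lambda>(z, t). p t z) \<and>
        (\<forall>t\<ge>0. \<forall>z\<in>M t.
           time_derivative M X t z + convective_derivative M X t z = - grad (M t) (p t) z))"

text \<open>\<open>f\<close> is the Euler diffeomorphism arising from the time-periodic velocity field \<open>X\<close>, in the fluid
  region stirred by the protocol \<open>(c, \<epsilon>, m, \<alpha>)\<close>.  Values of \<open>f\<close> outside the region are irrelevant.\<close>

definition euler_diffeomorphism ::
  "enat \<Rightarrow> (real \<Rightarrow> complex) \<Rightarrow> real \<Rightarrow> nat \<Rightarrow> (nat \<Rightarrow> real \<Rightarrow> complex) \<Rightarrow>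
   (real \<Rightarrow> complex \<Rightarrow> complex) \<Rightarrow> (complex \<Rightarrow> complex) \<Rightarrow> bool" where
  "euler_diffeomorphism k c \<epsilon> m \<alpha> X f \<longleftrightarrow>
     (let M = fluid_region c \<epsilon> m \<alpha> in
      stirring_protocol c \<epsilon> m \<alpha> \<and>
      (\<exists>T>0. \<exists>\<phi>.
         periodic_protocol T m \<alpha> \<and>
         fluid_motion k M \<phi> \<and>
         velocity_field k M \<phi> X \<and>
         boundary_condition c \<epsilon> m \<alpha> X \<and>
         incompressible M X \<and>
         euler_equation k M X \<and>
         (\<forall>t\<ge>0. \<forall>z\<in>M t. X (t + T) z = X t z) \<and>
         (\<forall>z\<in>M 0. f z = \<phi> T z)))"


text \<open>Topological entropy of a self-map \<open>f\<close> of a compact set \<open>S\<close>, by Bowen's separated sets.\<close>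

definition separated_sets ::
  "'a::metric_space set \<Rightarrow> ('a \<Rightarrow> 'a) \<Rightarrow> nat \<Rightarrow> real \<Rightarrow> 'a set set" where
  "separated_sets S f n \<delta> =
     {E. E \<subseteq> S \<and> finite E \<and>
         (\<forall>x\<in>E. \<forall>y\<in>E. x \<noteq> y \<longrightarrow> (\<exists>i<n. dist ((f ^^ i) x) ((f ^^ i) y) > \<delta>))}"

definition topological_entropy :: "'a::metric_space set \<Rightarrow> ('a \<Rightarrow> 'a) \<Rightarrow> ereal" where
  "topological_entropy S f =
     (SUP \<delta>\<in>{0<..}. limsup (\<lambda>n. SUP E\<in>separated_sets S f n \<delta>. ereal (ln (real (card E)) / real n)))"

end

theory Submission
  imports Defs
begin

text \<open>
  Vorticity is transported by an incompressible Euler flow, so by periodicity \<open>f\<close> preserves the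
  initial vorticity \<open>\<omega>\<close>; since \<open>f\<close> also preserves area, it preserves the Hamiltonian vector field
  \<open>V = J \<nabla>\<omega>\<close>, i.e. \<open>Df V = V \<circ> f\<close>.  A level curve of \<open>\<omega>\<close> parametrized by the time of \<open>V\<close> is therefore
  mapped to a level curve of the same time length, and as \<open>V\<close> is bounded, two points joined by a
  short piece of level curve in the interior stay close forever.

  Let \<open>Z\<close> be the union of the boundary and the finite set of interior critical points.  It is
  invariant, and \<open>f\<close> has zero entropy on it because homeomorphisms of circles do.  On a fixed level
  an orbit is coded cheaply as long as it stays near \<open>Z\<close>, and once it leaves a neighbourhood of
  \<open>Z\<close> it is determined up to a small error, for all later times, by finitely many classes.  Hence every
  level set has zero entropy, and compactness of the set of levels spreads this to the whole region.
\<close>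

subsection \<open>Coding orbits\<close>

text \<open>The obstacle is uniformity. Stability along level curves compares only points of one
  level, and the neighbourhood on which it holds shrinks towards \<open>Z\<close>. So
  \<open>Z\<close> is adjoined to every level set: there an orbit pays the zero-entropy price of
  \<open>Z\<close> for each block of time near \<open>Z\<close> and, on leaving, makes one final
  choice among finitely many classes. The resulting factor is linear in the number of blocks and
  does not affect the growth rate. The levels can be combined because \<open>f\<close> fixes each of
  them: a count for one block length on a fibre persists on a thin band of nearby levels, and since
  the band is invariant, concatenating blocks extends it to all times. The second obstacle is
  regularity at the edges. The fields are differentiable up to the edge of space-time only through
  local extensions, so derivatives are taken in the open interior, which has no point at time 0.
  Conservation laws are proved for positive times and carried to time 0 by limits, and the
  derivatives of the initial vorticity are read off at time \<open>T\<close>, where periodicity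
  gives the same velocity.\<close>

text \<open>Bounds the size of \<open>(n, \<delta>)\<close>-separated subsets of \<open>S\<close> by \<open>N\<close>.\<close>

definition orbit_coded ::
  "('a::metric_space \<Rightarrow> 'a) \<Rightarrow> 'a set \<Rightarrow> nat \<Rightarrow> real \<Rightarrow> nat \<Rightarrow> bool" where
  "orbit_coded f S n \<delta> N \<longleftrightarrow>
     (\<exists>g :: 'a \<Rightarrow> nat. (\<forall>x\<in>S. g x < N) \<and>
        (\<forall>x\<in>S. \<forall>y\<in>S. g x = g y \<longrightarrow> (\<forall>j<n. dist ((f ^^ j) x) ((f ^^ j) y) \<le> \<delta>)))"

lemma orbit_codedI:
  fixes g :: "'a::metric_space \<Rightarrow> 'b"
  assumes "finite A" "card A \<le> N" "g ` S \<subseteq> A"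
    and "\<And>x y j. x \<in> S \<Longrightarrow> y \<in> S \<Longrightarrow> g x = g y \<Longrightarrow> j < n \<Longrightarrow> dist ((f ^^ j) x) ((f ^^ j) y) \<le> \<delta>"
  shows "orbit_coded f S n \<delta> N"
proof -
  obtain h where h: "inj_on h A" "h ` A = {0..<card A}"
    using ex_bij_betw_finite_nat[OF assms(1)] unfolding bij_betw_def by blast
  have lt: "h (g x) < N" if "x \<in> S" for x
  proof -
    have "h (g x) \<in> h ` A" using that assms(3) by blast
    then have "h (g x) < card A" using h(2) by simp
    then show ?thesis using assms(2) by linarith
  qed
  have eq: "g x = g y" if "x \<in> S" "y \<in> S" "h (g x) = h (g y)" for x y
    using inj_onD[OF h(1) that(3)] that assms(3) by blast
  show ?thesis
    unfolding orbit_coded_def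
    by (rule exI[of _ "h \<circ> g"]) (use lt eq assms(4) in \<open>simp add: o_def\<close>)
qed

lemma orbit_coded_mono:
  assumes "orbit_coded f S n \<delta> N" "S' \<subseteq> S" "n' \<le> n" "\<delta> \<le> \<delta>'" "N \<le> N'"
  shows "orbit_coded f S' n' \<delta>' N'"
proof -
  obtain g where g: "\<forall>x\<in>S. g x < N"
    "\<forall>x\<in>S. \<forall>y\<in>S. g x = g y \<longrightarrow> (\<forall>j<n. dist ((f ^^ j) x) ((f ^^ j) y) \<le> \<delta>)"
    using assms(1) unfolding orbit_coded_def by blast
  show ?thesis
    unfolding orbit_coded_def
  proof (intro exI[of _ g] conjI ballI allI impI)
    show "g x < N'" if "x \<in> S'" for x
    proof -
      have "g x < N" using g(1) that assms(2) by blast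
      then show ?thesis using assms(5) by linarith
    qed
    show "dist ((f ^^ j) x) ((f ^^ j) y) \<le> \<delta>'"
      if "x \<in> S'" "y \<in> S'" "g x = g y" "j < n'" for x y j
    proof -
      have "x \<in> S" "y \<in> S" "j < n" using that assms(2,3) by auto
      then have "dist ((f ^^ j) x) ((f ^^ j) y) \<le> \<delta>" using g(2) that(3) by blast
      then show ?thesis using assms(4) by linarith
    qed
  qed
qed

lemma orbit_coded_Un:
  assumes "orbit_coded f S n \<delta> A" "orbit_coded f S' n \<delta> B"
  shows "orbit_coded f (S \<union> S') n \<delta> (A + B)"
proof -
  obtain g where g: "\<forall>x\<in>S. g x < A"
    "\<forall>x\<in>S. \<forall>y\<in>S. g x = g y \<longrightarrow> (\<forall>j<n. dist ((f ^^ j) x) ((f ^^ j) y) \<le> \<delta>)"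
    using assms(1) unfolding orbit_coded_def by blast
  obtain h where h: "\<forall>x\<in>S'. h x < B"
    "\<forall>x\<in>S'. \<forall>y\<in>S'. h x = h y \<longrightarrow> (\<forall>j<n. dist ((f ^^ j) x) ((f ^^ j) y) \<le> \<delta>)"
    using assms(2) unfolding orbit_coded_def by blast
  show ?thesis
    by (rule orbit_codedI[where A = "{..<A} <+> {..<B}"
          and g = "\<lambda>x. if x \<in> S then Inl (g x) else Inr (h x)"])
      (use g h in \<open>auto split: if_splits simp: card_Plus\<close>)
qed

lemma orbit_coded_empty: "orbit_coded f {} n \<delta> N"
  unfolding orbit_coded_def by simp

lemma orbit_coded_0: "orbit_coded f S 0 \<delta> 1"
  by (rule orbit_codedI[where A = "{0::nat}" and g = "\<lambda>_. 0"]) auto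

lemma orbit_coded_UN:
  assumes "finite I" "\<And>i. i \<in> I \<Longrightarrow> orbit_coded f (S i) n \<delta> (A i)"
  shows "orbit_coded f (\<Union>i\<in>I. S i) n \<delta> (\<Sum>i\<in>I. A i)"
  using assms
proof (induction I rule: finite_induct)
  case empty
  then show ?case by (simp add: orbit_coded_empty)
next
  case (insert i I)
  then show ?case using orbit_coded_Un[of f "S i" n \<delta> "A i" "\<Union>i\<in>I. S i" "\<Sum>i\<in>I. A i"] by simp
qed

lemma orbit_coded_finite:
  assumes "finite P" "0 \<le> \<delta>"
  shows "orbit_coded f P n \<delta> (card P)"
  by (rule orbit_codedI[where A = P and g = "\<lambda>x. x"]) (use assms in auto)

text \<open>Codes multiply: the first \<open>a\<close> steps are coded at \<open>x\<close>, the next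
  \<open>b\<close> at the point reached after \<open>a\<close> steps.\<close>

lemma orbit_coded_compose:
  assumes "orbit_coded f S a \<delta> A" "orbit_coded f S' b \<delta> B"
    and "\<And>x. x \<in> S \<Longrightarrow> (f ^^ a) x \<in> S'"
  shows "orbit_coded f S (a + b) \<delta> (A * B)"
proof -
  obtain g where g: "\<forall>x\<in>S. g x < A"
    "\<forall>x\<in>S. \<forall>y\<in>S. g x = g y \<longrightarrow> (\<forall>j<a. dist ((f ^^ j) x) ((f ^^ j) y) \<le> \<delta>)"
    using assms(1) unfolding orbit_coded_def by blast
  obtain h where h: "\<forall>x\<in>S'. h x < B"
    "\<forall>x\<in>S'. \<forall>y\<in>S'. h x = h y \<longrightarrow> (\<forall>j<b. dist ((f ^^ j) x) ((f ^^ j) y) \<le> \<delta>)"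
    using assms(2) unfolding orbit_coded_def by blast
  show ?thesis
  proof (rule orbit_codedI[where A = "{..<A} \<times> {..<B}" and g = "\<lambda>x. (g x, h ((f ^^ a) x))"])
    show "(\<lambda>x. (g x, h ((f ^^ a) x))) ` S \<subseteq> {..<A} \<times> {..<B}"
      using g(1) h(1) assms(3) by auto
  next
    fix x y j
    assume *: "x \<in> S" "y \<in> S" "(g x, h ((f ^^ a) x)) = (g y, h ((f ^^ a) y))" "j < a + b"
    show "dist ((f ^^ j) x) ((f ^^ j) y) \<le> \<delta>"
    proof (cases "j < a")
      case True
      then show ?thesis using g(2) * by blast
    next
      case False
      then have e: "(f ^^ j) z = (f ^^ (j - a)) ((f ^^ a) z)" for z
        using funpow_add[of "j - a" a f] by (simp add: o_def)
      have "j - a < b" using False *(4) by linarith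
      then show ?thesis
        unfolding e using h(2) assms(3)[OF *(1)] assms(3)[OF *(2)] *(3) by blast
    qed
  qed (auto simp: card_cartesian_product)
qed

lemma funpow_in:
  assumes "\<And>x. x \<in> S \<Longrightarrow> f x \<in> S" "x \<in> S"
  shows "(f ^^ n) x \<in> S"
  using assms by (induction n) auto

lemma continuous_on_funpow:
  assumes "continuous_on M f" "f ` M \<subseteq> M"
  shows "continuous_on M (f ^^ n)"
proof (induction n)
  case 0
  then show ?case by (simp add: continuous_on_id)
next
  case (Suc n)
  have "(f ^^ n) ` M \<subseteq> M" using assms(2) by (auto intro: funpow_in)
  then show ?case
    using continuous_on_compose[OF Suc] continuous_on_subset[OF assms(1)] by auto
qed

text \<open>The first \<open>n\<close> iterates are equicontinuous on the compact \<open>M\<close>,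
  so a point may borrow the code of a nearby point of \<open>S\<close>. The scale triples because
  two points are compared through their two proxies.\<close>

lemma orbit_coded_neighbourhood:
  fixes f :: "'a::metric_space \<Rightarrow> 'a"
  assumes M: "compact M" "continuous_on M f" "f ` M \<subseteq> M"
    and S: "S \<subseteq> M" "orbit_coded f S n \<delta> N" and "\<delta> > 0"
  obtains \<eta> where "\<eta> > 0" "orbit_coded f {x\<in>M. \<exists>s\<in>S. dist x s < \<eta>} n (3 * \<delta>) N"
proof -
  have "\<exists>\<eta>>0. \<forall>j<n. \<forall>x\<in>M. \<forall>y\<in>M. dist x y < \<eta> \<longrightarrow> dist ((f ^^ j) x) ((f ^^ j) y) < \<delta>"
  proof (induction n)
    case 0
    then show ?case by (auto intro: zero_less_one)
  next
    case (Suc n)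
    then obtain e1 where e1: "e1 > 0"
      "\<forall>j<n. \<forall>x\<in>M. \<forall>y\<in>M. dist x y < e1 \<longrightarrow> dist ((f ^^ j) x) ((f ^^ j) y) < \<delta>" by blast
    have "uniformly_continuous_on M (f ^^ n)"
      by (rule compact_uniformly_continuous[OF continuous_on_funpow[OF M(2,3)] M(1)])
    then obtain e2 where e2: "e2 > 0"
      "\<And>x y. x \<in> M \<Longrightarrow> y \<in> M \<Longrightarrow> dist x y < e2 \<Longrightarrow> dist ((f ^^ n) x) ((f ^^ n) y) < \<delta>"
      using \<open>\<delta> > 0\<close> unfolding uniformly_continuous_on_def by metis
    show ?case
      by (rule exI[of _ "min e1 e2"]) (use e1 e2 less_Suc_eq in auto)
  qed
  then obtain \<eta> where \<eta>: "\<eta> > 0"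
    "\<And>j x y. j < n \<Longrightarrow> x \<in> M \<Longrightarrow> y \<in> M \<Longrightarrow> dist x y < \<eta> \<Longrightarrow> dist ((f ^^ j) x) ((f ^^ j) y) < \<delta>"
    by blast
  obtain g where g: "\<forall>x\<in>S. g x < N"
    "\<forall>x\<in>S. \<forall>y\<in>S. g x = g y \<longrightarrow> (\<forall>j<n. dist ((f ^^ j) x) ((f ^^ j) y) \<le> \<delta>)"
    using S(2) unfolding orbit_coded_def by blast
  define r where "r x = (SOME s. s \<in> S \<and> dist x s < \<eta>)" for x
  have r: "r x \<in> S" "dist x (r x) < \<eta>" if "\<exists>s\<in>S. dist x s < \<eta>" for x
    using someI_ex[of "\<lambda>s. s \<in> S \<and> dist x s < \<eta>"] that unfolding r_def by blast+
  have "orbit_coded f {x\<in>M. \<exists>s\<in>S. dist x s < \<eta>} n (3 * \<delta>) N"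
  proof (rule orbit_codedI[where A = "{..<N}" and g = "g \<circ> r"])
    fix x y j
    assume x: "x \<in> {x\<in>M. \<exists>s\<in>S. dist x s < \<eta>}" and y: "y \<in> {x\<in>M. \<exists>s\<in>S. dist x s < \<eta>}"
      and e: "(g \<circ> r) x = (g \<circ> r) y" and j: "j < n"
    have 1: "dist ((f ^^ j) x) ((f ^^ j) (r x)) < \<delta>"
      using \<eta>(2)[OF j, of x "r x"] r[of x] x S(1) by auto
    have 2: "dist ((f ^^ j) y) ((f ^^ j) (r y)) < \<delta>"
      using \<eta>(2)[OF j, of y "r y"] r[of y] y S(1) by auto
    have 3: "dist ((f ^^ j) (r x)) ((f ^^ j) (r y)) \<le> \<delta>"
      using g(2) r[of x] r[of y] x y e j by auto
    have "dist ((f ^^ j) x) ((f ^^ j) y) \<le> dist ((f ^^ j) x) ((f ^^ j) (r x)) +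
       dist ((f ^^ j) (r x)) ((f ^^ j) (r y)) + dist ((f ^^ j) y) ((f ^^ j) (r y))"
      using dist_triangle[of "(f ^^ j) x" "(f ^^ j) y" "(f ^^ j) (r x)"]
        dist_triangle[of "(f ^^ j) (r x)" "(f ^^ j) y" "(f ^^ j) (r y)"]
      by (simp add: dist_commute)
    then show "dist ((f ^^ j) x) ((f ^^ j) y) \<le> 3 * \<delta>" using 1 2 3 by linarith
  next
    show "(g \<circ> r) ` {x\<in>M. \<exists>s\<in>S. dist x s < \<eta>} \<subseteq> {..<N}"
      using g(1) r(1) unfolding comp_def by blast
  qed auto
  then show ?thesis using that \<eta>(1) by blast
qed

text \<open>Every block of an orbit of \<open>S\<close> starts in \<open>G\<close>, so each block
  contributes a factor \<open>N\<close>.\<close>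

lemma orbit_coded_blocks:
  assumes "\<And>x. x \<in> S \<Longrightarrow> f x \<in> S" "S \<subseteq> G" "orbit_coded f G k \<delta> N"
  shows "orbit_coded f S (J * k) \<delta> (N ^ J)"
proof (induction J)
  case 0
  then show ?case using orbit_coded_0 by simp
next
  case (Suc J)
  have "orbit_coded f S (k + J * k) \<delta> (N * N ^ J)"
    by (rule orbit_coded_compose[OF _ Suc])
      (use assms in \<open>auto intro: funpow_in orbit_coded_mono\<close>)
  then show ?case by simp
qed

text \<open>A block started in \<open>U\<close> costs a factor \<open>N\<close>. The first block
  started outside \<open>U\<close> fixes the entire remaining orbit by one of \<open>C\<close>
  codes, since \<open>C\<close> does not depend on the time. Summing over the position of that block
  gives \<open>N^J + (1 + N + ... + N^(J-1)) * C\<close>, and \<open>N >= 1\<close> yields the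
  stated product.\<close>

lemma orbit_coded_first_exit:
  assumes inv: "\<And>x. x \<in> S \<Longrightarrow> f x \<in> S" and U: "orbit_coded f U k \<delta> N" "N \<ge> 1"
    and C: "\<And>n. orbit_coded f (S - U) n \<delta> C"
  shows "orbit_coded f S (J * k) \<delta> (N ^ J * (1 + J * C))"
proof (induction J)
  case 0
  then show ?case using orbit_coded_0 by simp
next
  case (Suc J)
  have 1: "orbit_coded f (S \<inter> U) (k + J * k) \<delta> (N * (N ^ J * (1 + J * C)))"
    by (rule orbit_coded_compose[OF _ Suc])
      (use inv U in \<open>auto intro: funpow_in orbit_coded_mono\<close>)
  have 2: "orbit_coded f (S \<inter> U \<union> (S - U)) (k + J * k) \<delta> (N * (N ^ J * (1 + J * C)) + C)"
    by (rule orbit_coded_Un[OF 1 C])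
  have "C * 1 \<le> C * N ^ Suc J" using U(2) by (intro mult_left_mono one_le_power) auto
  then show ?case
    by (intro orbit_coded_mono[OF 2]) (auto simp: algebra_simps)
qed

text \<open>This is vanishing Bowen entropy of \<open>f\<close> on \<open>S\<close>, scale by scale.
  The constant \<open>C\<close>, uniform in \<open>n\<close>, makes the notion stable under finite
  unions and under rounding \<open>n\<close> up to a multiple of a block length.\<close>

definition subexponential :: "('a::metric_space \<Rightarrow> 'a) \<Rightarrow> 'a set \<Rightarrow> bool" where
  "subexponential f S \<longleftrightarrow>
     (\<forall>\<delta>>0. \<forall>\<epsilon>>0. \<exists>C. \<forall>n. \<exists>N. orbit_coded f S n \<delta> N \<and> real N \<le> C * exp (\<epsilon> * real n))"

text \<open>Half of the rate is held back to absorb the constant at one large time. The result is a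
  bound without a constant, which can be iterated block by block.\<close>

lemma subexponential_block:
  assumes "subexponential f S" "\<delta> > 0" "\<epsilon> > 0"
  obtains n N where "n \<ge> 1" "N \<ge> 1" "orbit_coded f S n \<delta> N" "real N \<le> exp (\<epsilon> * real n)"
proof -
  have "\<epsilon> / 2 > 0" using assms(3) by simp
  then obtain C where C: "\<And>n. \<exists>N. orbit_coded f S n \<delta> N \<and> real N \<le> C * exp (\<epsilon> / 2 * real n)"
    using assms unfolding subexponential_def by metis
  \<comment> \<open>Chosen so that \<open>C <= \<epsilon>/2 * n <= exp (\<epsilon>/2 * n)\<close>;
    the lower bound 1 keeps the block nonempty.\<close>
  obtain n :: nat where n: "real n > max 1 (2 * \<bar>C\<bar> / \<epsilon>)"
    using reals_Archimedean2 by blast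
  obtain N where N: "orbit_coded f S n \<delta> N" "real N \<le> C * exp (\<epsilon> / 2 * real n)"
    using C by blast
  have "\<bar>C\<bar> \<le> \<epsilon> / 2 * real n" using n assms(3) by (simp add: field_simps)
  also have "\<dots> \<le> exp (\<epsilon> / 2 * real n)"
    using exp_ge_add_one_self[of "\<epsilon> / 2 * real n"] by linarith
  finally have "C \<le> exp (\<epsilon> / 2 * real n)" by linarith
  then have "real N \<le> exp (\<epsilon> / 2 * real n) * exp (\<epsilon> / 2 * real n)"
    using N(2) by (meson exp_ge_zero mult_right_mono order_trans)
  also have "\<dots> = exp (\<epsilon> * real n)" by (simp flip: exp_add)
  finally have b: "real N \<le> exp (\<epsilon> * real n)" .
  have "real (max N 1) \<le> exp (\<epsilon> * real n)"
    using b assms(3) by (simp add: max_def)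
  then show ?thesis
    using that[of n "max N 1"] n orbit_coded_mono[OF N(1), of S n \<delta> "max N 1"] by simp
qed

text \<open>Half of the rate pays for the blocks, the other half for the factor linear in their
  number.\<close>

lemma subexponentialI_blocks:
  assumes "\<And>\<delta> \<epsilon>. \<delta> > 0 \<Longrightarrow> \<epsilon> > 0 \<Longrightarrow>
    \<exists>k\<ge>1. \<exists>N C. real N \<le> exp (\<epsilon> * real k) \<and>
      (\<forall>J. orbit_coded f S (J * k) \<delta> (N ^ J * (1 + J * C)))"
  shows "subexponential f S"
  unfolding subexponential_def
proof (intro allI impI)
  fix \<delta> \<epsilon> :: real
  assume \<delta>: "\<delta> > 0" and \<epsilon>: "\<epsilon> > 0"
  then have "\<epsilon> / 2 > 0" by simp
  then obtain k N C where k: "k \<ge> 1" and N: "real N \<le> exp (\<epsilon> / 2 * real k)"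
    and cd: "\<And>J. orbit_coded f S (J * k) \<delta> (N ^ J * (1 + J * C))"
    using assms[OF \<delta>] by metis
  \<comment> \<open>The exponential pays for rounding \<open>n\<close> up to whole blocks; the
    bracket comes from \<open>J <= n + 1\<close> and
    \<open>n <= 2/\<epsilon> * exp (\<epsilon>/2 * n)\<close>.\<close>
  define K where "K = exp (\<epsilon> / 2 * real k) * (1 + C + C * (2 / \<epsilon>))"
  have "\<exists>L. orbit_coded f S n \<delta> L \<and> real L \<le> K * exp (\<epsilon> * real n)" for n
  proof -
    define J where "J = n div k + 1"
    define L where "L = N ^ J * (1 + J * C)"
    have nJ: "n \<le> J * k"
      unfolding J_def using k dividend_less_div_times[of k n] by (simp add: algebra_simps)
    have Jk: "J * k \<le> n + k" "J \<le> n + 1"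
      unfolding J_def by (auto simp: algebra_simps)
    have "real N ^ J \<le> exp (\<epsilon> / 2 * real k) ^ J" using N by (intro power_mono) auto
    also have "\<dots> = exp (\<epsilon> / 2 * real (J * k))" by (simp add: exp_of_nat_mult[symmetric] mult_ac)
    also have "\<dots> \<le> exp (\<epsilon> / 2 * real (n + k))"
      using Jk(1) \<epsilon> by (simp del: of_nat_add of_nat_mult)
    also have "\<dots> = exp (\<epsilon> / 2 * real k) * exp (\<epsilon> / 2 * real n)"
      by (simp add: algebra_simps flip: exp_add)
    finally have 1: "real N ^ J \<le> exp (\<epsilon> / 2 * real k) * exp (\<epsilon> / 2 * real n)" .
    have e: "real n \<le> 2 / \<epsilon> * exp (\<epsilon> / 2 * real n)"
    proof -
      have "\<epsilon> / 2 * real n \<le> exp (\<epsilon> / 2 * real n)"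
        using exp_ge_add_one_self[of "\<epsilon> / 2 * real n"] by linarith
      then show ?thesis using \<epsilon> by (simp add: field_simps)
    qed
    have o: "1 \<le> exp (\<epsilon> / 2 * real n)" using \<epsilon> by simp
    have "1 + real J * real C \<le> (1 + real C) * 1 + real C * real n"
      using Jk(2) mult_right_mono[of "real J" "real n + 1" "real C"] by (simp add: algebra_simps)
    also have "\<dots> \<le> (1 + real C) * exp (\<epsilon> / 2 * real n) + real C * (2 / \<epsilon> * exp (\<epsilon> / 2 * real n))"
      using e o by (intro add_mono mult_left_mono) auto
    finally have 2: "1 + real J * real C \<le> (1 + C + C * (2 / \<epsilon>)) * exp (\<epsilon> / 2 * real n)"
      by (simp add: algebra_simps)
    have "real L = real N ^ J * (1 + real J * real C)"
      unfolding L_def by (simp only: of_nat_mult of_nat_power of_nat_add of_nat_1)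
    also have "\<dots> \<le> (exp (\<epsilon> / 2 * real k) * exp (\<epsilon> / 2 * real n)) *
        ((1 + C + C * (2 / \<epsilon>)) * exp (\<epsilon> / 2 * real n))"
      by (rule mult_mono[OF 1 2]) auto
    also have "\<dots> = K * (exp (\<epsilon> / 2 * real n) * exp (\<epsilon> / 2 * real n))"
      unfolding K_def by (simp add: mult_ac)
    also have "\<dots> = K * exp (\<epsilon> * real n)" by (simp flip: exp_add)
    finally show ?thesis
      using orbit_coded_mono[OF cd[of J] order_refl nJ order_refl order_refl] unfolding L_def by blast
  qed
  then show "\<exists>C. \<forall>n. \<exists>N. orbit_coded f S n \<delta> N \<and> real N \<le> C * exp (\<epsilon> * real n)" by blast
qed

lemma subexponential_linear:
  assumes "\<And>\<delta>. \<delta> > 0 \<Longrightarrow> \<exists>a b. \<forall>n. orbit_coded f S n \<delta> (a * n + b)"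
  shows "subexponential f S"
proof (rule subexponentialI_blocks)
  fix \<delta> \<epsilon> :: real
  assume "\<delta> > 0" "\<epsilon> > 0"
  then obtain a b where ab: "\<And>n. orbit_coded f S n \<delta> (a * n + b)" using assms by blast
  \<comment> \<open>Blocks of length 1 with \<open>N = 1\<close>, so that all growth sits in the
    linear factor. For \<open>J >= 1\<close> the offset \<open>b\<close> is at most
    \<open>J * b\<close>.\<close>
  have "orbit_coded f S (J * 1) \<delta> (1 ^ J * (1 + J * (a + b)))" for J
  proof (cases "J = 0")
    case True
    then show ?thesis using orbit_coded_0 by simp
  next
    case False
    then have "b \<le> J * b" by simp
    moreover have "1 ^ J * (1 + J * (a + b)) = 1 + (a * J + J * b)" by (simp add: distrib_left mult.commute)
    ultimately have "a * J + b \<le> 1 ^ J * (1 + J * (a + b))" by linarith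
    then show ?thesis
      by (intro orbit_coded_mono[OF ab[of J]]) auto
  qed
  then show "\<exists>k\<ge>1. \<exists>N C. real N \<le> exp (\<epsilon> * real k) \<and>
      (\<forall>J. orbit_coded f S (J * k) \<delta> (N ^ J * (1 + J * C)))"
    using \<open>\<epsilon> > 0\<close> by (intro exI[of _ "1::nat"] conjI exI[of _ "a + b"] allI) auto
qed

text \<open>Stated at one fixed scale and rate, because the pieces joined in
  \<open>subexponential_fibred\<close> are controlled only at that pair.\<close>

lemma subexponential_UN:
  assumes I: "finite I" and S: "\<And>i. i \<in> I \<Longrightarrow> \<exists>C. \<forall>n. \<exists>N. orbit_coded f (S i) n \<delta> N \<and> real N \<le> C * exp (\<epsilon> * real n)"
  shows "\<exists>C. \<forall>n. \<exists>N. orbit_coded f (\<Union>i\<in>I. S i) n \<delta> N \<and> real N \<le> C * exp (\<epsilon> * real n)"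
proof -
  obtain C N where CN: "\<And>i n. i \<in> I \<Longrightarrow> orbit_coded f (S i) n \<delta> (N i n)"
    "\<And>i n. i \<in> I \<Longrightarrow> real (N i n) \<le> C i * exp (\<epsilon> * real n)"
    using S by metis
  have "orbit_coded f (\<Union>i\<in>I. S i) n \<delta> (\<Sum>i\<in>I. N i n)" for n
    by (rule orbit_coded_UN[OF I CN(1)])
  moreover have "real (\<Sum>i\<in>I. N i n) \<le> (\<Sum>i\<in>I. C i) * exp (\<epsilon> * real n)" for n
    using sum_mono[OF CN(2)] by (simp add: sum_distrib_right)
  ultimately show ?thesis by blast
qed

lemma subexponential_Un:
  assumes "subexponential f S" "subexponential f S'"
  shows "subexponential f (S \<union> S')"
  unfolding subexponential_def
proof (intro allI impI)
  fix \<delta> \<epsilon> :: real assume "\<delta> > 0" "\<epsilon> > 0"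
  then have "\<exists>C. \<forall>n. \<exists>N. orbit_coded f (\<Union>i\<in>{S, S'}. i) n \<delta> N \<and> real N \<le> C * exp (\<epsilon> * real n)"
    using assms unfolding subexponential_def by (intro subexponential_UN) auto
  then show "\<exists>C. \<forall>n. \<exists>N. orbit_coded f (S \<union> S') n \<delta> N \<and> real N \<le> C * exp (\<epsilon> * real n)"
    by simp
qed

text \<open>A single good block length on \<open>G\<close> is enough, since orbits of
  \<open>S\<close> begin every block in \<open>G\<close>. The constant accounts for the incomplete
  last block.\<close>

lemma subexponential_invariant_subset:
  assumes S: "\<And>x. x \<in> S \<Longrightarrow> f x \<in> S" "S \<subseteq> G"
    and k: "k \<ge> 1" "orbit_coded f G k \<delta> N" "real N \<le> exp (\<epsilon> * real k)" "\<epsilon> > 0"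
  shows "\<exists>C. \<forall>n. \<exists>L. orbit_coded f S n \<delta> L \<and> real L \<le> C * exp (\<epsilon> * real n)"
proof (intro exI[of _ "exp (\<epsilon> * real k)"] allI)
  fix n
  define J where "J = n div k + 1"
  have nJ: "n \<le> J * k"
    unfolding J_def using k(1) dividend_less_div_times[of k n] by (simp add: algebra_simps)
  have Jk: "J * k \<le> n + k" unfolding J_def by (auto simp: algebra_simps)
  have "real N ^ J \<le> exp (\<epsilon> * real k) ^ J" using k(3) by (intro power_mono) auto
  also have "\<dots> = exp (\<epsilon> * real (J * k))" by (simp add: exp_of_nat_mult[symmetric] mult_ac)
  also have "\<dots> \<le> exp (\<epsilon> * real (n + k))"
    using Jk k(4) by (simp del: of_nat_add of_nat_mult)
  also have "\<dots> = exp (\<epsilon> * real k) * exp (\<epsilon> * real n)"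
    by (simp add: algebra_simps flip: exp_add)
  finally have "real (N ^ J) \<le> exp (\<epsilon> * real k) * exp (\<epsilon> * real n)" by simp
  then show "\<exists>L. orbit_coded f S n \<delta> L \<and> real L \<le> exp (\<epsilon> * real k) * exp (\<epsilon> * real n)"
    using orbit_coded_mono[OF orbit_coded_blocks[OF S k(2), of J] order_refl nJ order_refl order_refl]
    by blast
qed

text \<open>A form of Bowen's bound of the entropy by the entropies of the fibres, the induced
  dynamics on the values of \<open>w\<close> being the identity. As \<open>w\<close> is continuous
  only off \<open>Z\<close>, each fibre is completed by \<open>Z\<close>, which makes it
  closed.\<close>

theorem subexponential_fibred:
  fixes f :: "'a::metric_space \<Rightarrow> 'a" and w :: "'a \<Rightarrow> real"
  assumes M: "compact M" "continuous_on M f" "f ` M \<subseteq> M"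
    and Z: "Z \<subseteq> M" "closed Z" "f ` Z \<subseteq> Z" "f ` (M - Z) \<subseteq> M - Z" "subexponential f Z"
    and w: "continuous_on (M - Z) w" "\<And>x. x \<in> M - Z \<Longrightarrow> w (f x) = w x"
    and stable: "\<And>q \<delta>. q \<in> M - Z \<Longrightarrow> \<delta> > 0 \<Longrightarrow> \<exists>W. open W \<and> q \<in> W \<and>
       (\<forall>x\<in>W \<inter> (M - Z). w x = w q \<longrightarrow> (\<forall>i. dist ((f ^^ i) x) ((f ^^ i) q) \<le> \<delta>))"
  shows "subexponential f M"
  unfolding subexponential_def
proof (intro allI impI)
  fix \<delta>0 \<epsilon> :: real
  assume \<delta>: "\<delta>0 > 0" and \<epsilon>: "\<epsilon> > 0"
  have fM: "f x \<in> M" if "x \<in> M" for x using that M(3) by blast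
  have Mi: "(f ^^ i) x \<in> M" if "x \<in> M" for x i using fM that by (rule funpow_in)
  have Zi: "(f ^^ i) x \<in> M - Z" if "x \<in> M - Z" for x i
    using Z(4) that by (intro funpow_in) auto
  have wi: "w ((f ^^ i) x) = w x" if "x \<in> M - Z" for x i
    by (induction i) (use w(2) Zi[OF that] in auto)

  \<comment> \<open>Every fibre, completed by \<open>Z\<close>, is subexponential: an orbit leaving \<open>U\<close> is determined from
    then on by finitely many classes.\<close>
  have fibre: "subexponential f (Z \<union> {x \<in> M - Z. w x = c})" (is "subexponential f ?F") for c
  proof (rule subexponentialI_blocks)
    fix \<delta>1 \<epsilon>1 :: real
    assume \<delta>1: "\<delta>1 > 0" and \<epsilon>1: "\<epsilon>1 > 0"
    have d3: "\<delta>1 / 3 > 0" using \<delta>1 by simp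
    obtain k N where k: "k \<ge> 1" and N: "N \<ge> 1" "orbit_coded f Z k (\<delta>1 / 3) N" "real N \<le> exp (\<epsilon>1 * real k)"
      using subexponential_block[OF Z(5) d3 \<epsilon>1] by blast
    obtain \<eta> where \<eta>: "\<eta> > 0" "orbit_coded f {x\<in>M. \<exists>s\<in>Z. dist x s < \<eta>} k (3 * (\<delta>1 / 3)) N"
      using orbit_coded_neighbourhood[OF M Z(1) N(2) d3] by blast
    define U where "U = {x\<in>M. \<exists>s\<in>Z. dist x s < \<eta>}"
    have U: "orbit_coded f U k \<delta>1 N" using \<eta>(2) by (simp add: U_def)
    have ZU: "Z \<subseteq> U" unfolding U_def using Z(1) \<eta>(1) by force
    \<comment> \<open>The points at distance at least \<open>\<eta>\<close> from \<open>Z\<close>: a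
      compact set off \<open>Z\<close>, on which \<open>stable\<close> yields finitely many classes
      per level.\<close>
    define K where "K = M - (\<Union>s\<in>Z. ball s \<eta>)"
    have K: "compact K" "K = M - U" "K \<subseteq> M - Z"
      using compact_diff[OF M(1), of "\<Union>s\<in>Z. ball s \<eta>"] ZU
      unfolding K_def U_def by (auto simp: dist_commute)
    define Kc where "Kc = {x \<in> K. w x = c}"
    have "continuous_on K w" using w(1) K(3) by (rule continuous_on_subset)
    then have "closedin (top_of_set K) Kc"
      unfolding Kc_def using continuous_closedin_preimage_constant[of K w c] by simp
    then have Kc: "compact Kc" using K(1) closedin_compact by blast
    \<comment> \<open>Half of \<open>\<delta>1\<close>, since two points of one class are compared
      through its centre.\<close>
    have "\<forall>q\<in>Kc. \<exists>W. open W \<and> q \<in> W \<and>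
       (\<forall>x\<in>W \<inter> (M - Z). w x = w q \<longrightarrow> (\<forall>i. dist ((f ^^ i) x) ((f ^^ i) q) \<le> \<delta>1 / 2))"
      using stable[of _ "\<delta>1 / 2"] \<delta>1 K(3) unfolding Kc_def by auto
    then obtain W where W: "\<And>q. q \<in> Kc \<Longrightarrow> open (W q)" "\<And>q. q \<in> Kc \<Longrightarrow> q \<in> W q"
      "\<And>q x i. q \<in> Kc \<Longrightarrow> x \<in> W q \<inter> (M - Z) \<Longrightarrow> w x = w q \<Longrightarrow>
         dist ((f ^^ i) x) ((f ^^ i) q) \<le> \<delta>1 / 2"
      by metis
    have "Kc \<subseteq> (\<Union>q\<in>Kc. W q)" using W(2) by blast
    then obtain D where D: "D \<subseteq> Kc" "finite D" "Kc \<subseteq> (\<Union>q\<in>D. W q)"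
      using compactE_image[OF Kc, of Kc W] W(1) by metis
    then obtain r where r: "\<And>x. x \<in> Kc \<Longrightarrow> r x \<in> D \<and> x \<in> W (r x)"
      by (metis UN_E subsetD)
    \<comment> \<open>Stability holds for all iterates, so the number of classes does not grow with
      \<open>n\<close>. This is the \<open>C\<close> of
      \<open>orbit_coded_first_exit\<close>.\<close>
    have "orbit_coded f Kc n \<delta>1 (card D)" for n
    proof (rule orbit_codedI[where A = D and g = r])
      fix x y j
      assume x: "x \<in> Kc" and y: "y \<in> Kc" and e: "r x = r y"
      have rx: "r x \<in> Kc" using r[OF x] D(1) by blast
      have "dist ((f ^^ j) x) ((f ^^ j) (r x)) \<le> \<delta>1 / 2"
        using W(3)[OF rx, of x j] r[OF x] x rx K(3) unfolding Kc_def by auto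
      moreover have "dist ((f ^^ j) y) ((f ^^ j) (r x)) \<le> \<delta>1 / 2"
        using W(3)[OF rx, of y j] r[OF y] y rx K(3) unfolding Kc_def e by auto
      ultimately show "dist ((f ^^ j) x) ((f ^^ j) y) \<le> \<delta>1"
        using dist_triangle2[of "(f ^^ j) x" "(f ^^ j) y" "(f ^^ j) (r x)"] by linarith
    qed (use D r in auto)
    moreover have "?F - U \<subseteq> Kc" using ZU K(2) unfolding Kc_def by blast
    ultimately have C: "orbit_coded f (?F - U) n \<delta>1 (card D)" for n
      using orbit_coded_mono by blast
    have "f x \<in> ?F" if "x \<in> ?F" for x using that Z(3,4) w(2) by auto
    then have "orbit_coded f ?F (J * k) \<delta>1 (N ^ J * (1 + J * card D))" for J
      by (rule orbit_coded_first_exit[OF _ U N(1) C])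
    then show "\<exists>k\<ge>1. \<exists>N C. real N \<le> exp (\<epsilon>1 * real k) \<and>
      (\<forall>J. orbit_coded f ?F (J * k) \<delta>1 (N ^ J * (1 + J * C)))"
      using k N(3) by blast
  qed

  \<comment> \<open>Only one block length is controlled on the neighbourhood, as it need not be
    invariant.\<close>
  have tube: "\<exists>\<eta>>0. \<exists>k\<ge>1. \<exists>N. orbit_coded f {x\<in>M. \<exists>s\<in>F. dist x s < \<eta>} k \<delta>0 N \<and> real N \<le> exp (\<epsilon> * real k)"
    if F: "F \<subseteq> M" "subexponential f F" for F
  proof -
    have d3: "\<delta>0 / 3 > 0" using \<delta> by simp
    obtain k N where k: "k \<ge> 1" and N: "orbit_coded f F k (\<delta>0 / 3) N" "real N \<le> exp (\<epsilon> * real k)"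
      using subexponential_block[OF F(2) d3 \<epsilon>] by metis
    obtain \<eta> where "\<eta> > 0" "orbit_coded f {x\<in>M. \<exists>s\<in>F. dist x s < \<eta>} k (3 * (\<delta>0 / 3)) N"
      using orbit_coded_neighbourhood[OF M F(1) N(1) d3] by blast
    then show ?thesis using k N(2) by auto
  qed
  obtain \<eta> k N where \<eta>: "\<eta> > 0" and k: "k \<ge> 1"
    and N: "orbit_coded f {x\<in>M. \<exists>s\<in>Z. dist x s < \<eta>} k \<delta>0 N" "real N \<le> exp (\<epsilon> * real k)"
    using tube[OF Z(1) Z(5)] by blast
  define U where "U = {x\<in>M. \<exists>s\<in>Z. dist x s < \<eta>}"
  have ZU: "Z \<subseteq> U" unfolding U_def using Z(1) \<eta>(1) by force
  define K where "K = M - (\<Union>s\<in>Z. ball s \<eta>)"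
  have K: "compact K" "K = M - U" "K \<subseteq> M - Z"
    using compact_diff[OF M(1), of "\<Union>s\<in>Z. ball s \<eta>"] ZU
    unfolding K_def U_def by (auto simp: dist_commute)
  have cK: "compact (w ` K)"
    using compact_continuous_image[OF continuous_on_subset[OF w(1) K(3)] K(1)] .
  \<comment> \<open>A thin band of levels around \<open>c\<close> lies in the tube about the fibre
    of \<open>c\<close>. The band is invariant, which the tube need not be, so the bound for one
    block extends to all times.\<close>
  have level: "\<exists>r>0. \<exists>C. \<forall>n. \<exists>N. orbit_coded f {x \<in> M - Z. dist c (w x) < r} n \<delta>0 N \<and>
      real N \<le> C * exp (\<epsilon> * real n)" for c
  proof -
    let ?F = "Z \<union> {x \<in> M - Z. w x = c}"
    obtain \<eta> k N where \<eta>: "\<eta> > 0" and k: "k \<ge> 1"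
      and N: "orbit_coded f {x\<in>M. \<exists>s\<in>?F. dist x s < \<eta>} k \<delta>0 N" "real N \<le> exp (\<epsilon> * real k)"
      using tube[OF _ fibre[of c]] Z(1) by blast
    \<comment> \<open>Otherwise points at levels tending to \<open>c\<close> stay
      \<open>\<eta>\<close> away from the fibre. A limit point is then off \<open>Z\<close>, where
      continuity of \<open>w\<close> puts it on level \<open>c\<close>, hence in the fibre.\<close>
    have "\<exists>r>0. {x \<in> M - Z. dist c (w x) < r} \<subseteq> {x\<in>M. \<exists>s\<in>?F. dist x s < \<eta>}"
    proof (rule ccontr)
      assume "\<not> ?thesis"
      then have "\<forall>n. \<exists>x. x \<in> M - Z \<and> dist c (w x) < inverse (real (Suc n)) \<and> (\<forall>s\<in>?F. \<eta> \<le> dist x s)"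
        by (smt (verit, best) inverse_positive_iff_positive mem_Collect_eq of_nat_0_less_iff subsetI zero_less_Suc DiffD1)
      then obtain x where x: "\<And>n. x n \<in> M - Z" "\<And>n. dist c (w (x n)) < inverse (real (Suc n))"
        "\<And>n s. s \<in> ?F \<Longrightarrow> \<eta> \<le> dist (x n) s" by metis
      obtain l r where l: "l \<in> M" "strict_mono r" "(x \<circ> r) \<longlonglongrightarrow> l"
        using M(1) x(1) unfolding compact_eq_seq_compact_metric seq_compact_def by blast
      have far: "\<eta> \<le> dist l s" if "s \<in> ?F" for s
        by (rule tendsto_lowerbound[OF tendsto_dist[OF l(3) tendsto_const]]) (use x(3)[OF that] in auto)
      then have "l \<notin> Z" using \<eta> by force
      have "(\<lambda>n. w ((x \<circ> r) n)) \<longlonglongrightarrow> w l"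
        by (rule continuous_on_tendsto_compose[OF w(1) l(3)]) (use l(1) \<open>l \<notin> Z\<close> x(1) in auto)
      moreover have "(\<lambda>n. w (x n)) \<longlonglongrightarrow> c"
      proof (rule metric_tendsto_imp_tendsto[OF LIMSEQ_inverse_real_of_nat])
        show "\<forall>\<^sub>F n in sequentially. dist (w (x n)) c \<le> dist (inverse (real (Suc n))) 0"
          using less_imp_le[OF x(2)] by (intro always_eventually allI) (simp add: dist_commute dist_norm)
      qed
      then have "(\<lambda>n. w ((x \<circ> r) n)) \<longlonglongrightarrow> c"
        using LIMSEQ_subseq_LIMSEQ[OF _ l(2)] by (fastforce simp: o_def)
      ultimately have "w l = c" using LIMSEQ_unique by blast
      then show False using far[of l] \<eta> l(1) \<open>l \<notin> Z\<close> by auto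
    qed
    then obtain r where r: "r > 0"
      "{x \<in> M - Z. dist c (w x) < r} \<subseteq> {x\<in>M. \<exists>s\<in>?F. dist x s < \<eta>}" by blast
    have "f x \<in> {x \<in> M - Z. dist c (w x) < r}" if "x \<in> {x \<in> M - Z. dist c (w x) < r}" for x
      using that Z(4) w(2) by auto
    from subexponential_invariant_subset[OF this r(2) k N \<epsilon>] show ?thesis
      using r(1) by blast
  qed
  then obtain r where r: "\<And>c. r c > (0::real)"
    "\<And>c. \<exists>C. \<forall>n. \<exists>N. orbit_coded f {x \<in> M - Z. dist c (w x) < r c} n \<delta>0 N \<and>
      real N \<le> C * exp (\<epsilon> * real n)" by metis
  have "w ` K \<subseteq> (\<Union>c\<in>w ` K. ball c (r c))" using r(1) by force
  then obtain D where D: "D \<subseteq> w ` K" "finite D" "w ` K \<subseteq> (\<Union>c\<in>D. ball c (r c))"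
    using compactE_image[OF cK, of "w ` K" "\<lambda>c. ball c (r c)"] open_ball by metis
  \<comment> \<open>\<open>None\<close> collects the orbits that never leave \<open>U\<close>. Every
    other orbit meets \<open>K\<close>; as \<open>w\<close> is constant along it, its level is among
    those covered by \<open>D\<close>, unless the orbit started in \<open>Z\<close>, which is
    invariant and misses \<open>K\<close>.\<close>
  define S where "S i = (case i of None \<Rightarrow> {x\<in>M. \<forall>j. (f ^^ j) x \<in> U}
      | Some c \<Rightarrow> {x \<in> M - Z. dist c (w x) < r c})" for i
  have "M \<subseteq> (\<Union>i\<in>insert None (Some ` D). S i)"
  proof
    fix x assume x: "x \<in> M"
    show "x \<in> (\<Union>i\<in>insert None (Some ` D). S i)"
    proof (cases "\<forall>j. (f ^^ j) x \<in> U")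
      case True
      then show ?thesis using x by (auto simp: S_def)
    next
      case False
      then obtain j where j: "(f ^^ j) x \<in> K" using K(2) Mi[OF x] by blast
      have "x \<notin> Z"
        using funpow_in[of Z f x j] Z(3) K(3) j by blast
      then have "w x \<in> w ` K" using wi[of x j] x j by (metis DiffI imageI)
      then obtain c where "c \<in> D" "dist c (w x) < r c" using D(3) by auto
      then show ?thesis using x \<open>x \<notin> Z\<close> by (auto simp: S_def)
    qed
  qed
  then have cover: "orbit_coded f M n \<delta>0 N"
    if "orbit_coded f (\<Union>i\<in>insert None (Some ` D). S i) n \<delta>0 N" for n N
    by (rule orbit_coded_mono[OF that]) auto
  have "\<exists>C. \<forall>n. \<exists>N. orbit_coded f (\<Union>i\<in>insert None (Some ` D). S i) n \<delta>0 N \<and>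
      real N \<le> C * exp (\<epsilon> * real n)"
  proof (rule subexponential_UN)
    fix i assume "i \<in> insert None (Some ` D)"
    show "\<exists>C. \<forall>n. \<exists>N. orbit_coded f (S i) n \<delta>0 N \<and> real N \<le> C * exp (\<epsilon> * real n)"
    proof (cases i)
      case None
      have "f x \<in> S None" if "x \<in> S None" for x
        using that fM unfolding S_def
        by (auto simp: funpow_swap1[symmetric]) (metis funpow_swap1 funpow.simps(2) o_apply)
      moreover have "S None \<subseteq> {x\<in>M. \<exists>s\<in>Z. dist x s < \<eta>}"
      proof
        fix x assume "x \<in> S None"
        then have "\<forall>j. (f ^^ j) x \<in> U" by (simp add: S_def)
        from spec[OF this, of 0] show "x \<in> {x\<in>M. \<exists>s\<in>Z. dist x s < \<eta>}" unfolding U_def by simp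
      qed
      ultimately show ?thesis
        using subexponential_invariant_subset[OF _ _ k N \<epsilon>] None by blast
    next
      case (Some c)
      then show ?thesis using r(2)[of c] by (simp add: S_def)
    qed
  qed (use D(2) in auto)
  then show "\<exists>C. \<forall>n. \<exists>N. orbit_coded f M n \<delta>0 N \<and> real N \<le> C * exp (\<epsilon> * real n)"
    using cover by blast
qed

text \<open>A code of scale \<open>\<delta>\<close> is injective on a
  \<open>\<delta>\<close>-separated set, so the number of codes bounds its cardinality.\<close>

lemma topological_entropy_eq_0:
  assumes "subexponential f M" "M \<noteq> {}"
  shows "topological_entropy M f = 0"
proof -
  define h where "h \<delta> n = (SUP E\<in>separated_sets M f n \<delta>. ereal (ln (real (card E)) / real n))" for \<delta> n
  have lower: "0 \<le> h \<delta> n" for \<delta> n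
  proof -
    obtain x where "x \<in> M" using assms(2) by blast
    then have "{x} \<in> separated_sets M f n \<delta>" unfolding separated_sets_def by auto
    from SUP_upper[OF this, of "\<lambda>E. ereal (ln (real (card E)) / real n)"]
    show ?thesis unfolding h_def by (simp add: zero_ereal_def)
  qed
  have upper: "limsup (h \<delta>) \<le> ereal \<epsilon>" if "\<delta> > 0" "\<epsilon> > 0" for \<delta> \<epsilon>
  proof -
    obtain C where C: "\<And>n. \<exists>N. orbit_coded f M n \<delta> N \<and> real N \<le> C * exp (\<epsilon> / 2 * real n)"
      using assms(1) \<open>\<delta> > 0\<close> \<open>\<epsilon> > 0\<close> half_gt_zero unfolding subexponential_def by metis
    \<comment> \<open>From then on \<open>ln (max C 1)\<close> is at most half of
      \<open>\<epsilon> * n\<close>.\<close>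
    have "\<forall>\<^sub>F n in sequentially. ln (max C 1) / (\<epsilon> / 2) \<le> real n"
      using filterlim_real_sequentially unfolding filterlim_at_top by blast
    then have "\<forall>\<^sub>F n in sequentially. h \<delta> n \<le> ereal \<epsilon>"
      using eventually_gt_at_top[of "0::nat"]
    proof eventually_elim
      case (elim n)
      obtain N where N: "orbit_coded f M n \<delta> N" "real N \<le> C * exp (\<epsilon> / 2 * real n)" using C by blast
      obtain g where g: "\<forall>x\<in>M. g x < N"
        "\<forall>x\<in>M. \<forall>y\<in>M. g x = g y \<longrightarrow> (\<forall>j<n. dist ((f ^^ j) x) ((f ^^ j) y) \<le> \<delta>)"
        using N(1) unfolding orbit_coded_def by blast
      show ?case
        unfolding h_def
      proof (rule SUP_least)
        fix E assume "E \<in> separated_sets M f n \<delta>"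
        then have E: "E \<subseteq> M" "finite E"
          "\<And>x y. x \<in> E \<Longrightarrow> y \<in> E \<Longrightarrow> x \<noteq> y \<Longrightarrow> \<exists>i<n. dist ((f ^^ i) x) ((f ^^ i) y) > \<delta>"
          unfolding separated_sets_def by auto
        have "inj_on g E"
          by (rule inj_onI) (meson E(1,3) g(2) not_less subsetD)
        moreover have "g ` E \<subseteq> {..<N}" using g(1) E(1) by auto
        ultimately have "card E \<le> N" using card_inj_on_le[of g E "{..<N}"] by simp
        then have "real (card E) \<le> real N" by simp
        also note N(2)
        also have "C * exp (\<epsilon> / 2 * real n) \<le> max C 1 * exp (\<epsilon> / 2 * real n)"
          by (intro mult_right_mono) auto
        finally have cE: "real (card E) \<le> max C 1 * exp (\<epsilon> / 2 * real n)" .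
        have "ln (real (card E)) \<le> ln (max C 1 * exp (\<epsilon> / 2 * real n))"
        \<comment> \<open>HOL sets \<open>ln 0 = 0\<close>, so for the empty set the bound has to be
          at least 1; hence \<open>max C 1\<close>.\<close>
        proof (cases "card E = 0")
          case True
          have "1 \<le> exp (\<epsilon> / 2 * real n)" using \<open>\<epsilon> > 0\<close> by simp
          then have "1 * 1 \<le> max C 1 * exp (\<epsilon> / 2 * real n)" by (intro mult_mono) auto
          then show ?thesis using True by simp
        next
          case False
          then show ?thesis using cE by (subst ln_le_cancel_iff) (auto intro: mult_pos_pos)
        qed
        also have "\<dots> = ln (max C 1) + \<epsilon> / 2 * real n" by (simp add: ln_mult)
        also have "\<dots> \<le> \<epsilon> * real n"
          using elim \<open>\<epsilon> > 0\<close> by (simp add: field_simps)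
        finally show "ereal (ln (real (card E)) / real n) \<le> ereal \<epsilon>"
          using elim(2) by (simp add: field_simps)
      qed
    qed
    then show ?thesis by (rule Limsup_bounded)
  qed
  have "limsup (h \<delta>) = 0" if "\<delta> > 0" for \<delta>
  proof (rule antisym)
    show "limsup (h \<delta>) \<le> 0"
      by (rule ereal_le_epsilon2) (use upper[OF that] in auto)
    show "0 \<le> limsup (h \<delta>)"
      using Limsup_mono[of "\<lambda>_. 0" "h \<delta>" sequentially] lower by (simp add: Limsup_const)
  qed
  then show ?thesis
    unfolding topological_entropy_def h_def[symmetric] by simp
qed

subsection \<open>Homeomorphisms of circles\<close>

text \<open>An element in between would be counted below \<open>t\<close> but not below
  \<open>s\<close>. The left end is included because ranks count strictly smaller elements.\<close>

lemma not_mem_if_same_rank: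
  fixes B :: "real set"
  assumes "finite B" "card {a\<in>B. a < s} = card {a\<in>B. a < t}" "s \<le> u" "u < t"
  shows "u \<notin> B"
proof
  assume "u \<in> B"
  have "{a\<in>B. a < s} \<subset> {a\<in>B. a < t}"
  proof
    show "{a\<in>B. a < s} \<subseteq> {a\<in>B. a < t}" using assms(3,4) by auto
    have "u \<in> {a\<in>B. a < t} - {a\<in>B. a < s}" using \<open>u \<in> B\<close> assms(3,4) by auto
    then show "{a\<in>B. a < s} \<noteq> {a\<in>B. a < t}" by blast
  qed
  then show False
    using psubset_card_mono[of "{a\<in>B. a < t}" "{a\<in>B. a < s}"] assms(1,2) by simp
qed

lemma loops_subdivision:
  fixes g :: "nat \<Rightarrow> real \<Rightarrow> 'a::metric_space"
  assumes "finite I" "\<And>i. i \<in> I \<Longrightarrow> continuous_on {0..1} (g i)" "\<delta> > 0"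
  shows "\<exists>n::nat. n > 0 \<and> (\<forall>i\<in>I. \<forall>s\<in>{0..1}. \<forall>t\<in>{0..1}. \<bar>s - t\<bar> \<le> 1 / n \<longrightarrow> dist (g i s) (g i t) \<le> \<delta>)"
  using assms(1,2)
proof (induction I rule: finite_induct)
  case empty
  then show ?case by (auto intro: exI[of _ 1])
next
  case (insert i I)
  then obtain n where n: "n > 0"
    "\<And>i s t. i \<in> I \<Longrightarrow> s\<in>{0..1} \<Longrightarrow> t\<in>{0..1} \<Longrightarrow> \<bar>s - t\<bar> \<le> 1 / real n \<Longrightarrow> dist (g i s) (g i t) \<le> \<delta>"
    by auto
  have "uniformly_continuous_on {0..1} (g i)"
    using insert.prems by (intro compact_uniformly_continuous) auto
  then obtain e where e: "e > 0"
    "\<And>s t. s \<in> {0..1} \<Longrightarrow> t \<in> {0..1} \<Longrightarrow> dist s t < e \<Longrightarrow> dist (g i s) (g i t) < \<delta>"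
    using \<open>\<delta> > 0\<close> unfolding uniformly_continuous_on_def by metis
  obtain k :: nat where k: "k > 0" "1 / real k < e"
    using e(1) nat_approx_posE[of e] by (metis Suc_pred' zero_less_Suc)
  have le: "1 / real (n + k) \<le> 1 / real n" "1 / real (n + k) \<le> 1 / real k"
    using n(1) k(1) by (auto intro!: divide_left_mono)
  show ?case
  proof (intro exI[of _ "n + k"] conjI ballI impI)
    fix j s t
    assume j: "j \<in> insert i I" and st: "s \<in> {0..1}" "t \<in> {0..1}" "\<bar>s - t\<bar> \<le> 1 / real (n + k)"
    show "dist (g j s) (g j t) \<le> \<delta>"
    proof (cases "j = i")
      case True
      then show ?thesis using e(2)[OF st(1,2)] st(3) k(2) le(2) by (simp add: dist_real_def less_imp_le)
    next
      case False
      then show ?thesis using n(2)[of j s t] j st le(1) by auto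
    qed
  qed (use n(1) in simp)
qed

text \<open>The preimages of a finite subdivision cut the loops into linearly many arcs; an arc avoiding them
  has all its first \<open>n\<close> images inside single pieces of the subdivision.\<close>

theorem subexponential_loops:
  fixes f :: "'a::metric_space \<Rightarrow> 'a" and g :: "nat \<Rightarrow> real \<Rightarrow> 'a"
  assumes I: "finite I"
    and g: "\<And>i. i \<in> I \<Longrightarrow> continuous_on {0..1} (g i)" "\<And>i. i \<in> I \<Longrightarrow> g i 1 = g i 0"
      "\<And>i. i \<in> I \<Longrightarrow> inj_on (g i) {0..<1}"
    and disj: "\<And>i j. i \<in> I \<Longrightarrow> j \<in> I \<Longrightarrow> i \<noteq> j \<Longrightarrow> g i ` {0..1} \<inter> g j ` {0..1} = {}"
    and F: "F = (\<Union>i\<in>I. g i ` {0..1})"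
    and f: "continuous_on F f" "f ` F \<subseteq> F" "inj_on f F"
  shows "subexponential f F"
proof (rule subexponential_linear)
  fix \<delta> :: real
  assume "\<delta> > 0"
  from loops_subdivision[of I g, OF I g(1) this]
  obtain N :: nat where N: "N > 0" "\<And>i s t. i \<in> I \<Longrightarrow> s \<in> {0..1} \<Longrightarrow> t \<in> {0..1} \<Longrightarrow>
      \<bar>s - t\<bar> \<le> 1 / real N \<Longrightarrow> dist (g i s) (g i t) \<le> \<delta>" by auto
  \<comment> \<open>The marked points. On each loop \<open>j = 0\<close> and \<open>j = N\<close>
    give the same point, where the loop closes.\<close>
  define Q where "Q = (\<lambda>(i, j). g i (real j / real N)) ` (I \<times> {..N})"
  have Q: "finite Q" unfolding Q_def using I by simp
  have QI: "g i (real j / real N) \<in> Q" if "i \<in> I" "j \<le> N" for i j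
    unfolding Q_def using that by auto
  define J where "J j = {real j / real N .. real (Suc j) / real N}" for j
  define A where "A = (\<lambda>(i, j). g i ` J j)"
  have J01: "J j \<subseteq> {0..1}" if "j < N" for j
    using that N(1) unfolding J_def by (auto simp: field_simps)
  have closedA: "closed (A k)" if kI: "k \<in> I \<times> {..<N}" for k
  proof -
    obtain i j where k: "k = (i, j)" "i \<in> I" "j < N" using kI by auto
    have "compact (g i ` J j)"
      by (intro compact_continuous_image continuous_on_subset[OF g(1)[OF k(2)] J01[OF k(3)]])
        (simp add: J_def)
    then have "compact (A k)" by (simp add: A_def k)
    then show ?thesis by (rule compact_imp_closed)
  qed
  have FA: "\<exists>k\<in>I \<times> {..<N}. z \<in> A k" if zF: "z \<in> F" for z
  proof -
    obtain i s where i: "i \<in> I" "z = g i s" "0 \<le> s" "s \<le> 1" using zF F by auto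
    obtain t where t: "z = g i t" "0 \<le> t" "t < 1"
      using i g(2)[OF i(1)] by (cases "s = 1") auto
    define j where "j = nat \<lfloor>t * N\<rfloor>"
    have j: "real j \<le> t * N" "t * N < real j + 1"
    proof -
      have "0 \<le> t * real N" using t(2) by simp
      then have "real j = of_int \<lfloor>t * real N\<rfloor>" by (simp add: j_def)
      then show "real j \<le> t * N" "t * N < real j + 1" by linarith+
    qed
    have "t * real N < 1 * real N" using t(3) N(1) by (intro mult_strict_right_mono) auto
    then have "real j < real N" using j(1) by linarith
    then have "j < N" by simp
    moreover have "t \<in> J j" using j N(1) unfolding J_def by (auto simp: field_simps)
    ultimately show ?thesis using i(1) t(1) unfolding A_def by force
  qed
  have diamA: "dist x y \<le> \<delta>" if xy: "k \<in> I \<times> {..<N}" "x \<in> A k" "y \<in> A k" for k x y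
  proof -
    obtain i j s t where *: "i \<in> I" "j < N" "x = g i s" "y = g i t" "s \<in> J j" "t \<in> J j"
      using xy unfolding A_def by auto
    have "\<bar>s - t\<bar> \<le> 1 / real N"
      using *(5,6) unfolding J_def by (auto simp: add_divide_distrib abs_le_iff)
    then show ?thesis using N(2) * J01 by blast
  qed
  \<comment> \<open>Different pieces meet only in marked points: different loops are disjoint, and
    on one loop injectivity reduces the claim to parameter intervals. The parameter 1, outside the
    range of injectivity, is itself marked.\<close>
  have inter: "z \<in> Q" if k: "k \<in> I \<times> {..<N}" "k' \<in> I \<times> {..<N}" "k \<noteq> k'" "z \<in> A k" "z \<in> A k'" for k k' z
  proof -
    obtain i j i' j' where e: "k = (i, j)" "k' = (i', j')" by (meson surj_pair)
    have "z \<in> g i ` J j" "z \<in> g i' ` J j'" using k(4,5) unfolding A_def e by auto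
    then obtain s s' where s_s': "z = g i s" "s \<in> J j" "z = g i' s'" "s' \<in> J j'" by blast
    have ij: "i \<in> I" "j < N" "i' \<in> I" "j' < N" using k(1,2) e by auto
    note i = ij(1,2) s_s'(1,2) ij(3,4) s_s'(3,4)
    have s: "s \<in> {0..1}" "s' \<in> {0..1}" using J01 i by blast+
    have ii: "i = i'"
      using disj[of i i'] i s by blast
    consider "s = 1" | "s' = 1" | "s < 1" "s' < 1" using s by force
    then show ?thesis
    proof cases
      case 1
      then show ?thesis using QI[of i N] i N(1) by simp
    next
      case 2
      then show ?thesis using QI[of i' N] i N(1) by simp
    next
      case 3
      then have ss: "s = s'"
        using inj_onD[OF g(3)[OF i(1)], of s s'] i s ii by auto
      have "j \<noteq> j'" using k(3) e ii by simp
      then consider "Suc j \<le> j'" | "Suc j' \<le> j" by linarith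
      then show ?thesis
      proof cases
        case 1
        then have "real (Suc j) / real N \<le> real j' / real N" by (intro divide_right_mono) auto
        then have "s = real j' / real N" using i ss unfolding J_def by auto
        then show ?thesis using QI[of i j'] i by simp
      next
        case 2
        then have "real (Suc j') / real N \<le> real j / real N" by (intro divide_right_mono) auto
        then have "s = real j / real N" using i ss unfolding J_def by auto
        then show ?thesis using QI[of i j] i by simp
      qed
    qed
  qed
  \<comment> \<open>Off \<open>Q\<close> the finitely many closed pieces are disjoint, so a
    connected set avoiding \<open>Q\<close> stays in one of them.\<close>
  have conn: "dist x y \<le> \<delta>" if C: "connected C" "C \<subseteq> F - Q" "x \<in> C" "y \<in> C" for C x y
  proof -
    obtain k where k: "k \<in> I \<times> {..<N}" "x \<in> A k" using FA C by blast
    let ?B = "\<Union>k'\<in>I \<times> {..<N} - {k}. A k'"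
    have "closed ?B" using closedA I by (intro closed_UN) auto
    moreover have "C \<subseteq> A k \<union> ?B" using FA C(2) by blast
    moreover have "A k \<inter> ?B \<inter> C = {}" using inter k(1) C(2) by blast
    ultimately have "?B \<inter> C = {}"
      using connected_closedD[OF C(1), of "A k" ?B] closedA[OF k(1)] k(2) C(3) by blast
    then have "y \<in> A k" using \<open>C \<subseteq> A k \<union> ?B\<close> C(4) by blast
    then show ?thesis using diamA k by blast
  qed
  \<comment> \<open>Injective iterates keep each preimage of \<open>Q\<close> at most as large as
    \<open>Q\<close>; this is what makes the count linear in \<open>n\<close>.\<close>
  have fi: "inj_on (f ^^ j) F" for j
  proof (induction j)
    case (Suc j)
    have "(f ^^ j) ` F \<subseteq> F" using f(2) funpow_in[of F f] by blast
    then have "inj_on f ((f ^^ j) ` F)" using f(3) inj_on_subset by blast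
    then show ?case using comp_inj_on[OF Suc] by (simp add: o_def)
  qed simp
  have fF: "(f ^^ j) z \<in> F" if "z \<in> F" for z j
    using f(2) that by (intro funpow_in) auto
  have "F \<subseteq> (\<Union>i\<in>I. g i ` {0..<1})"
  proof
    fix z assume "z \<in> F"
    then obtain i s where i: "i \<in> I" "z = g i s" "0 \<le> s" "s \<le> 1" using F by auto
    show "z \<in> (\<Union>i\<in>I. g i ` {0..<1})"
      using i g(2)[OF i(1)] by (cases "s = 1") force+
  qed
  then have "\<forall>z\<in>F. \<exists>p. fst p \<in> I \<and> snd p \<in> {0..<1} \<and> g (fst p) (snd p) = z" by fastforce
  from bchoice[OF this] obtain h where h: "\<And>z. z \<in> F \<Longrightarrow>
    fst (h z) \<in> I \<and> snd (h z) \<in> {0..<1} \<and> g (fst (h z)) (snd (h z)) = z" by blast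
  define ix par where "ix z = fst (h z)" and "par z = snd (h z)" for z
  have par: "ix z \<in> I" "par z \<in> {0..<1}" "g (ix z) (par z) = z" if "z \<in> F" for z
    using h[OF that] by (auto simp: ix_def par_def)
  have "orbit_coded f F n \<delta> (2 * card I * card Q * n + 2 * card I)" for n
  proof -
    define P where "P = (\<Union>j<n. (f ^^ j) -` Q \<inter> F)"
    have P: "finite P" "card P \<le> n * card Q"
    proof -
      show "finite P"
        unfolding P_def by (intro finite_UN_I finite_vimage_IntI[OF Q fi]) simp
      have "card P \<le> (\<Sum>j<n. card ((f ^^ j) -` Q \<inter> F))"
        unfolding P_def by (rule card_UN_le) simp
      also have "\<dots> \<le> (\<Sum>j<n. card Q)"
        by (rule sum_mono) (rule card_vimage_inj_on_le[OF fi Q])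
      finally show "card P \<le> n * card Q" by simp
    qed
    define B where "B i = g i -` P \<inter> {0..<1}" for i
    have B: "finite (B i)" "card (B i) \<le> n * card Q" if "i \<in> I" for i
      unfolding B_def using finite_vimage_IntI[OF P(1) g(3)[OF that]]
        card_vimage_inj_on_le[OF g(3)[OF that] P(1)] P(2) by auto
    show ?thesis
    \<comment> \<open>The code of a point: its loop, the number of cut points before it, and whether
      it is a cut point. The last entry settles the right end of an arc, which equality of ranks
      leaves open.\<close>
    proof (rule orbit_codedI[where A = "I \<times> {..n * card Q} \<times> (UNIV :: bool set)"
          and g = "\<lambda>z. (ix z, card {a \<in> B (ix z). a < par z}, par z \<in> B (ix z))"])
      show "(\<lambda>z. (ix z, card {a \<in> B (ix z). a < par z}, par z \<in> B (ix z))) ` F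
          \<subseteq> I \<times> {..n * card Q} \<times> UNIV"
      proof (clarsimp simp: par(1))
        fix z assume "z \<in> F"
        then have "card {a \<in> B (ix z). a < par z} \<le> card (B (ix z))"
          using B(1) par(1) by (intro card_mono) auto
        then show "card {a \<in> B (ix z). a < par z} \<le> n * card Q"
          using B(2)[OF par(1)[OF \<open>z \<in> F\<close>]] by linarith
      qed
    next
      have *: "dist ((f ^^ j) x) ((f ^^ j) y) \<le> \<delta>"
        if x: "x \<in> F" and y: "y \<in> F" and e: "ix x = ix y" "par x \<le> par y"
          "card {a \<in> B (ix x). a < par x} = card {a \<in> B (ix x). a < par y}"
          "par x \<in> B (ix x) \<longleftrightarrow> par y \<in> B (ix x)" and j: "j < n" for x y j
      proof (cases "par x = par y")
        case True
        then have "x = y" using par(3)[OF x] par(3)[OF y] e(1) by metis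
        then show ?thesis using \<open>\<delta> > 0\<close> by simp
      next
        case False
        define i where "i = ix x"
        have i: "i \<in> I" using par(1) x i_def by blast
        have nb: "u \<notin> B i" if "u \<in> {par x..par y}" for u
        proof (cases "u = par y")
          case True
          have "par x \<notin> B i"
            using not_mem_if_same_rank[OF B(1)[OF i], of "par x" "par y" "par x"] e(2,3) False
            unfolding i_def by simp
          then show ?thesis using True e(4) i_def by simp
        next
          case False
          then show ?thesis
            using not_mem_if_same_rank[OF B(1)[OF i], of "par x" "par y" u] that e(3)
            unfolding i_def by simp
        qed
        have sub: "{par x..par y} \<subseteq> {0..<1}" using par(2)[OF x] par(2)[OF y] by auto
        then have sub1: "{par x..par y} \<subseteq> {0..1}" by auto
        \<comment> \<open>The arc from \<open>x\<close> to \<open>y\<close> misses \<open>P\<close>,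
          so its image under the \<open>j\<close>-th iterate misses \<open>Q\<close> and
          \<open>conn\<close> applies.\<close>
        let ?C = "g i ` {par x..par y}"
        have CF: "?C \<subseteq> F" using sub1 i F by blast
        have "connected ?C"
          by (intro connected_continuous_image connected_Icc continuous_on_subset[OF g(1)[OF i] sub1])
        moreover have "continuous_on ?C (f ^^ j)"
          using continuous_on_funpow[OF f(1,2)] CF continuous_on_subset by blast
        ultimately have "connected ((f ^^ j) ` ?C)" using connected_continuous_image by blast
        moreover have "(f ^^ j) ` ?C \<subseteq> F - Q"
        proof
          fix v assume "v \<in> (f ^^ j) ` ?C"
          then obtain u where u: "u \<in> {par x..par y}" "v = (f ^^ j) (g i u)" by blast
          have "g i u \<in> F" using u CF by blast
          moreover have "g i u \<notin> P" using nb[OF u(1)] u(1) sub unfolding B_def by blast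
          ultimately show "v \<in> F - Q" using u(2) fF j unfolding P_def by blast
        qed
        moreover have "x \<in> ?C"
          by (rule image_eqI[of _ _ "par x"]) (use par(3)[OF x] e(2) in \<open>simp_all add: i_def\<close>)
        moreover have "y \<in> ?C"
          by (rule image_eqI[of _ _ "par y"]) (use par(3)[OF y] e(1,2) in \<open>simp_all add: i_def\<close>)
        ultimately show ?thesis by (intro conn[of "(f ^^ j) ` ?C"]) auto
      qed
      fix x y j
      assume x: "x \<in> F" and y: "y \<in> F" and j: "j < n"
        and "(ix x, card {a \<in> B (ix x). a < par x}, par x \<in> B (ix x)) =
             (ix y, card {a \<in> B (ix y). a < par y}, par y \<in> B (ix y))"
      then have e: "ix x = ix y" "card {a \<in> B (ix x). a < par x} = card {a \<in> B (ix x). a < par y}"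
          "par x \<in> B (ix x) \<longleftrightarrow> par y \<in> B (ix x)" by auto
      show "dist ((f ^^ j) x) ((f ^^ j) y) \<le> \<delta>"
      proof (cases "par x \<le> par y")
        case True
        then show ?thesis using * x y j e by blast
      next
        case False
        then show ?thesis using *[OF y x, of j] j e by (simp add: dist_commute)
      qed
    next
      show "finite (I \<times> {..n * card Q} \<times> (UNIV :: bool set))" using I by simp
      show "card (I \<times> {..n * card Q} \<times> (UNIV :: bool set)) \<le> 2 * card I * card Q * n + 2 * card I"
        by (simp add: card_cartesian_product algebra_simps)
    qed
  qed
  then show "\<exists>a b. \<forall>n. orbit_coded f F n \<delta> (a * n + b)" by blast
qed

subsection \<open>Functions of class \<open>C\<^sup>k\<close>\<close>

abbreviation dderiv :: "'a::real_normed_vector \<Rightarrow> ('a \<Rightarrow> 'b::real_normed_vector) \<Rightarrow> 'a \<Rightarrow> 'b" where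
  "dderiv v F x \<equiv> frechet_derivative F (at x) v"

text \<open>\<open>frechet_derivative\<close> is a choice among the derivatives at the point, and
  functions agreeing near it have the same derivatives; so the equality holds even where none
  exists.\<close>

lemma frechet_derivative_eq_on_open:
  assumes "open U" "x \<in> U" "\<And>y. y \<in> U \<Longrightarrow> f y = g y"
  shows "frechet_derivative f (at x) = frechet_derivative g (at x)"
proof -
  have "(f has_derivative D) (at x) \<longleftrightarrow> (g has_derivative D) (at x)" for D
    using has_derivative_transform_within_open[of f D x UNIV U g]
      has_derivative_transform_within_open[of g D x UNIV U f] assms by auto
  then show ?thesis unfolding frechet_derivative_def by simp
qed

lemma higher_differentiable_on_cong:
  assumes "open U" "\<And>y. y \<in> U \<Longrightarrow> f y = g y" "higher_differentiable_on U f n"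
  shows "higher_differentiable_on U g n"
  using assms(2,3)
proof (induction n arbitrary: f g)
  case 0
  then show ?case using continuous_on_cong[of U U f g] by simp
next
  case (Suc n)
  have "g differentiable (at x)" if "x \<in> U" for x
  proof -
    have "f differentiable (at x)" using Suc.prems(2) that by simp
    then obtain D where "(f has_derivative D) (at x)" unfolding differentiable_def by blast
    then have "(g has_derivative D) (at x)"
      by (rule has_derivative_transform_within_open[OF _ assms(1) that Suc.prems(1)])
    then show ?thesis unfolding differentiable_def by blast
  qed
  moreover have "higher_differentiable_on U (\<lambda>x. dderiv v g x) n" for v
  proof (rule Suc.IH)
    show "higher_differentiable_on U (\<lambda>x. dderiv v f x) n" using Suc.prems by simp
    show "dderiv v f y = dderiv v g y" if "y \<in> U" for y
      using frechet_derivative_eq_on_open[OF assms(1) that Suc.prems(1)] by simp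
  qed
  ultimately show ?case by simp
qed

lemma higher_differentiable_on_subset:
  "higher_differentiable_on U f n \<Longrightarrow> V \<subseteq> U \<Longrightarrow> higher_differentiable_on V f n"
  by (induction n arbitrary: f) (auto intro: continuous_on_subset)

lemma higher_differentiable_on_local:
  assumes "\<And>x. x \<in> S \<Longrightarrow> \<exists>U. open U \<and> x \<in> U \<and> higher_differentiable_on U f n"
  shows "higher_differentiable_on S f n"
  using assms
proof (induction n arbitrary: f)
  case 0
  show ?case
    unfolding higher_differentiable_on.simps
  proof (rule continuous_at_imp_continuous_on, rule ballI)
    fix x assume "x \<in> S"
    from 0[OF this] obtain U where "open U" "x \<in> U" "continuous_on U f" by auto
    then show "isCont f x" using continuous_on_eq_continuous_at by blast
  qed
next
  case (Suc n)
  have "f differentiable (at x)" if "x \<in> S" for x using Suc.prems[OF that] by auto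
  moreover have "higher_differentiable_on S (\<lambda>x. dderiv v f x) n" for v
  proof (rule Suc.IH)
    fix x assume "x \<in> S"
    from Suc.prems[OF this] show "\<exists>U. open U \<and> x \<in> U \<and> higher_differentiable_on U (\<lambda>x. dderiv v f x) n"
      by auto
  qed
  ultimately show ?case by simp
qed

lemma Ck_on_extension:
  assumes "Ck_on k S f" "enat n \<le> k" "x \<in> S"
  obtains U g where "open U" "x \<in> U" "\<And>m. m \<le> n \<Longrightarrow> higher_differentiable_on U g m"
    "\<And>y. y \<in> S \<inter> U \<Longrightarrow> g y = f y"
proof -
  obtain U g where U: "open U" "x \<in> U" "\<forall>n. enat n \<le> k \<longrightarrow> higher_differentiable_on U g n"
    "\<forall>y\<in>S \<inter> U. g y = f y"
    using assms(1,3) unfolding Ck_on_def by metis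
  have "higher_differentiable_on U g m" if "m \<le> n" for m
    using U(3) that assms(2) by (meson enat_ord_simps(1) order_trans)
  then show ?thesis using that U by blast
qed

lemma Ck_on_imp_higher_differentiable_on:
  assumes "Ck_on k S f" "enat n \<le> k" "open V" "V \<subseteq> S"
  shows "higher_differentiable_on V f n"
proof (rule higher_differentiable_on_local)
  fix x assume "x \<in> V"
  then obtain U g where U: "open U" "x \<in> U" "\<And>m. m \<le> n \<Longrightarrow> higher_differentiable_on U g m"
    "\<And>y. y \<in> S \<inter> U \<Longrightarrow> g y = f y"
    using Ck_on_extension[OF assms(1,2)] assms(4) by blast
  have "higher_differentiable_on (U \<inter> V) f n"
    by (rule higher_differentiable_on_cong[of _ g])
      (use U assms(3,4) in \<open>auto intro: higher_differentiable_on_subset\<close>)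
  then show "\<exists>U. open U \<and> x \<in> U \<and> higher_differentiable_on U f n"
    using U assms(3) \<open>x \<in> V\<close> by (intro exI[of _ "U \<inter> V"]) auto
qed

lemma Ck_on_imp_continuous_on:
  assumes "Ck_on k S f"
  shows "continuous_on S f"
  unfolding continuous_on_eq_continuous_within
proof
  fix x assume "x \<in> S"
  have "enat 0 \<le> k" by (simp add: zero_enat_def[symmetric])
  then obtain U g where U: "open U" "x \<in> U" "\<And>m. m \<le> 0 \<Longrightarrow> higher_differentiable_on U g m"
    "\<And>y. y \<in> S \<inter> U \<Longrightarrow> g y = f y"
    using Ck_on_extension[OF assms _ \<open>x \<in> S\<close>] by blast
  have "continuous_on U g" using U(3)[of 0] by simp
  then have "isCont g x" using U(1,2) continuous_on_eq_continuous_at by blast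
  then have "continuous (at x within S) g" by (rule continuous_at_imp_continuous_at_within)
  then show "continuous (at x within S) f"
    by (rule continuous_transform_within_openin[where S = "S \<inter> U"])
      (use U \<open>x \<in> S\<close> in \<open>auto intro: openin_open_Int\<close>)
qed

lemma has_derivative_dderiv:
  assumes "higher_differentiable_on U f (Suc n)" "x \<in> U"
  shows "(f has_derivative (\<lambda>h. dderiv h f x)) (at x)"
  using assms frechet_derivative_works[of f "at x"] by simp

lemma higher_differentiable_on_dderiv:
  "higher_differentiable_on U f (Suc n) \<Longrightarrow> higher_differentiable_on U (dderiv v f) n"
  by simp

text \<open>On \<open>V\<close> the derivatives agree with those of a C^2 extension, which are
  continuous at \<open>x\<close>. The bound thus reaches points of \<open>S\<close> on the edge of
  \<open>V\<close>; it serves to bound the vorticity gradient near the walls.\<close>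

lemma Ck_on_bounded_second_derivative:
  assumes "Ck_on k S f" "2 \<le> k" "open V" "V \<subseteq> S" "x \<in> S"
  shows "\<exists>U B. open U \<and> x \<in> U \<and> (\<forall>y\<in>U \<inter> V. norm (dderiv v (dderiv w f) y) \<le> B)"
proof -
  have "enat 2 \<le> k" using assms(2) by (simp add: numeral_eq_enat)
  from Ck_on_extension[OF assms(1) this assms(5)]
  obtain U g where U: "open U" "x \<in> U" "\<And>m. m \<le> 2 \<Longrightarrow> higher_differentiable_on U g m"
    "\<And>y. y \<in> S \<inter> U \<Longrightarrow> g y = f y" by blast
  have "continuous_on U (dderiv v (dderiv w g))"
    using U(3)[of 2] by (simp add: numeral_2_eq_2)
  then have "isCont (dderiv v (dderiv w g)) x" using U(1,2) continuous_on_eq_continuous_at by blast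
  then obtain d where d: "d > 0"
    "\<And>y. dist y x < d \<Longrightarrow> dist (dderiv v (dderiv w g) y) (dderiv v (dderiv w g) x) < 1"
    unfolding continuous_at_eps_delta by (meson zero_less_one)
  have eq: "dderiv v (dderiv w f) y = dderiv v (dderiv w g) y" if "y \<in> U \<inter> V" for y
  proof -
    have 1: "dderiv w f z = dderiv w g z" if "z \<in> U \<inter> V" for z
      using frechet_derivative_eq_on_open[of "U \<inter> V" z f g] that U assms(3,4) by fastforce
    show ?thesis
      using frechet_derivative_eq_on_open[OF open_Int[OF U(1) assms(3)] that 1] by simp
  qed
  have "norm (dderiv v (dderiv w f) y) \<le> norm (dderiv v (dderiv w g) x) + 1"
    if "y \<in> U \<inter> ball x d \<inter> V" for y
  proof -
    have "dist (dderiv v (dderiv w g) y) (dderiv v (dderiv w g) x) < 1"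
      using d(2)[of y] that by (simp add: dist_commute)
    then show ?thesis
      using eq[of y] that norm_triangle_ineq2[of "dderiv v (dderiv w g) y" "dderiv v (dderiv w g) x"]
      by (simp add: dist_norm)
  qed
  then show ?thesis
    using U(1,2) d(1) by (intro exI[of _ "U \<inter> ball x d"] exI[of _ "norm (dderiv v (dderiv w g) x) + 1"]) auto
qed

section \<open>Linearization bounds and symmetry of second derivatives\<close>

lemma vector_derivative_bound_linearization:
  fixes f :: "real \<Rightarrow> 'a::real_normed_vector"
  assumes "0 \<le> s" and f: "\<And>x. x \<in> {0..s} \<Longrightarrow> (f has_vector_derivative f' x) (at x within {0..s})"
    and B: "\<And>x. x \<in> {0..s} \<Longrightarrow> norm (f' x - c) \<le> B"
  shows "norm (f s - f 0 - s *\<^sub>R c) \<le> B * s"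
proof -
  define g where "g x = f x - x *\<^sub>R c" for x
  have "norm (g s - g 0) \<le> B * norm (s - 0)"
  proof (rule differentiable_bound)
    show "convex {0..s}" by simp
    show "(g has_derivative (\<lambda>h. h *\<^sub>R (f' x - c))) (at x within {0..s})" if "x \<in> {0..s}" for x
      unfolding g_def using f[OF that] unfolding has_vector_derivative_def
      by (auto intro!: derivative_eq_intros simp: algebra_simps)
    show "onorm (\<lambda>h. h *\<^sub>R (f' x - c)) \<le> B" if "x \<in> {0..s}" for x
      using B[OF that] onorm_scaleR_left[OF bounded_linear_ident, of "f' x - c"] by (simp add: onorm_id)
  qed (use assms(1) in auto)
  then show ?thesis using assms(1) by (simp add: g_def algebra_simps)
qed

lemma has_vector_derivative_along_line:
  assumes "higher_differentiable_on U f (Suc n)" "p + x *\<^sub>R v \<in> U"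
  shows "((\<lambda>\<sigma>. f (p + \<sigma> *\<^sub>R v)) has_vector_derivative dderiv v f (p + x *\<^sub>R v)) (at x within T)"
proof -
  have "((\<lambda>\<sigma>. p + \<sigma> *\<^sub>R v) has_derivative (\<lambda>h. h *\<^sub>R v)) (at x within T)"
    by (auto intro!: derivative_eq_intros)
  from has_derivative_compose[OF this has_derivative_dderiv[OF assms]]
  have "((\<lambda>\<sigma>. f (p + \<sigma> *\<^sub>R v)) has_derivative (\<lambda>h. dderiv (h *\<^sub>R v) f (p + x *\<^sub>R v))) (at x within T)" .
  moreover have "dderiv (h *\<^sub>R v) f (p + x *\<^sub>R v) = h *\<^sub>R dderiv v f (p + x *\<^sub>R v)" for h
    using has_derivative_linear[OF has_derivative_dderiv[OF assms]] by (rule linear_scale)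
  ultimately show ?thesis unfolding has_vector_derivative_def by simp
qed

text \<open>The second difference is an increment of \<open>G\<close>, and the derivative of
  \<open>G\<close> is an increment of \<open>dderiv v f\<close> in direction \<open>w\<close>. The
  mean value inequality is applied once to each.\<close>

lemma second_difference_bound:
  assumes U: "higher_differentiable_on U f 2"
    and s: "0 \<le> s" "\<And>\<sigma> \<tau>. \<sigma> \<in> {0..s} \<Longrightarrow> \<tau> \<in> {0..s} \<Longrightarrow> p + \<sigma> *\<^sub>R v + \<tau> *\<^sub>R w \<in> U"
    and e: "\<And>\<sigma> \<tau>. \<sigma> \<in> {0..s} \<Longrightarrow> \<tau> \<in> {0..s} \<Longrightarrow>
      norm (dderiv w (dderiv v f) (p + \<sigma> *\<^sub>R v + \<tau> *\<^sub>R w) - c) \<le> e"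
  shows "norm (f (p + s *\<^sub>R v + s *\<^sub>R w) - f (p + s *\<^sub>R v) - f (p + s *\<^sub>R w) + f p - (s * s) *\<^sub>R c) \<le> e * s * s"
proof -
  have U1: "higher_differentiable_on U f (Suc (Suc 0))" using U by (simp only: numeral_2_eq_2)
  have U2: "higher_differentiable_on U (dderiv v f) (Suc 0)" using U1 by simp
  define G where "G \<sigma> = f (p + \<sigma> *\<^sub>R v + s *\<^sub>R w) - f (p + \<sigma> *\<^sub>R v)" for \<sigma>
  define G' where "G' \<sigma> = dderiv v f (p + \<sigma> *\<^sub>R v + s *\<^sub>R w) - dderiv v f (p + \<sigma> *\<^sub>R v)" for \<sigma>
  have "norm (G s - G 0 - s *\<^sub>R (s *\<^sub>R c)) \<le> (e * s) * s"
  proof (rule vector_derivative_bound_linearization[where f' = G'])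
    fix \<sigma> assume \<sigma>: "\<sigma> \<in> {0..s}"
    have "p + s *\<^sub>R w + \<sigma> *\<^sub>R v \<in> U" "p + \<sigma> *\<^sub>R v \<in> U"
      using s(2)[OF \<sigma>, of s] s(2)[OF \<sigma>, of 0] s(1) by (simp_all add: add_ac)
    from this[THEN has_vector_derivative_along_line[OF U1, of _ _ _ "{0..s}"]]
    show "(G has_vector_derivative G' \<sigma>) (at \<sigma> within {0..s})"
      unfolding G_def G'_def by (auto intro!: derivative_eq_intros simp: add_ac)
    have "norm (dderiv v f (p + \<sigma> *\<^sub>R v + s *\<^sub>R w) - dderiv v f (p + \<sigma> *\<^sub>R v + 0 *\<^sub>R w) - s *\<^sub>R c) \<le> e * s"
    proof (rule vector_derivative_bound_linearization
        [where f = "\<lambda>\<tau>. dderiv v f (p + \<sigma> *\<^sub>R v + \<tau> *\<^sub>R w)"])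
      fix \<tau> assume "\<tau> \<in> {0..s}"
      then show "((\<lambda>\<tau>. dderiv v f (p + \<sigma> *\<^sub>R v + \<tau> *\<^sub>R w)) has_vector_derivative
          dderiv w (dderiv v f) (p + \<sigma> *\<^sub>R v + \<tau> *\<^sub>R w)) (at \<tau> within {0..s})"
        using has_vector_derivative_along_line[OF U2] s(2)[OF \<sigma>] by blast
    qed (use s(1) e \<sigma> in auto)
    then show "norm (G' \<sigma> - s *\<^sub>R c) \<le> e * s" unfolding G'_def by simp
  qed (rule s(1))
  then show ?thesis unfolding G_def by (simp add: algebra_simps)
qed

text \<open>The second difference is symmetric in \<open>v\<close> and \<open>w\<close>, and it
  approximates \<open>s * s\<close> times either mixed derivative.\<close>

lemma dderiv_commute:
  assumes U: "open U" "higher_differentiable_on U f 2" "p \<in> U"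
  shows "dderiv v (dderiv w f) p = dderiv w (dderiv v f) p"
proof (rule ccontr)
  assume ne: "dderiv v (dderiv w f) p \<noteq> dderiv w (dderiv v f) p"
  \<comment> \<open>A third of the supposed discrepancy: the two approximation errors together reach
    only \<open>2 * e\<close>, against \<open>3 * e\<close>.\<close>
  define e where "e = norm (dderiv v (dderiv w f) p - dderiv w (dderiv v f) p) / 3"
  have e: "e > 0" using ne by (simp add: e_def)
  have "continuous_on U (dderiv a (dderiv b f))" for a b
    using U(2) by (simp add: numeral_2_eq_2)
  then have "isCont (dderiv a (dderiv b f)) p" for a b
    using U(1,3) continuous_on_eq_continuous_at by blast
  then have ex: "\<exists>d>0. \<forall>y. dist y p < d \<longrightarrow> dist (dderiv a (dderiv b f) y) (dderiv a (dderiv b f) p) < e" for a b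
    using e unfolding continuous_at_eps_delta by simp
  from ex[where a = v and b = w] obtain d1 where d1: "d1 > 0"
    "\<forall>y. dist y p < d1 \<longrightarrow> dist (dderiv v (dderiv w f) y) (dderiv v (dderiv w f) p) < e"
    by (elim exE conjE)
  from ex[where a = w and b = v] obtain d2 where d2: "d2 > 0"
    "\<forall>y. dist y p < d2 \<longrightarrow> dist (dderiv w (dderiv v f) y) (dderiv w (dderiv v f) p) < e"
    by (elim exE conjE)
  obtain r where r: "r > 0" "ball p r \<subseteq> U" using openE[OF U(1,3)] by blast
  define m where "m = min r (min d1 d2)"
  have m: "m > 0" using r d1 d2 by (simp add: m_def)
  define K where "K = norm v + norm w + 1"
  have K: "K > 0" unfolding K_def by (smt (verit) norm_ge_zero)
  \<comment> \<open>Keeps the whole parallelogram spanned at \<open>p\<close> within distance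
    \<open>m / 2\<close> of \<open>p\<close>.\<close>
  define s where "s = m / (2 * K)"
  have s: "s > 0" using m K by (simp add: s_def)
  have near: "dist (p + \<sigma> *\<^sub>R a + \<tau> *\<^sub>R b) p < m"
    if "\<sigma> \<in> {0..s}" "\<tau> \<in> {0..s}" "norm a + norm b = norm v + norm w" for \<sigma> \<tau> a b
  proof -
    have "norm (\<sigma> *\<^sub>R a + \<tau> *\<^sub>R b) \<le> s * norm a + s * norm b"
      using that by (intro norm_triangle_le add_mono) (auto intro!: mult_right_mono)
    also have "\<dots> = s * (norm v + norm w)" using that(3) by (simp flip: distrib_left)
    also have "\<dots> \<le> s * K" using s by (intro mult_left_mono) (auto simp: K_def)
    also have "\<dots> = m / 2" using K by (simp add: s_def)
    also have "\<dots> < m" using m by simp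
    finally show ?thesis by (simp add: dist_norm add.assoc)
  qed
  have bd: "norm (f (p + s *\<^sub>R a + s *\<^sub>R b) - f (p + s *\<^sub>R a) - f (p + s *\<^sub>R b) + f p -
      (s * s) *\<^sub>R dderiv b (dderiv a f) p) \<le> e * s * s"
    if "norm a + norm b = norm v + norm w"
      and db: "\<And>y. dist y p < m \<Longrightarrow> dist (dderiv b (dderiv a f) y) (dderiv b (dderiv a f) p) < e" for a b
  proof (rule second_difference_bound[OF U(2)])
    fix \<sigma> \<tau> assume "\<sigma> \<in> {0..s}" "\<tau> \<in> {0..s}"
    note n = near[OF this that(1)]
    show "p + \<sigma> *\<^sub>R a + \<tau> *\<^sub>R b \<in> U" using n r(2) by (auto simp: m_def dist_commute)
    show "norm (dderiv b (dderiv a f) (p + \<sigma> *\<^sub>R a + \<tau> *\<^sub>R b) - dderiv b (dderiv a f) p) \<le> e"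
      using db[OF n] by (simp add: dist_norm)
  qed (use s in auto)
  let ?A = "f (p + s *\<^sub>R v + s *\<^sub>R w) - f (p + s *\<^sub>R v) - f (p + s *\<^sub>R w) + f p"
  have 1: "norm (?A - (s * s) *\<^sub>R dderiv w (dderiv v f) p) \<le> e * s * s"
    by (rule bd) (auto simp: m_def d2)
  have sw: "f (p + s *\<^sub>R w + s *\<^sub>R v) - f (p + s *\<^sub>R w) - f (p + s *\<^sub>R v) + f p = ?A"
    by (simp add: algebra_simps)
  have 2: "norm (?A - (s * s) *\<^sub>R dderiv v (dderiv w f) p) \<le> e * s * s"
    unfolding sw[symmetric] by (rule bd) (auto simp: m_def d1)
  have n1: "norm ((s * s) *\<^sub>R (dderiv v (dderiv w f) p - dderiv w (dderiv v f) p)) \<le> e * s * s + e * s * s"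
    using norm_triangle_ineq4[of "?A - (s * s) *\<^sub>R dderiv w (dderiv v f) p"
        "?A - (s * s) *\<^sub>R dderiv v (dderiv w f) p"] 1 2
    by (simp add: algebra_simps)
  have n2: "norm ((s * s) *\<^sub>R (dderiv v (dderiv w f) p - dderiv w (dderiv v f) p)) = (s * s) * (3 * e)"
    unfolding norm_scaleR using s by (simp add: e_def)
  have "(s * s) * (3 * e) \<le> (s * s) * (2 * e)"
    using n1[unfolded n2] by (simp add: algebra_simps)
  then have "3 * e \<le> 2 * e" using s by (metis mult_le_cancel_left_pos mult_pos_pos)
  then show False using e by simp
qed

subsection \<open>Level curves and the Euler equation\<close>

text \<open>The function \<open>w\<close> and a linear function increasing along the Hamiltonian
  direction at \<open>q\<close> are local coordinates, in which the level curve through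
  \<open>q\<close> is a straight segment. Its tangent is a multiple of the Hamiltonian field, with a
  small factor if the segment is short.\<close>

lemma level_curve:
  fixes w w1 w2 :: "complex \<Rightarrow> real"
  assumes U: "open U" "q \<in> U"
    and w: "\<And>z. z \<in> U \<Longrightarrow> (w has_derivative (\<lambda>h. w1 z * Re h + w2 z * Im h)) (at z)"
    and cont: "continuous_on U w1" "continuous_on U w2"
    and nz: "w1 q \<noteq> 0 \<or> w2 q \<noteq> 0" and "\<tau> > 0"
  obtains W where "open W" "q \<in> W" "W \<subseteq> U"
    "\<And>x. x \<in> W \<Longrightarrow> w x = w q \<Longrightarrow>
      \<exists>\<gamma> h. \<gamma> 0 = q \<and> \<gamma> 1 = x \<and> (\<forall>t\<in>{0..1}. \<gamma> t \<in> U \<and> \<bar>h t\<bar> \<le> \<tau> \<and>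
        (\<gamma> has_vector_derivative h t *\<^sub>R Complex (- w2 (\<gamma> t)) (w1 (\<gamma> t))) (at t within {0..1}))"
proof -
  define a b where "a = w1 q" and "b = w2 q"
  define r where "r = a * a + b * b"
  have r: "r > 0" using nz unfolding r_def a_def b_def by (metis not_sum_squares_lt_zero sum_squares_eq_zero_iff less_linear)
  define \<Psi> where "\<Psi> z = Complex (a * Im z - b * Re z) (w z)" for z
  \<comment> \<open>\<open>l0\<close>, \<open>l1\<close>, \<open>l2\<close> assemble the derivative
    of \<open>\<Psi>\<close>, so that its continuity reduces to that of \<open>w1\<close> and
    \<open>w2\<close>; \<open>l3\<close> is its inverse at \<open>q\<close>.\<close>
  define l0 l1 l2 l3 :: "complex \<Rightarrow> complex" where
    "l0 h = Complex (a * Im h - b * Re h) 0" and "l1 h = Complex 0 (Re h)" and "l2 h = Complex 0 (Im h)"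
    and "l3 h = Complex ((a * Im h - b * Re h) / r) ((a * Re h + b * Im h) / r)" for h
  have bl: "bounded_linear l0" "bounded_linear l1" "bounded_linear l2" "bounded_linear l3"
    unfolding linear_conv_bounded_linear[symmetric] l0_def l1_def l2_def l3_def
    by (auto intro!: linearI simp: complex_eq_iff algebra_simps add_divide_distrib diff_divide_distrib)
  define \<Psi>' where "\<Psi>' z = Blinfun l0 + w1 z *\<^sub>R Blinfun l1 + w2 z *\<^sub>R Blinfun l2" for z
  have \<Psi>': "blinfun_apply (\<Psi>' z) h = Complex (a * Im h - b * Re h) (w1 z * Re h + w2 z * Im h)" for z h
    unfolding \<Psi>'_def
    by (simp add: blinfun.add_left blinfun.scaleR_left bounded_linear_Blinfun_apply bl)
      (simp add: l0_def l1_def l2_def complex_eq_iff)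
  have der: "(\<Psi> has_derivative blinfun_apply (\<Psi>' z)) (at z)" if "z \<in> U" for z
  proof -
    have e: "\<Psi> = (\<lambda>z. (a * Im z - b * Re z) *\<^sub>R 1 + w z *\<^sub>R \<i>)"
      by (auto simp: \<Psi>_def complex_eq_iff)
    have "((\<lambda>z. (a * Im z - b * Re z) *\<^sub>R (1::complex) + w z *\<^sub>R \<i>) has_derivative
        (\<lambda>h. (a * Im h - b * Re h) *\<^sub>R 1 + (w1 z * Re h + w2 z * Im h) *\<^sub>R \<i>)) (at z)"
      by (intro has_derivative_add has_derivative_scaleR_left has_derivative_diff
          has_derivative_mult_right has_derivative_Re has_derivative_Im has_derivative_ident w[OF that])
    moreover have "blinfun_apply (\<Psi>' z) = (\<lambda>h. (a * Im h - b * Re h) *\<^sub>R 1 + (w1 z * Re h + w2 z * Im h) *\<^sub>R \<i>)"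
      by (auto simp: \<Psi>' complex_eq_iff)
    ultimately show ?thesis unfolding e by simp
  qed
  have "continuous_on U \<Psi>'"
    unfolding \<Psi>'_def by (intro continuous_intros cont)
  moreover have "Blinfun l3 o\<^sub>L \<Psi>' q = id_blinfun"
  proof (rule blinfun_eqI)
    fix h
    have "l3 (blinfun_apply (\<Psi>' q) h) = h"
      unfolding \<Psi>' l3_def a_def[symmetric] b_def[symmetric]
      using r by (simp add: complex_eq_iff field_simps) (simp add: r_def algebra_simps)
    then show "blinfun_apply (Blinfun l3 o\<^sub>L \<Psi>' q) h = blinfun_apply id_blinfun h"
      by (simp add: bounded_linear_Blinfun_apply bl)
  qed
  ultimately obtain U' V g g' where U': "open U'" "U' \<subseteq> U" "q \<in> U'" and V: "open V" "\<Psi> q \<in> V"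
    and hom: "homeomorphism U' V \<Psi> g"
    and g: "\<And>y. y \<in> V \<Longrightarrow> (g has_derivative (g' y)) (at y)"
      "\<And>y. y \<in> V \<Longrightarrow> g' y = inv (blinfun_apply (\<Psi>' (g y)))"
      "\<And>y. y \<in> V \<Longrightarrow> bij (blinfun_apply (\<Psi>' (g y)))"
    using inverse_function_theorem[OF U(1) der _ U(2)] by metis
  \<comment> \<open>Minus the Jacobian determinant of \<open>\<Psi>\<close> at \<open>z\<close>; it
    equals \<open>r\<close> at \<open>q\<close>.\<close>
  define n where "n z = a * w1 z + b * w2 z" for z
  have "continuous_on U' n"
    unfolding n_def by (intro continuous_intros continuous_on_subset[OF cont(1) U'(2)] continuous_on_subset[OF cont(2) U'(2)])
  then have S: "open (U' \<inter> n -` {r / 2<..})"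
    using U'(1) by (intro continuous_open_preimage) auto
  have gV: "continuous_on V g" "g ` V = U'" and \<Psi>U: "continuous_on U' \<Psi>" and
    g\<Psi>: "\<And>x. x \<in> U' \<Longrightarrow> g (\<Psi> x) = x" "\<And>y. y \<in> V \<Longrightarrow> \<Psi> (g y) = y"
    using hom unfolding homeomorphism_def by auto
  have "open (V \<inter> g -` (U' \<inter> n -` {r / 2<..}))"
    by (rule continuous_open_preimage[OF gV(1) V(1) S])
  moreover have "n q = r" by (simp add: n_def a_def b_def r_def)
  then have "\<Psi> q \<in> V \<inter> g -` (U' \<inter> n -` {r / 2<..})"
    using V(2) U'(3) g\<Psi>(1) r by simp
  ultimately obtain \<rho> where \<rho>: "\<rho> > 0" "ball (\<Psi> q) \<rho> \<subseteq> V \<inter> g -` (U' \<inter> n -` {r / 2<..})"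
    by (rule openE)
  \<comment> \<open>With \<open>|s| < \<tau> * r / 2\<close> and \<open>n > r / 2\<close> the rate
    \<open>s / n\<close> is at most \<open>\<tau>\<close> in absolute value.\<close>
  define \<rho>' where "\<rho>' = min \<rho> (\<tau> * r / 2)"
  have \<rho>': "\<rho>' > 0" "\<rho>' \<le> \<rho>" "\<rho>' \<le> \<tau> * r / 2" using \<rho> r \<open>\<tau> > 0\<close> by (auto simp: \<rho>'_def)
  show ?thesis
  proof (rule that)
    show "open (U' \<inter> \<Psi> -` ball (\<Psi> q) \<rho>')"
      by (rule continuous_open_preimage[OF \<Psi>U U'(1)]) simp
    show "q \<in> U' \<inter> \<Psi> -` ball (\<Psi> q) \<rho>'" using U'(3) \<rho>'(1) by simp
    show "U' \<inter> \<Psi> -` ball (\<Psi> q) \<rho>' \<subseteq> U" using U'(2) by blast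
    fix x assume x: "x \<in> U' \<inter> \<Psi> -` ball (\<Psi> q) \<rho>'" and wx: "w x = w q"
    define s where "s = (a * Im x - b * Re x) - (a * Im q - b * Re q)"
    have \<Psi>x: "\<Psi> x = \<Psi> q + of_real s"
      using wx by (simp add: \<Psi>_def s_def complex_eq_iff)
    have s: "\<bar>s\<bar> < \<rho>'" using x \<Psi>x by (simp add: dist_norm)
    define y where "y t = \<Psi> q + of_real (t * s)" for t
    define \<gamma> where "\<gamma> t = g (y t)" for t
    have yb: "y t \<in> V" "\<gamma> t \<in> U'" "n (\<gamma> t) > r / 2" if "t \<in> {0..1}" for t
    proof -
      have "\<bar>t * s\<bar> \<le> 1 * \<bar>s\<bar>" using that by (simp add: abs_mult mult_left_le_one_le)
      then have "y t \<in> ball (\<Psi> q) \<rho>" using s \<rho>'(2) unfolding y_def by (simp add: dist_norm del: of_real_mult)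
      then show "y t \<in> V" "\<gamma> t \<in> U'" "n (\<gamma> t) > r / 2" using \<rho>(2) unfolding \<gamma>_def by auto
    qed
    have "(\<gamma> has_vector_derivative (s / n (\<gamma> t)) *\<^sub>R Complex (- w2 (\<gamma> t)) (w1 (\<gamma> t))) (at t within {0..1})"
      if t: "t \<in> {0..1}" for t
    proof -
      have "(y has_derivative (\<lambda>h. of_real (h * s))) (at t within {0..1})"
        unfolding y_def by (auto intro!: derivative_eq_intros)
      from has_derivative_compose[OF this g(1)[OF yb(1)[OF t]]]
      have d: "(\<gamma> has_derivative (\<lambda>h. g' (y t) (of_real (h * s)))) (at t within {0..1})"
        unfolding \<gamma>_def .
      \<comment> \<open>The velocity of the curve for unit speed in \<open>t\<close>. The two
        coordinates of \<open>\<Psi>'\<close> give a linear system for it, and eliminating either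
        unknown leaves the divisor \<open>n\<close>.\<close>
      define u where "u = g' (y t) (of_real s)"
      have "blinfun_apply (\<Psi>' (\<gamma> t)) u = of_real s"
        unfolding u_def g(2)[OF yb(1)[OF t]] \<gamma>_def
        using surj_f_inv_f[OF bij_is_surj[OF g(3)[OF yb(1)[OF t]]]] by simp
      then have 1: "a * Im u - b * Re u = s" and 2: "w1 (\<gamma> t) * Re u + w2 (\<gamma> t) * Im u = 0"
        unfolding \<Psi>' by (auto simp: complex_eq_iff)
      have n: "n (\<gamma> t) > 0" using yb(3)[OF t] r by linarith
      have 3: "w1 (\<gamma> t) * Re u = - (w2 (\<gamma> t) * Im u)" using 2 by linarith
      have 4: "w2 (\<gamma> t) * Im u = - (w1 (\<gamma> t) * Re u)" using 2 by linarith
      have "n (\<gamma> t) * Re u = a * (w1 (\<gamma> t) * Re u) + b * w2 (\<gamma> t) * Re u"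
        unfolding n_def by (simp add: algebra_simps)
      also have "\<dots> = - w2 (\<gamma> t) * (a * Im u - b * Re u)" unfolding 3 by (simp add: algebra_simps)
      finally have 5: "n (\<gamma> t) * Re u = - w2 (\<gamma> t) * s" unfolding 1 .
      have "n (\<gamma> t) * Im u = a * w1 (\<gamma> t) * Im u + b * (w2 (\<gamma> t) * Im u)"
        unfolding n_def by (simp add: algebra_simps)
      also have "\<dots> = w1 (\<gamma> t) * (a * Im u - b * Re u)" unfolding 4 by (simp add: algebra_simps)
      finally have "n (\<gamma> t) * Im u = w1 (\<gamma> t) * s" unfolding 1 .
      with 5 have u: "u = (s / n (\<gamma> t)) *\<^sub>R Complex (- w2 (\<gamma> t)) (w1 (\<gamma> t))"
        using n by (simp add: complex_eq_iff field_simps)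
      have "linear (g' (y t))" using g(1)[OF yb(1)[OF t]] by (rule has_derivative_linear)
      then have "g' (y t) (of_real (h * s)) = h *\<^sub>R u" for h
        unfolding u_def by (metis linear_scale of_real_mult scaleR_conv_of_real)
      then show ?thesis using d unfolding has_vector_derivative_def u by simp
    qed
    moreover have "\<bar>s / n (\<gamma> t)\<bar> \<le> \<tau>" if t: "t \<in> {0..1}" for t
    proof -
      have "\<bar>s\<bar> \<le> \<tau> * (r / 2)" using s \<rho>'(3) by simp
      also have "\<dots> \<le> \<tau> * n (\<gamma> t)" using yb(3)[OF t] \<open>\<tau> > 0\<close> by (intro mult_left_mono) auto
      finally show ?thesis using yb(3)[OF t] r by (simp add: abs_divide divide_le_eq)
    qed
    moreover have "y 0 = \<Psi> q" "y 1 = \<Psi> x"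
      unfolding \<Psi>x y_def by simp_all
    then have "\<gamma> 0 = q" "\<gamma> 1 = x"
      using g\<Psi>(1) U'(3) x unfolding \<gamma>_def by simp_all
    ultimately show "\<exists>\<gamma> h. \<gamma> 0 = q \<and> \<gamma> 1 = x \<and> (\<forall>t\<in>{0..1}. \<gamma> t \<in> U \<and> \<bar>h t\<bar> \<le> \<tau> \<and>
        (\<gamma> has_vector_derivative h t *\<^sub>R Complex (- w2 (\<gamma> t)) (w1 (\<gamma> t))) (at t within {0..1}))"
      using yb(2) U'(2) by (intro exI[of _ \<gamma>] exI[of _ "\<lambda>t. s / n (\<gamma> t)"]) auto
  qed
qed

text \<open>The rate \<open>h\<close> at which a level curve follows \<open>V\<close> is unchanged under \<open>f\<close>, which bounds the length of
  all its images.\<close>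

lemma level_set_stable:
  fixes w w1 w2 :: "complex \<Rightarrow> real" and f :: "complex \<Rightarrow> complex"
  defines "V \<equiv> \<lambda>z. Complex (- w2 z) (w1 z)"
  assumes R: "open R" "q \<in> R"
    and w: "\<And>z. z \<in> R \<Longrightarrow> (w has_derivative (\<lambda>h. w1 z * Re h + w2 z * Im h)) (at z)"
    and cont: "continuous_on R w1" "continuous_on R w2"
    and nz: "w1 q \<noteq> 0 \<or> w2 q \<noteq> 0"
    and f: "\<And>z. z \<in> R \<Longrightarrow> f z \<in> R" "\<And>z. z \<in> R \<Longrightarrow> (f has_derivative D z) (at z)"
      "\<And>z. z \<in> R \<Longrightarrow> D z (V z) = V (f z)"
    and B: "\<And>z. z \<in> R \<Longrightarrow> norm (V z) \<le> B"
    and "\<delta> > 0"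
  shows "\<exists>W. open W \<and> q \<in> W \<and> (\<forall>x\<in>W. w x = w q \<longrightarrow> (\<forall>i. dist ((f ^^ i) x) ((f ^^ i) q) \<le> \<delta>))"
proof -
  have B0: "0 \<le> B" using B[OF R(2)] norm_ge_zero order_trans by blast
  \<comment> \<open>A curve with rate at most \<open>\<tau>\<close> and field at most
    \<open>B\<close> has length at most \<open>\<tau> * B <= \<delta>\<close>; the added 1 keeps the
    denominator positive.\<close>
  define \<tau> where "\<tau> = \<delta> / (B + 1)"
  have \<tau>: "\<tau> > 0" "\<tau> * B \<le> \<delta>" using B0 \<open>\<delta> > 0\<close> by (auto simp: \<tau>_def field_simps)
  obtain W where W: "open W" "q \<in> W" "W \<subseteq> R"
    "\<And>x. x \<in> W \<Longrightarrow> w x = w q \<Longrightarrow>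
      \<exists>\<gamma> h. \<gamma> 0 = q \<and> \<gamma> 1 = x \<and> (\<forall>t\<in>{0..1}. \<gamma> t \<in> R \<and> \<bar>h t\<bar> \<le> \<tau> \<and>
        (\<gamma> has_vector_derivative h t *\<^sub>R V (\<gamma> t)) (at t within {0..1}))"
    using level_curve[OF R w cont nz \<tau>(1)] unfolding V_def by blast
  have "dist ((f ^^ i) x) ((f ^^ i) q) \<le> \<delta>" if x: "x \<in> W" "w x = w q" for x i
  proof -
    obtain \<gamma> h where \<gamma>: "\<gamma> 0 = q" "\<gamma> 1 = x" and h: "\<And>t. t \<in> {0..1} \<Longrightarrow> \<bar>h t\<bar> \<le> \<tau>"
      and \<gamma>R: "\<And>t. t \<in> {0..1} \<Longrightarrow> \<gamma> t \<in> R"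
      "\<And>t. t \<in> {0..1} \<Longrightarrow> (\<gamma> has_vector_derivative h t *\<^sub>R V (\<gamma> t)) (at t within {0..1})"
      using W(4)[OF x] by blast
    have iter: "(f ^^ i) (\<gamma> t) \<in> R \<and>
       ((\<lambda>t. (f ^^ i) (\<gamma> t)) has_vector_derivative h t *\<^sub>R V ((f ^^ i) (\<gamma> t))) (at t within {0..1})"
      if t: "t \<in> {0..1}" for t
    proof (induction i)
      case 0
      then show ?case using \<gamma>R t by simp
    next
      case (Suc i)
      let ?z = "(f ^^ i) (\<gamma> t)"
      have z: "?z \<in> R" using Suc by blast
      have "((\<lambda>t. (f ^^ i) (\<gamma> t)) has_derivative (\<lambda>k. k *\<^sub>R (h t *\<^sub>R V ?z))) (at t within {0..1})"
        using Suc unfolding has_vector_derivative_def by blast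
      from has_derivative_compose[OF this f(2)[OF z]]
      have 1: "((\<lambda>t. f ((f ^^ i) (\<gamma> t))) has_derivative (\<lambda>k. D ?z (k *\<^sub>R (h t *\<^sub>R V ?z)))) (at t within {0..1})" .
      have "linear (D ?z)" using f(2)[OF z] by (rule has_derivative_linear)
      then have "D ?z (k *\<^sub>R (h t *\<^sub>R V ?z)) = k *\<^sub>R (h t *\<^sub>R V (f ?z))" for k
        using f(3)[OF z] by (simp add: linear_scale)
      then show ?case using 1 f(1)[OF z] unfolding has_vector_derivative_def by simp
    qed
    have "norm ((f ^^ i) (\<gamma> 1) - (f ^^ i) (\<gamma> 0) - 1 *\<^sub>R 0) \<le> (\<tau> * B) * 1"
    proof (rule vector_derivative_bound_linearization)
      fix t :: real assume t: "t \<in> {0..1}"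
      show "((\<lambda>t. (f ^^ i) (\<gamma> t)) has_vector_derivative h t *\<^sub>R V ((f ^^ i) (\<gamma> t))) (at t within {0..1})"
        using iter[OF t] by blast
      show "norm (h t *\<^sub>R V ((f ^^ i) (\<gamma> t)) - 0) \<le> \<tau> * B"
        using h[OF t] B[of "(f ^^ i) (\<gamma> t)"] iter[OF t] \<tau>(1) B0 by (auto intro!: mult_mono)
    qed simp
    then show ?thesis using \<tau>(2) \<gamma> by (simp add: dist_norm)
  qed
  then show ?thesis using W(1,2) by blast
qed

section \<open>Vorticity transport and conservation of area\<close>

lemma dderiv_split:
  fixes F :: "complex \<times> real \<Rightarrow> 'b::real_normed_vector"
  assumes "higher_differentiable_on U F (Suc n)" "q \<in> U"
  shows "dderiv (x, s) F q = Re x *\<^sub>R dderiv (1, 0) F q + Im x *\<^sub>R dderiv (\<i>, 0) F q + s *\<^sub>R dderiv (0, 1) F q"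
proof -
  have l: "linear (\<lambda>h. dderiv h F q)"
    using has_derivative_dderiv[OF assms] by (rule has_derivative_linear)
  have "(x, s) = Re x *\<^sub>R (1, 0) + Im x *\<^sub>R (\<i>, 0) + s *\<^sub>R (0, 1)"
    by (simp add: complex_eq_iff)
  then have "dderiv (x, s) F q = dderiv (Re x *\<^sub>R (1, 0) + Im x *\<^sub>R (\<i>, 0) + s *\<^sub>R (0, 1)) F q" by simp
  then show ?thesis by (simp only: linear_add[OF l] linear_scale[OF l])
qed

text \<open>This is the curl of the momentum equation. The pressure drops out by symmetry of its
  second derivatives, and the terms quadratic in first derivatives of \<open>F\<close> combine to
  the divergence times \<open>\<zeta>\<close>. What remains is the derivative of
  \<open>\<zeta>\<close> along the path.\<close>

lemma euler_vorticity_transport: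
  fixes F :: "complex \<times> real \<Rightarrow> complex" and p :: "complex \<times> real \<Rightarrow> real"
  defines "\<zeta> \<equiv> \<lambda>q. Im (dderiv (1, 0) F q) - Re (dderiv (\<i>, 0) F q)"
  assumes \<Omega>: "open \<Omega>"
    and F: "higher_differentiable_on \<Omega> F 2" and p: "higher_differentiable_on \<Omega> p 2"
    and euler: "\<And>q. q \<in> \<Omega> \<Longrightarrow> dderiv (0, 1) F q + dderiv (F q, 0) F q =
       - Complex (dderiv (1, 0) p q) (dderiv (\<i>, 0) p q)"
    and div: "\<And>q. q \<in> \<Omega> \<Longrightarrow> Re (dderiv (1, 0) F q) + Im (dderiv (\<i>, 0) F q) = 0"
    and y: "(y t, t) \<in> \<Omega>" "(y has_vector_derivative F (y t, t)) (at t)"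
  shows "((\<lambda>s. \<zeta> (y s, s)) has_real_derivative 0) (at t)"
proof -
  have F2: "higher_differentiable_on \<Omega> F (Suc (Suc 0))" and p2: "higher_differentiable_on \<Omega> p (Suc (Suc 0))"
    using F p by (simp_all only: numeral_2_eq_2)
  have Fv: "higher_differentiable_on \<Omega> (dderiv v F) (Suc 0)"
    and pv: "higher_differentiable_on \<Omega> (dderiv v p) (Suc 0)" for v
    by (rule higher_differentiable_on_dderiv[OF F2] higher_differentiable_on_dderiv[OF p2])+
  define q where "q = (y t, t)"
  have q: "q \<in> \<Omega>" using y(1) by (simp add: q_def)
  define e1 e2 e3 :: "complex \<times> real" where "e1 = (1, 0)" and "e2 = (\<i>, 0)" and "e3 = (0, 1)"
  note e = e1_def[symmetric] e2_def[symmetric] e3_def[symmetric]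
  note F' = has_derivative_dderiv[OF F2 q] has_derivative_dderiv[OF Fv q]
  have eqs: "Im (dderiv e3 F z) + Re (F z) * Im (dderiv e1 F z) + Im (F z) * Im (dderiv e2 F z) = - dderiv e2 p z"
    "Re (dderiv e3 F z) + Re (F z) * Re (dderiv e1 F z) + Im (F z) * Re (dderiv e2 F z) = - dderiv e1 p z"
    if "z \<in> \<Omega>" for z
    using euler[OF that] unfolding dderiv_split[OF F2 that, of "F z" 0] e
    by (simp_all add: complex_eq_iff)
  have 1: "((\<lambda>z. Im (dderiv e3 F z) + Re (F z) * Im (dderiv e1 F z) + Im (F z) * Im (dderiv e2 F z)) has_derivative
     (\<lambda>h. Im (dderiv h (dderiv e3 F) q) + (Re (F q) * Im (dderiv h (dderiv e1 F) q) + Re (dderiv h F q) * Im (dderiv e1 F q))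
       + (Im (F q) * Im (dderiv h (dderiv e2 F) q) + Im (dderiv h F q) * Im (dderiv e2 F q)))) (at q)"
    by (intro has_derivative_add has_derivative_mult has_derivative_Re has_derivative_Im F')
  have 2: "((\<lambda>z. Re (dderiv e3 F z) + Re (F z) * Re (dderiv e1 F z) + Im (F z) * Re (dderiv e2 F z)) has_derivative
     (\<lambda>h. Re (dderiv h (dderiv e3 F) q) + (Re (F q) * Re (dderiv h (dderiv e1 F) q) + Re (dderiv h F q) * Re (dderiv e1 F q))
       + (Im (F q) * Re (dderiv h (dderiv e2 F) q) + Im (dderiv h F q) * Re (dderiv e2 F q)))) (at q)"
    by (intro has_derivative_add has_derivative_mult has_derivative_Re has_derivative_Im F')
  have 3: "((\<lambda>z. - dderiv v p z) has_derivative (\<lambda>h. - dderiv h (dderiv v p) q)) (at q)" for v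
    by (intro has_derivative_minus has_derivative_dderiv[OF pv q])
  \<comment> \<open>\<open>A\<close> is the second component of the equation differentiated in
    direction \<open>e1\<close>, \<open>B\<close> the first in direction \<open>e2\<close>; their
    difference is the curl.\<close>
  note A = fun_cong[OF has_derivative_unique[OF has_derivative_transform_within_open[OF 1 \<Omega> q eqs(1)] 3], of e1]
  note B = fun_cong[OF has_derivative_unique[OF has_derivative_transform_within_open[OF 2 \<Omega> q eqs(2)] 3], of e2]
  note comm = dderiv_commute[OF \<Omega> F q] dderiv_commute[OF \<Omega> p q]
  have c: "dderiv e1 (dderiv e3 F) q = dderiv e3 (dderiv e1 F) q" "dderiv e2 (dderiv e3 F) q = dderiv e3 (dderiv e2 F) q"
    "dderiv e1 (dderiv e2 F) q = dderiv e2 (dderiv e1 F) q" "dderiv e1 (dderiv e2 p) q = dderiv e2 (dderiv e1 p) q"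
    using comm by blast+
  have d: "Re (dderiv e1 F q) + Im (dderiv e2 F q) = 0" using div[OF q] unfolding e .
  have key: "Re (F q) * (Im (dderiv e1 (dderiv e1 F) q) - Re (dderiv e1 (dderiv e2 F) q))
     + Im (F q) * (Im (dderiv e2 (dderiv e1 F) q) - Re (dderiv e2 (dderiv e2 F) q))
     + (Im (dderiv e3 (dderiv e1 F) q) - Re (dderiv e3 (dderiv e2 F) q)) = 0"
    using A B d unfolding c by algebra
  have "((\<lambda>s. (y s, s)) has_derivative (\<lambda>h. (h *\<^sub>R F q, h))) (at t)"
    using y(2) unfolding has_vector_derivative_def q_def by (auto intro!: derivative_eq_intros)
  moreover have "(\<zeta> has_derivative (\<lambda>h. Im (dderiv h (dderiv e1 F) q) - Re (dderiv h (dderiv e2 F) q))) (at (y t, t))"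
    unfolding \<zeta>_def e q_def[symmetric]
    by (intro has_derivative_diff has_derivative_Re has_derivative_Im F')
  ultimately have "((\<lambda>s. \<zeta> (y s, s)) has_derivative
     (\<lambda>h. Im (dderiv (h *\<^sub>R F q, h) (dderiv e1 F) q) - Re (dderiv (h *\<^sub>R F q, h) (dderiv e2 F) q))) (at t)"
    by (rule has_derivative_compose)
  moreover have "Im (dderiv (h *\<^sub>R F q, h) (dderiv e1 F) q) - Re (dderiv (h *\<^sub>R F q, h) (dderiv e2 F) q) = 0" for h
  proof -
    have "Im (dderiv (h *\<^sub>R F q, h) (dderiv e1 F) q) - Re (dderiv (h *\<^sub>R F q, h) (dderiv e2 F) q) =
      h * (Re (F q) * (Im (dderiv e1 (dderiv e1 F) q) - Re (dderiv e1 (dderiv e2 F) q))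
     + Im (F q) * (Im (dderiv e2 (dderiv e1 F) q) - Re (dderiv e2 (dderiv e2 F) q))
     + (Im (dderiv e3 (dderiv e1 F) q) - Re (dderiv e3 (dderiv e2 F) q)))"
      unfolding dderiv_split[OF Fv q, of _ "h *\<^sub>R F q" h] e by (simp add: algebra_simps)
    then show ?thesis unfolding key by simp
  qed
  ultimately show ?thesis unfolding has_field_derivative_def by (simp add: lambda_zero)
qed

text \<open>Both columns of the spatial Jacobian solve the linearized flow equation, so the
  derivative of the determinant is the divergence times the determinant.\<close>

lemma liouville:
  fixes F \<Phi> :: "complex \<times> real \<Rightarrow> complex"
  assumes \<Omega>: "open \<Omega>" "higher_differentiable_on \<Omega> F (Suc n)"
    and D: "open D" "higher_differentiable_on D \<Phi> 2"
    and flow: "\<And>q. q \<in> D \<Longrightarrow> (\<Phi> q, snd q) \<in> \<Omega>" "\<And>q. q \<in> D \<Longrightarrow> dderiv (0, 1) \<Phi> q = F (\<Phi> q, snd q)"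
    and div: "\<And>q. q \<in> \<Omega> \<Longrightarrow> Re (dderiv (1, 0) F q) + Im (dderiv (\<i>, 0) F q) = 0"
    and zt: "(z, t) \<in> D"
  shows "((\<lambda>s. Re (dderiv (1, 0) \<Phi> (z, s)) * Im (dderiv (\<i>, 0) \<Phi> (z, s)) -
      Im (dderiv (1, 0) \<Phi> (z, s)) * Re (dderiv (\<i>, 0) \<Phi> (z, s))) has_real_derivative 0) (at t)"
proof -
  have D2: "higher_differentiable_on D \<Phi> (Suc (Suc 0))" using D(2) by (simp only: numeral_2_eq_2)
  have Dv: "higher_differentiable_on D (dderiv v \<Phi>) (Suc 0)" for v
    by (rule higher_differentiable_on_dderiv[OF D2])
  define q where "q = (z, t)"
  have q: "q \<in> D" using zt by (simp add: q_def)
  define Q where "Q = (\<Phi> q, snd q)"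
  have Q: "Q \<in> \<Omega>" using flow(1)[OF q] by (simp add: Q_def)
  define F1 F2 where "F1 = dderiv (1, 0) F Q" and "F2 = dderiv (\<i>, 0) F Q"
  have G: "((\<lambda>q. F (\<Phi> q, snd q)) has_derivative (\<lambda>h. dderiv (dderiv h \<Phi> q, snd h) F Q)) (at q)"
  proof (rule has_derivative_compose[where g = F and f = "\<lambda>q. (\<Phi> q, snd q)"])
    show "((\<lambda>q. (\<Phi> q, snd q)) has_derivative (\<lambda>h. (dderiv h \<Phi> q, snd h))) (at q)"
      by (intro has_derivative_Pair has_derivative_dderiv[OF D2 q] has_derivative_snd has_derivative_ident)
    show "(F has_derivative (\<lambda>h. dderiv h F Q)) (at (\<Phi> q, snd q))"
      using has_derivative_dderiv[OF \<Omega>(2) Q] unfolding Q_def .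
  qed
  \<comment> \<open>Time and space derivatives are exchanged so that the flow equation, valid on all
    of \<open>D\<close>, can be differentiated in space.\<close>
  have t: "dderiv (0, 1) (dderiv (v, 0) \<Phi>) q = Re (dderiv (v, 0) \<Phi> q) *\<^sub>R F1 + Im (dderiv (v, 0) \<Phi> q) *\<^sub>R F2" for v
  proof -
    have "dderiv (0, 1) (dderiv (v, 0) \<Phi>) q = dderiv (v, 0) (dderiv (0, 1) \<Phi>) q"
      by (rule dderiv_commute[OF D q])
    also have "\<dots> = dderiv (v, 0) (\<lambda>q. F (\<Phi> q, snd q)) q"
      using frechet_derivative_eq_on_open[OF D(1) q flow(2)] by simp
    also have "\<dots> = dderiv (dderiv (v, 0) \<Phi> q, 0) F Q"
      unfolding frechet_derivative_at[OF G, symmetric] by simp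
    finally show ?thesis unfolding dderiv_split[OF \<Omega>(2) Q, of "dderiv (v, 0) \<Phi> q" 0] F1_def F2_def by simp
  qed
  have "((\<lambda>s. (z, s)) has_derivative (\<lambda>h. (0, h))) (at t)"
    by (auto intro!: derivative_eq_intros)
  then have "((\<lambda>s. dderiv v \<Phi> (z, s)) has_derivative (\<lambda>h. dderiv (0, h) (dderiv v \<Phi>) q)) (at t)" for v
    unfolding q_def by (rule has_derivative_compose) (rule has_derivative_dderiv[OF Dv zt])
  moreover have "(\<lambda>h. dderiv (0, h) (dderiv v \<Phi>) q) = (\<lambda>h. h *\<^sub>R dderiv (0, 1) (dderiv v \<Phi>) q)" for v
    by (rule ext) (subst dderiv_split[OF Dv q], simp)
  ultimately have dv: "((\<lambda>s. dderiv v \<Phi> (z, s)) has_derivative (\<lambda>h. h *\<^sub>R dderiv (0, 1) (dderiv v \<Phi>) q)) (at t)" for v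
    by metis
  define A1 A2 where "A1 = dderiv (1, 0) \<Phi> q" and "A2 = dderiv (\<i>, 0) \<Phi> q"
  define B1 B2 where "B1 = dderiv (0, 1) (dderiv (1, 0) \<Phi>) q" and "B2 = dderiv (0, 1) (dderiv (\<i>, 0) \<Phi>) q"
  have B: "B1 = Re A1 *\<^sub>R F1 + Im A1 *\<^sub>R F2" "B2 = Re A2 *\<^sub>R F1 + Im A2 *\<^sub>R F2"
    unfolding A1_def A2_def B1_def B2_def by (rule t)+
  have "((\<lambda>s. Re (dderiv (1, 0) \<Phi> (z, s)) * Im (dderiv (\<i>, 0) \<Phi> (z, s)) -
      Im (dderiv (1, 0) \<Phi> (z, s)) * Re (dderiv (\<i>, 0) \<Phi> (z, s))) has_derivative
      (\<lambda>h. (Re A1 * Im (h *\<^sub>R B2) + Re (h *\<^sub>R B1) * Im A2) - (Im A1 * Re (h *\<^sub>R B2) + Im (h *\<^sub>R B1) * Re A2))) (at t)"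
    unfolding A1_def A2_def B1_def B2_def q_def
    by (intro has_derivative_diff has_derivative_mult has_derivative_Re has_derivative_Im dv[unfolded q_def])
  moreover have "(Re A1 * Im (h *\<^sub>R B2) + Re (h *\<^sub>R B1) * Im A2) - (Im A1 * Re (h *\<^sub>R B2) + Im (h *\<^sub>R B1) * Re A2) = 0" for h
  proof -
    have "Re F1 + Im F2 = 0" using div[OF Q] by (simp add: F1_def F2_def)
    then have "Im F2 = - Re F1" by simp
    then show ?thesis unfolding B by (simp add: algebra_simps)
  qed
  ultimately show ?thesis unfolding has_field_derivative_def by (simp only: lambda_zero)
qed

subsection \<open>The fluid region\<close>

lemma circle_loop:
  fixes a :: complex
  assumes "r > 0"
  defines "g \<equiv> \<lambda>s :: real. a + of_real r * exp (\<i> * of_real (2 * pi * s))"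
  shows "continuous_on {0..1} g" "g 1 = g 0" "inj_on g {0..<1}" "g ` {0..1} = sphere a r"
proof -
  show "continuous_on {0..1} g" unfolding g_def by (intro continuous_intros)
  show g10: "g 1 = g 0" unfolding g_def by (simp add: exp_eq_polar)
  have arg: "Arg2pi (g s - a) = 2 * pi * s" if "0 \<le> s" "s < 1" for s
    by (rule Arg2pi_unique[of r]) (use that assms(1) in \<open>auto simp: g_def\<close>)
  show "inj_on g {0..<1}"
  proof (rule inj_onI)
    fix s t assume "s \<in> {0..<1}" "t \<in> {0..<1}" "g s = g t"
    then have "2 * pi * s = 2 * pi * t" using arg by (metis atLeastLessThan_iff)
    then show "s = t" by simp
  qed
  show "g ` {0..1} = sphere a r"
  proof
    show "g ` {0..1} \<subseteq> sphere a r"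
      using assms(1) by (auto simp: g_def dist_norm norm_mult)
    show "sphere a r \<subseteq> g ` {0..1}"
    proof
      fix z assume "z \<in> sphere a r"
      then have n: "norm (z - a) = r" by (simp add: dist_norm norm_minus_commute)
      have "z = g (Arg2pi (z - a) / (2 * pi))"
        using Arg2pi_eq[of "z - a"] n unfolding g_def by (simp add: algebra_simps)
      moreover have "Arg2pi (z - a) / (2 * pi) \<in> {0..1}"
        using Arg2pi_ge_0[of "z - a"] Arg2pi_lt_2pi[of "z - a"] by (simp add: field_simps)
      ultimately show "z \<in> g ` {0..1}" by blast
    qed
  qed
qed

locale stirring =
  fixes c :: "real \<Rightarrow> complex" and \<epsilon> :: real and m :: nat and \<alpha> :: "nat \<Rightarrow> real \<Rightarrow> complex"
  assumes protocol: "stirring_protocol c \<epsilon> m \<alpha>"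
begin

abbreviation M :: "real \<Rightarrow> complex set" where "M \<equiv> fluid_region c \<epsilon> m \<alpha>"

lemma curve: "continuous_on UNIV c" "\<And>s. c (s + 1) = c s" "inj_on c {0..<1}"
  and eps: "\<epsilon> > 0"
  and centres: "\<And>i. i \<in> {1..m} \<Longrightarrow> continuous_on {0..} (\<alpha> i)"
    "\<And>t i. 0 \<le> t \<Longrightarrow> i \<in> {1..m} \<Longrightarrow> \<alpha> i t \<in> bounded_region c"
    "\<And>t i. 0 \<le> t \<Longrightarrow> i \<in> {1..m} \<Longrightarrow> cball (\<alpha> i t) \<epsilon> \<inter> range c = {}"
    "\<And>t i j. 0 \<le> t \<Longrightarrow> i \<in> {1..m} \<Longrightarrow> j \<in> {1..m} \<Longrightarrow> i \<noteq> j \<Longrightarrow>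
       cball (\<alpha> i t) \<epsilon> \<inter> cball (\<alpha> j t) \<epsilon> = {}"
  using protocol unfolding stirring_protocol_def smooth_simple_closed_curve_def
  by (auto intro: Ck_on_imp_continuous_on)

lemma range_c: "range c = c ` {0..1}"
proof -
  have nat: "c (s + real n) = c s" for s n
  proof (induction n)
    case (Suc n)
    have "c (s + real (Suc n)) = c (s + real n + 1)" by (simp add: add_ac)
    then show ?case using curve(2) Suc by simp
  qed simp
  have int: "c (s + of_int n) = c s" for s n
  proof (cases "n \<ge> 0")
    case True
    then show ?thesis using nat[of s "nat n"] by simp
  next
    case False
    then show ?thesis using nat[of "s + of_int n" "nat (- n)"] by simp
  qed
  have "c s \<in> c ` {0..1}" for s
  proof
    show "c s = c (frac s)" using int[of s "- \<lfloor>s\<rfloor>"] by (simp add: frac_def)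
    show "frac s \<in> {0..1}" using frac_ge_0[of s] frac_lt_1[of s] by simp
  qed
  then show ?thesis by blast
qed

lemma jordan: "simple_path c" "pathfinish c = pathstart c" "path_image c = range c"
proof -
  have c01: "c 1 = c 0" using curve(2)[of 0] by simp
  show "pathfinish c = pathstart c" "path_image c = range c"
    using c01 range_c by (simp_all add: pathfinish_def pathstart_def path_image_def)
  have "x = y \<or> x = 0 \<and> y = 1 \<or> x = 1 \<and> y = 0"
    if xy: "x \<in> {0..1}" "y \<in> {0..1}" "c x = c y" for x y
  proof -
    define x' y' where "x' = (if x = 1 then 0 else x)" and "y' = (if y = 1 then 0 else y)"
    have "x' \<in> {0..<1}" "y' \<in> {0..<1}" "c x' = c y'"
      using xy c01 by (auto simp: x'_def y'_def)
    then have "x' = y'" using inj_onD[OF curve(3)] by blast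
    then show ?thesis by (auto simp: x'_def y'_def split: if_splits)
  qed
  then show "simple_path c"
    unfolding simple_path_def loop_free_def path_def
    using continuous_on_subset[OF curve(1)] by blast
qed

lemma region_inside: "open (inside (range c))" "bounded (inside (range c))"
    "frontier (outside (range c)) = range c" "frontier (inside (range c)) = range c"
    "open (outside (range c))"
  using Jordan_inside_outside[OF jordan(1,2)] unfolding jordan(3) by blast+

text \<open>The disk is connected and misses the curve, so it lies on the same side as its
  centre.\<close>

lemma disk_inside:
  assumes t: "0 \<le> t" and i: "i \<in> {1..m}"
  shows "cball (\<alpha> i t) \<epsilon> \<subseteq> inside (range c)"
proof -
  have sub: "cball (\<alpha> i t) \<epsilon> \<subseteq> inside (range c) \<union> outside (range c)"
    using centres(3)[OF t i] inside_Un_outside[of "range c"] by blast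
  have "\<alpha> i t \<in> cball (\<alpha> i t) \<epsilon>" using eps by simp
  then have "\<alpha> i t \<in> inside (range c) \<inter> cball (\<alpha> i t) \<epsilon>"
    using centres(2,3)[OF t i] unfolding bounded_region_def by blast
  moreover have "inside (range c) \<inter> outside (range c) \<inter> cball (\<alpha> i t) \<epsilon> = {}"
    using inside_Int_outside[of "range c"] by blast
  ultimately have "outside (range c) \<inter> cball (\<alpha> i t) \<epsilon> = {}"
    using connectedD[OF connected_cball region_inside(1,5) _ sub] by blast
  then show ?thesis using sub by blast
qed

lemma closed_bounded_region: "closed (bounded_region c)" "bounded (bounded_region c)"
proof -
  have "closure (inside (range c)) = bounded_region c"
    using region_inside(4) unfolding bounded_region_def
    by (metis Un_commute closure_Un_frontier)
  then show "closed (bounded_region c)" by (metis closed_closure)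
  have "compact (range c)"
    unfolding range_c by (intro compact_continuous_image continuous_on_subset[OF curve(1)]) auto
  then show "bounded (bounded_region c)"
    unfolding bounded_region_def using region_inside(2) compact_imp_bounded[of "range c"] by simp
qed

lemma compact_fluid_region: "compact (M t)"
  unfolding fluid_region_def compact_eq_bounded_closed
  using closed_bounded_region by (auto intro!: closed_Diff bounded_diff)

text \<open>Points of the outer curve are limits of the exterior by the Jordan curve theorem; points
  of a circle are limits of the removed open disk.\<close>

lemma frontier_in_fluid_region:
  assumes t: "0 \<le> t"
  shows "range c \<union> (\<Union>i\<in>{1..m}. sphere (\<alpha> i t) \<epsilon>) \<subseteq> frontier (M t)"
proof -
  have sub: "range c \<subseteq> M t"
    unfolding fluid_region_def bounded_region_def using centres(3)[OF t] ball_subset_cball by blast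
  have "range c \<subseteq> closure (outside (range c))"
    using region_inside(3) frontier_closures by blast
  also have "\<dots> \<subseteq> closure (- M t)"
  proof (rule closure_mono)
    show "outside (range c) \<subseteq> - M t"
      unfolding fluid_region_def bounded_region_def
      using inside_Int_outside[of "range c"] outside_no_overlap[of "range c"] by blast
  qed
  finally have c: "range c \<subseteq> frontier (M t)"
    using sub unfolding frontier_closures using closure_subset by blast
  have "sphere (\<alpha> i t) \<epsilon> \<subseteq> frontier (M t)" if i: "i \<in> {1..m}" for i
  proof -
    have "sphere (\<alpha> i t) \<epsilon> \<subseteq> M t"
    proof
      fix z assume z: "z \<in> sphere (\<alpha> i t) \<epsilon>"
      then have zc: "z \<in> cball (\<alpha> i t) \<epsilon>" by auto
      have "z \<notin> ball (\<alpha> j t) \<epsilon>" if j: "j \<in> {1..m}" for j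
      proof (cases "i = j")
        case True
        then show ?thesis using z by auto
      next
        case False
        then show ?thesis using centres(4)[OF t i j] zc ball_subset_cball by blast
      qed
      then show "z \<in> M t"
        unfolding fluid_region_def bounded_region_def using disk_inside[OF t i] zc by blast
    qed
    moreover have "sphere (\<alpha> i t) \<epsilon> \<subseteq> closure (ball (\<alpha> i t) \<epsilon>)"
      using eps by (auto simp: closure_ball)
    moreover have "closure (ball (\<alpha> i t) \<epsilon>) \<subseteq> closure (- M t)"
      by (rule closure_mono) (use i in \<open>auto simp: fluid_region_def\<close>)
    ultimately show ?thesis unfolding frontier_closures using closure_subset by blast
  qed
  then show ?thesis using c by blast
qed

lemma interior_fluid_region:
  assumes t: "0 \<le> t"
  shows "interior (M t) = inside (range c) - (\<Union>i\<in>{1..m}. cball (\<alpha> i t) \<epsilon>)"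
proof
  show "inside (range c) - (\<Union>i\<in>{1..m}. cball (\<alpha> i t) \<epsilon>) \<subseteq> interior (M t)"
  proof (rule interior_maximal)
    show "open (inside (range c) - (\<Union>i\<in>{1..m}. cball (\<alpha> i t) \<epsilon>))"
      using region_inside(1) by (intro open_Diff closed_UN) auto
    show "inside (range c) - (\<Union>i\<in>{1..m}. cball (\<alpha> i t) \<epsilon>) \<subseteq> M t"
      unfolding fluid_region_def bounded_region_def using ball_subset_cball by blast
  qed
  have cb: "cball (\<alpha> i t) \<epsilon> = ball (\<alpha> i t) \<epsilon> \<union> sphere (\<alpha> i t) \<epsilon>" for i by auto
  have "interior (M t) \<inter> frontier (M t) = {}" unfolding frontier_def by blast
  then show "interior (M t) \<subseteq> inside (range c) - (\<Union>i\<in>{1..m}. cball (\<alpha> i t) \<epsilon>)"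
    using frontier_in_fluid_region[OF t] interior_subset[of "M t"]
    unfolding fluid_region_def bounded_region_def cb by blast
qed

lemma frontier_fluid_region:
  assumes t: "0 \<le> t"
  shows "frontier (M t) = range c \<union> (\<Union>i\<in>{1..m}. sphere (\<alpha> i t) \<epsilon>)"
proof
  have "frontier (M t) = M t - interior (M t)"
    using compact_fluid_region compact_imp_closed closure_closed unfolding frontier_def by metis
  moreover have cb: "cball (\<alpha> i t) \<epsilon> = ball (\<alpha> i t) \<epsilon> \<union> sphere (\<alpha> i t) \<epsilon>" for i by auto
  ultimately show "frontier (M t) \<subseteq> range c \<union> (\<Union>i\<in>{1..m}. sphere (\<alpha> i t) \<epsilon>)"
    unfolding interior_fluid_region[OF t] unfolding fluid_region_def bounded_region_def cb by blast
qed (rule frontier_in_fluid_region[OF t])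

text \<open>Openness in time comes from continuity of the centres; \<open>0 < t\<close> keeps clear
  of the initial face of space-time.\<close>

lemma interior_spacetime:
  assumes t: "0 < t" and z: "z \<in> interior (M t)"
  shows "(z, t) \<in> interior (spacetime M)"
proof -
  define G where "G = (inside (range c) \<times> {0<..}) \<inter> (\<Inter>i\<in>{1..m}. {(w, s). 0 < s \<and> \<epsilon> < dist (\<alpha> i s) w})"
  have "open {(w, s). 0 < s \<and> \<epsilon> < dist (\<alpha> i s) w}" if i: "i \<in> {1..m}" for i
  proof -
    have "continuous_on (UNIV \<times> {0<..}) (\<lambda>q. dist (\<alpha> i (snd q)) (fst q))"
      by (intro continuous_intros continuous_on_compose2[OF centres(1)[OF i]]) auto
    then have "open ((UNIV \<times> {0<..}) \<inter> (\<lambda>q. dist (\<alpha> i (snd q)) (fst q)) -` {\<epsilon><..})"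
      by (intro continuous_open_preimage open_Times) auto
    also have "(UNIV \<times> {0<..}) \<inter> (\<lambda>q. dist (\<alpha> i (snd q)) (fst q)) -` {\<epsilon><..} =
        {(w, s). 0 < s \<and> \<epsilon> < dist (\<alpha> i s) w}" by auto
    finally show ?thesis .
  qed
  then have "open G" unfolding G_def
    by (intro open_Int open_INT open_Times region_inside(1)) auto
  moreover have "G \<subseteq> spacetime M"
  proof
    fix q assume q: "q \<in> G"
    obtain w s where ws: "q = (w, s)" by (cases q)
    have 1: "w \<in> inside (range c)" "0 < s" using q unfolding G_def ws by auto
    have 2: "w \<notin> ball (\<alpha> i s) \<epsilon>" if "i \<in> {1..m}" for i
    proof -
      have "(w, s) \<in> {(w, s). 0 < s \<and> \<epsilon> < dist (\<alpha> i s) w}" using q that unfolding G_def ws by blast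
      then show ?thesis by simp
    qed
    show "q \<in> spacetime M"
      using 1 2 unfolding ws spacetime_def fluid_region_def bounded_region_def by simp
  qed
  moreover have "(z, t) \<in> G"
    using z t unfolding interior_fluid_region[OF less_imp_le[OF t]] G_def by auto
  ultimately show ?thesis using interior_maximal by blast
qed

lemma spacetime_slice:
  assumes "(z, t) \<in> interior (spacetime M)"
  shows "0 \<le> t" "z \<in> interior (M t)"
proof -
  show "0 \<le> t" using assms interior_subset unfolding spacetime_def by blast
  have "open ((\<lambda>w. (w, t)) -` interior (spacetime M))"
    by (intro continuous_open_vimage) (auto intro!: continuous_intros)
  moreover have "(\<lambda>w. (w, t)) -` interior (spacetime M) \<subseteq> M t"
    using interior_subset[of "spacetime M"] unfolding spacetime_def by auto
  ultimately show "z \<in> interior (M t)" using assms interior_maximal by blast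
qed

text \<open>The boundary is a disjoint family of simple loops; the outer curve takes the index 0,
  which the disks leave free.\<close>

lemma subexponential_frontier:
  assumes f: "continuous_on (frontier (M 0)) f" "f ` frontier (M 0) \<subseteq> frontier (M 0)"
    "inj_on f (frontier (M 0))"
  shows "subexponential f (frontier (M 0))"
proof -
  define g where "g i = (if i = 0 then c else
    (\<lambda>s. \<alpha> i 0 + of_real \<epsilon> * exp (\<i> * of_real (2 * pi * s))))" for i
  have gi: "g i ` {0..1} = (if i = 0 then range c else sphere (\<alpha> i 0) \<epsilon>)" for i
    using circle_loop(4)[OF eps] range_c by (simp add: g_def)
  show ?thesis
  proof (rule subexponential_loops[where I = "{0..m}" and g = g])
    fix i assume i: "i \<in> {0..m}"
    show "continuous_on {0..1} (g i)" "g i 1 = g i 0" "inj_on (g i) {0..<1}"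
      using circle_loop(1-3)[OF eps, of "\<alpha> i 0"] curve(3) curve(2)[of 0]
        continuous_on_subset[OF curve(1), of "{0..1}"] by (simp_all add: g_def)
    fix j assume j: "j \<in> {0..m}" "i \<noteq> j"
    have s: "sphere (\<alpha> i 0) \<epsilon> \<subseteq> cball (\<alpha> i 0) \<epsilon>" for i by auto
    have disj: "range c \<inter> sphere (\<alpha> k 0) \<epsilon> = {}" if "k \<in> {0..m}" "k \<noteq> 0" for k
      using centres(3)[of 0 k] s[of k] that by auto
    consider "i = 0" | "j = 0" | "i \<noteq> 0" "j \<noteq> 0" by blast
    then show "g i ` {0..1} \<inter> g j ` {0..1} = {}"
    proof cases
      case 1
      then show ?thesis unfolding gi using disj[of j] j by simp
    next
      case 2
      then show ?thesis unfolding gi using disj[of i] i j by (simp add: Int_commute)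
    next
      case 3
      then have "cball (\<alpha> i 0) \<epsilon> \<inter> cball (\<alpha> j 0) \<epsilon> = {}"
        using centres(4)[of 0 i j] i j by auto
      then have "sphere (\<alpha> i 0) \<epsilon> \<inter> sphere (\<alpha> j 0) \<epsilon> = {}" using s by blast
      then show ?thesis unfolding gi using 3 by simp
    qed
  next
    have "{0..m} = insert 0 {1..m}" by auto
    then show "frontier (M 0) = (\<Union>i\<in>{0..m}. g i ` {0..1})"
      unfolding frontier_fluid_region[OF order_refl] gi by auto
  qed (use f in auto)
qed

end

subsection \<open>Euler diffeomorphisms\<close>

lemma slice_derivative:
  fixes G :: "complex \<times> real \<Rightarrow> 'b::real_normed_vector"
  assumes "higher_differentiable_on U G (Suc n)" "(z, t) \<in> U"
  shows "((\<lambda>w. G (w, t)) has_derivative (\<lambda>h. dderiv (h, 0) G (z, t))) (at z)"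
proof (rule has_derivative_compose[where f = "\<lambda>w. (w, t)"])
  show "((\<lambda>w. (w, t)) has_derivative (\<lambda>h. (h, 0))) (at z)"
    by (auto intro!: derivative_eq_intros)
  show "(G has_derivative (\<lambda>h. dderiv h G (z, t))) (at (z, t))"
    by (rule has_derivative_dderiv[OF assms])
qed

lemma time_slice_derivative:
  fixes G :: "complex \<times> real \<Rightarrow> 'b::real_normed_vector"
  assumes "higher_differentiable_on U G (Suc n)" "(z, t) \<in> U"
  shows "((\<lambda>s. G (z, s)) has_vector_derivative dderiv (0, 1) G (z, t)) (at t)"
proof -
  have "((\<lambda>s. (z, s)) has_derivative (\<lambda>h. h *\<^sub>R (0, 1))) (at t)"
    by (auto intro!: derivative_eq_intros)
  then have "((\<lambda>s. G (z, s)) has_derivative (\<lambda>h. dderiv (h *\<^sub>R (0, 1)) G (z, t))) (at t)"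
    by (rule has_derivative_compose) (rule has_derivative_dderiv[OF assms])
  moreover have "(\<lambda>h. dderiv (h *\<^sub>R (0, 1)) G (z, t)) = (\<lambda>h. h *\<^sub>R dderiv (0, 1) G (z, t))"
    using linear_scale[OF has_derivative_linear[OF has_derivative_dderiv[OF assms]]] by blast
  ultimately show ?thesis unfolding has_vector_derivative_def by metis
qed

text \<open>The point \<open>(z, t)\<close> may lie on the edge of \<open>S\<close>, as for
  \<open>t = 0\<close>. A local C^1 extension has continuous derivatives, which agree with those of
  \<open>G\<close> on \<open>\<Omega>\<close> and restrict at \<open>(z, t)\<close> to the
  derivative in the slice.\<close>

lemma slice_derivative_limit:
  fixes G :: "complex \<times> real \<Rightarrow> 'b::real_normed_vector"
  assumes S: "Ck_on k S G" "enat 1 \<le> k" and \<Omega>: "open \<Omega>" "\<Omega> \<subseteq> S" and x: "(z, t) \<in> S"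
    and A: "open A" "z \<in> A" "\<And>w. w \<in> A \<Longrightarrow> (w, t) \<in> S"
  shows "((\<lambda>q. dderiv (v, 0) G q) \<longlongrightarrow> frechet_derivative (\<lambda>w. G (w, t)) (at z) v) (at (z, t) within \<Omega>)"
proof -
  obtain U g where U: "open U" "(z, t) \<in> U" "\<And>m. m \<le> 1 \<Longrightarrow> higher_differentiable_on U g m"
    "\<And>y. y \<in> S \<inter> U \<Longrightarrow> g y = G y"
    using Ck_on_extension[OF S x] by blast
  have g1: "higher_differentiable_on U g (Suc 0)" using U(3)[of 1] by (simp only: One_nat_def)
  have "continuous_on U (dderiv (v, 0) g)" using g1 by simp
  then have "isCont (dderiv (v, 0) g) (z, t)" using U(1,2) continuous_on_eq_continuous_at by blast
  then have lim: "(dderiv (v, 0) g \<longlongrightarrow> dderiv (v, 0) g (z, t)) (at (z, t) within \<Omega>)"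
    unfolding isCont_def by (rule tendsto_within_subset) simp
  have "open ((\<lambda>w. (w, t)) -` U)"
    by (intro continuous_open_vimage U(1)) (auto intro!: continuous_intros)
  then have "open (A \<inter> (\<lambda>w. (w, t)) -` U)" using A(1) by blast
  then have "frechet_derivative (\<lambda>w. G (w, t)) (at z) = frechet_derivative (\<lambda>w. g (w, t)) (at z)"
    by (rule frechet_derivative_eq_on_open) (use A U in auto)
  also have "\<dots> = (\<lambda>h. dderiv (h, 0) g (z, t))"
    by (rule frechet_derivative_at[OF slice_derivative[OF g1 U(2)], symmetric])
  finally have val: "frechet_derivative (\<lambda>w. G (w, t)) (at z) v = dderiv (v, 0) g (z, t)" by simp
  have "dderiv (v, 0) g q = dderiv (v, 0) G q" if "q \<in> U \<inter> \<Omega>" for q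
    using frechet_derivative_eq_on_open[of "U \<inter> \<Omega>" q g G] U(1,4) \<Omega> that by fastforce
  then have "\<forall>\<^sub>F q in at (z, t) within \<Omega>. dderiv (v, 0) g q = dderiv (v, 0) G q"
    unfolding eventually_at_topological using U(1,2) by blast
  from Lim_transform_eventually[OF lim this] show ?thesis unfolding val .
qed

text \<open>Carries a conservation law for positive times back to the initial time, where only a
  one-sided limit is at hand.\<close>

lemma eq_limit_if_derivative_0:
  fixes h :: "real \<Rightarrow> real"
  assumes "\<And>s. 0 < s \<Longrightarrow> (h has_real_derivative 0) (at s)" "(h \<longlongrightarrow> l) (at_right 0)" "0 < t"
  shows "h t = l"
proof -
  have "h s = h t" if "0 < s" "s < t" for s
  proof (rule DERIV_isconst_end[symmetric, OF that(2)])
    show "continuous_on {s..t} h"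
    proof (rule continuous_at_imp_continuous_on, rule ballI)
      fix x assume "x \<in> {s..t}"
      then have "0 < x" using that(1) by simp
      then show "isCont h x" using DERIV_isCont[OF assms(1)] by blast
    qed
    show "DERIV h x :> 0" if "s < x" "x < t" for x
      using assms(1)[of x] that \<open>0 < s\<close> by simp
  qed
  then have "\<forall>\<^sub>F s in at_right 0. h t = h s"
    unfolding eventually_at_right_field using assms(3) by metis
  from Lim_transform_eventually[OF tendsto_const this] have "(h \<longlongrightarrow> h t) (at_right 0)" .
  then show ?thesis using tendsto_unique[OF _ _ assms(2)] by simp
qed

text \<open>The planar identity \<open>A J A^t = det(A) J\<close>, with \<open>a1\<close>,
  \<open>a2\<close> the columns of \<open>A\<close> and \<open>(p, q)\<close> the image of
  \<open>(r, s)\<close> under the transpose. In use, \<open>A\<close> is the derivative of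
  \<open>f\<close> and the pairs are the vorticity gradients at a point and at its image.\<close>

lemma unimodular_hamiltonian_invariance:
  fixes a1 a2 :: complex and p q r s :: real
  assumes det: "Re a1 * Im a2 - Im a1 * Re a2 = 1"
    and pull: "p = r * Re a1 + s * Im a1" "q = r * Re a2 + s * Im a2"
  shows "(- q) *\<^sub>R a1 + p *\<^sub>R a2 = Complex (- s) r"
proof -
  have "- q * Re a1 + p * Re a2 = - s * (Re a1 * Im a2 - Im a1 * Re a2)"
    "- q * Im a1 + p * Im a2 = r * (Re a1 * Im a2 - Im a1 * Re a2)"
    unfolding pull by (simp_all add: algebra_simps)
  then show ?thesis unfolding det by (simp add: complex_eq_iff)
qed

locale euler_flow = stirring +
  fixes k :: enat and T :: real and \<phi> :: "real \<Rightarrow> complex \<Rightarrow> complex"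
    and X :: "real \<Rightarrow> complex \<Rightarrow> complex" and f :: "complex \<Rightarrow> complex"
  assumes k: "3 \<le> k" and T: "0 < T" and periodic: "periodic_protocol T m \<alpha>"
    and motion: "fluid_motion k (fluid_region c \<epsilon> m \<alpha>) \<phi>"
    and velocity: "velocity_field k (fluid_region c \<epsilon> m \<alpha>) \<phi> X"
    and incompressible: "incompressible (fluid_region c \<epsilon> m \<alpha>) X"
    and euler: "euler_equation k (fluid_region c \<epsilon> m \<alpha>) X"
    and X_periodic: "\<And>t z. 0 \<le> t \<Longrightarrow> z \<in> fluid_region c \<epsilon> m \<alpha> t \<Longrightarrow> X (t + T) z = X t z"
    and f_eq: "\<And>z. z \<in> fluid_region c \<epsilon> m \<alpha> 0 \<Longrightarrow> f z = \<phi> T z"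
begin

definition F :: "complex \<times> real \<Rightarrow> complex" where "F = (\<lambda>(z, t). X t z)"
definition \<Phi> :: "complex \<times> real \<Rightarrow> complex" where "\<Phi> = (\<lambda>(z, t). \<phi> t z)"
definition \<Omega> :: "(complex \<times> real) set" where "\<Omega> = interior (spacetime M)"
definition R :: "complex set" where "R = interior (M 0)"
definition \<zeta> :: "complex \<times> real \<Rightarrow> real" where
  "\<zeta> q = Im (dderiv (1, 0) F q) - Re (dderiv (\<i>, 0) F q)"

text \<open>The bound \<open>3 <= k\<close> enters here: the pressure, of class
  \<open>k - 1\<close>, needs commuting second derivatives when the curl is taken.\<close>

lemma k_le: "enat 1 \<le> k" "enat 2 \<le> k" "2 \<le> k" "enat 2 \<le> k - 1"
  using k by (cases k; auto simp: numeral_eq_enat one_enat_def)+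

lemma open_\<Omega>: "open \<Omega>" "\<Omega> \<subseteq> spacetime M"
  unfolding \<Omega>_def using interior_subset by auto

lemma open_R: "open R" "R \<subseteq> M 0"
  unfolding R_def using interior_subset by auto

lemma F_smooth: "Ck_on k (spacetime M) F" "higher_differentiable_on \<Omega> F 2"
  "higher_differentiable_on \<Omega> F (Suc (Suc 0))" "higher_differentiable_on \<Omega> (dderiv v F) (Suc 0)"
  "\<And>v w. continuous_on \<Omega> (dderiv v (dderiv w F))"
proof -
  show 1: "Ck_on k (spacetime M) F"
    using velocity unfolding velocity_field_def F_def by blast
  show 2: "higher_differentiable_on \<Omega> F 2"
    by (rule Ck_on_imp_higher_differentiable_on[OF 1 k_le(2) open_\<Omega>])
  then show 3: "higher_differentiable_on \<Omega> F (Suc (Suc 0))" by (simp only: numeral_2_eq_2)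
  show 4: "higher_differentiable_on \<Omega> (dderiv v F) (Suc 0)" for v
    by (rule higher_differentiable_on_dderiv[OF 3])
  show "continuous_on \<Omega> (dderiv v (dderiv w F))" for v w
    using higher_differentiable_on_dderiv[OF 4] by simp
qed

lemma open_domain: "open (R \<times> {0::real<..})" "R \<times> {0::real<..} \<subseteq> M 0 \<times> {0..}"
proof -
  show "open (R \<times> {0::real<..})" by (rule open_Times[OF open_R(1) open_greaterThan])
  show "R \<times> {0::real<..} \<subseteq> M 0 \<times> {0..}" using open_R(2) by auto
qed

lemma \<Phi>_smooth: "Ck_on k (M 0 \<times> {0..}) \<Phi>" "higher_differentiable_on (R \<times> {0<..}) \<Phi> 2"
  "higher_differentiable_on (R \<times> {0<..}) \<Phi> (Suc (Suc 0))"
proof -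
  show 1: "Ck_on k (M 0 \<times> {0..}) \<Phi>"
    using motion unfolding fluid_motion_def \<Phi>_def by blast
  show "higher_differentiable_on (R \<times> {0<..}) \<Phi> 2"
    by (rule Ck_on_imp_higher_differentiable_on[OF 1 k_le(2) open_domain])
  then show "higher_differentiable_on (R \<times> {0<..}) \<Phi> (Suc (Suc 0))" by (simp only: numeral_2_eq_2)
qed

lemma flow_homeo:
  assumes "0 \<le> t"
  shows "bij_betw (\<phi> t) (M 0) (M t)" "continuous_on (M 0) (\<phi> t)" "continuous_on (M t) (inv_into (M 0) (\<phi> t))"
  using motion assms unfolding fluid_motion_def Ck_diffeomorphism_def
  by (auto intro: Ck_on_imp_continuous_on)

lemma flow_0: "z \<in> M 0 \<Longrightarrow> \<phi> 0 z = z"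
  using motion unfolding fluid_motion_def by blast

lemma flow_derivative:
  assumes "0 \<le> t" "z \<in> M 0"
  shows "((\<lambda>s. \<phi> s z) has_vector_derivative F (\<phi> t z, t)) (at t within {0..})"
  using velocity assms unfolding velocity_field_def F_def by auto

text \<open>By invariance of domain the image of the open set \<open>R\<close> is open.\<close>

lemma flow_interior:
  assumes t: "0 \<le> t" and z: "z \<in> R"
  shows "\<phi> t z \<in> interior (M t)"
proof -
  have "inj_on (\<phi> t) R"
    using flow_homeo(1)[OF t] open_R(2) inj_on_subset unfolding bij_betw_def by blast
  then have "open (\<phi> t ` R)"
    using invariance_of_domain[OF continuous_on_subset[OF flow_homeo(2)[OF t] open_R(2)] open_R(1)] by blast
  moreover have "\<phi> t ` R \<subseteq> M t"
    using flow_homeo(1)[OF t] open_R(2) unfolding bij_betw_def by blast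
  ultimately show ?thesis using z interior_maximal by blast
qed

lemma flow_in_\<Omega>:
  assumes "0 < t" "z \<in> R"
  shows "(\<phi> t z, t) \<in> \<Omega>"
  unfolding \<Omega>_def using interior_spacetime[OF assms(1) flow_interior] assms by simp

lemma flow_derivative_at:
  assumes "0 < t" "z \<in> R"
  shows "((\<lambda>s. \<phi> s z) has_vector_derivative F (\<phi> t z, t)) (at t)"
proof -
  have "t \<in> interior {0..}" using assms(1) by simp
  then show ?thesis
    using flow_derivative[of t z] assms open_R(2) at_within_interior[of t "{0..}"] by auto
qed

lemma slice_within:
  assumes "(z, t) \<in> \<Omega>"
  shows "at z within M t = at z"
  using spacetime_slice(2)[of z t] assms at_within_interior unfolding \<Omega>_def by blast

lemma slice_frechet:
  fixes G :: "complex \<times> real \<Rightarrow> 'b::real_normed_vector"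
  assumes "higher_differentiable_on \<Omega> G (Suc n)" "(z, t) \<in> \<Omega>"
  shows "frechet_derivative (\<lambda>w. G (w, t)) (at z within M t) = (\<lambda>h. dderiv (h, 0) G (z, t))"
  unfolding slice_within[OF assms(2)]
  by (rule frechet_derivative_at[OF slice_derivative[OF assms], symmetric])

lemma X_slice: "X t = (\<lambda>w. F (w, t))"
  by (simp add: F_def)

lemma curl_eq:
  assumes "(z, t) \<in> \<Omega>"
  shows "curl (M t) (X t) z = \<zeta> (z, t)"
  unfolding curl_def \<zeta>_def X_slice[of t] slice_frechet[OF F_smooth(3) assms] by simp

lemma divergence_free:
  assumes "q \<in> \<Omega>"
  shows "Re (dderiv (1, 0) F q) + Im (dderiv (\<i>, 0) F q) = 0"
proof -
  obtain z t where q: "q = (z, t)" by (cases q)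
  have zt: "(z, t) \<in> \<Omega>" using assms q by simp
  then have "0 \<le> t" "z \<in> M t"
    using spacetime_slice[of z t] interior_subset unfolding \<Omega>_def by blast+
  then have "divergence (M t) (X t) z = 0" using incompressible unfolding incompressible_def by blast
  then show ?thesis
    unfolding divergence_def X_slice[of t] slice_frechet[OF F_smooth(3) zt] q by simp
qed

lemma vorticity_derivative:
  assumes t: "0 < t" and z: "z \<in> R"
  shows "((\<lambda>s. \<zeta> (\<phi> s z, s)) has_real_derivative 0) (at t)"
proof -
  obtain p where p: "Ck_on (k - 1) (spacetime M) (\<lambda>(z, t). p t z)"
    and eq: "\<And>t z. 0 \<le> t \<Longrightarrow> z \<in> M t \<Longrightarrow>
      time_derivative M X t z + convective_derivative M X t z = - grad (M t) (p t) z"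
    using euler unfolding euler_equation_def by blast
  define P where "P = (\<lambda>(z, t). p t z)"
  have P: "higher_differentiable_on \<Omega> P 2"
    unfolding P_def by (rule Ck_on_imp_higher_differentiable_on[OF p k_le(4) open_\<Omega>])
  then have P2: "higher_differentiable_on \<Omega> P (Suc (Suc 0))" by (simp only: numeral_2_eq_2)
  have p_slice: "p t = (\<lambda>w. P (w, t))" for t by (simp add: P_def)
  \<comment> \<open>In the interior of space-time the one-sided derivatives of
    \<open>euler_equation\<close> become ordinary ones of the uncurried fields.\<close>
  have euler: "dderiv (0, 1) F q + dderiv (F q, 0) F q = - Complex (dderiv (1, 0) P q) (dderiv (\<i>, 0) P q)"
    if "q \<in> \<Omega>" for q
  proof -
    obtain z t where q: "q = (z, t)" by (cases q)
    have zt: "(z, t) \<in> \<Omega>" using that q by simp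
    have tz: "0 \<le> t" "z \<in> M t"
      using spacetime_slice[of z t] zt interior_subset unfolding \<Omega>_def by blast+
    have "time_derivative M X t z = dderiv (0, 1) F q"
      unfolding time_derivative_def F_def[symmetric] q
      using at_within_interior[of "(z, t)" "spacetime M"] zt unfolding \<Omega>_def by simp
    moreover have "convective_derivative M X t z = dderiv (F q, 0) F q"
      unfolding convective_derivative_def X_slice[of t] slice_frechet[OF F_smooth(3) zt] q ..
    moreover have "grad (M t) (p t) z = Complex (dderiv (1, 0) P q) (dderiv (\<i>, 0) P q)"
      unfolding grad_def p_slice[of t] slice_frechet[OF P2 zt] q ..
    ultimately show ?thesis using eq[OF tz] by simp
  qed
  show ?thesis
    unfolding \<zeta>_def
    by (rule euler_vorticity_transport[OF open_\<Omega>(1) F_smooth(2) P euler divergence_free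
          flow_in_\<Omega>[OF t z] flow_derivative_at[OF t z]])
qed

lemma flow_tendsto_0:
  assumes z: "z \<in> R"
  shows "((\<lambda>s. \<phi> s z) \<longlongrightarrow> z) (at_right 0)"
proof -
  have zM: "z \<in> M 0" using z open_R(2) by blast
  have "continuous (at 0 within {0..}) (\<lambda>s. \<phi> s z)"
    using flow_derivative[OF order_refl zM] has_vector_derivative_continuous by blast
  then have "((\<lambda>s. \<phi> s z) \<longlongrightarrow> z) (at 0 within {0..})"
    unfolding continuous_within flow_0[OF zM] .
  then show ?thesis by (rule tendsto_within_subset) auto
qed

text \<open>Along a path \<open>\<zeta>\<close> is known to be constant for positive times; its
  value is found as the limit at time 0, where \<open>\<zeta>\<close> tends to the initial
  curl.\<close>

lemma vorticity_conserved:
  assumes t: "0 < t" and z: "z \<in> R"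
  shows "\<zeta> (\<phi> t z, t) = curl (M 0) (X 0) z"
proof (rule eq_limit_if_derivative_0[OF _ _ t])
  have zS: "(z, 0) \<in> spacetime M" using z open_R(2) unfolding spacetime_def by auto
  have A: "(w, 0) \<in> spacetime M" if "w \<in> R" for w
    using that open_R(2) unfolding spacetime_def by auto
  have lim: "(dderiv (v, 0) F \<longlongrightarrow> frechet_derivative (X 0) (at z) v) (at (z, 0) within \<Omega>)" for v
    using slice_derivative_limit[OF F_smooth(1) k_le(1) open_\<Omega> zS open_R(1) z A] unfolding X_slice[of 0] .
  have "at z within M 0 = at z" using z unfolding R_def by (rule at_within_interior)
  then have "(\<zeta> \<longlongrightarrow> curl (M 0) (X 0) z) (at (z, 0) within \<Omega>)"
    unfolding curl_def \<zeta>_def by (auto intro!: tendsto_intros lim)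
  moreover have "filterlim (\<lambda>s. (\<phi> s z, s)) (at (z, 0) within \<Omega>) (at_right 0)"
    unfolding filterlim_at
  proof
    show "((\<lambda>s. (\<phi> s z, s)) \<longlongrightarrow> (z, 0)) (at_right 0)"
      by (intro tendsto_Pair flow_tendsto_0[OF z] tendsto_ident_at)
    show "\<forall>\<^sub>F s in at_right 0. (\<phi> s z, s) \<in> \<Omega> \<and> (\<phi> s z, s) \<noteq> (z, 0)"
      unfolding eventually_at_right_field using flow_in_\<Omega>[OF _ z] by (auto intro!: exI[of _ 1])
  qed
  ultimately show "((\<lambda>s. \<zeta> (\<phi> s z, s)) \<longlongrightarrow> curl (M 0) (X 0) z) (at_right 0)"
    by (rule filterlim_compose)
qed (rule vorticity_derivative[OF _ z])

text \<open>Liouville's theorem makes the determinant constant for positive times, and the Jacobian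
  tends to the identity at time 0.\<close>

lemma flow_unimodular:
  assumes t: "0 < t" and z: "z \<in> R"
  shows "Re (dderiv (1, 0) \<Phi> (z, t)) * Im (dderiv (\<i>, 0) \<Phi> (z, t)) -
      Im (dderiv (1, 0) \<Phi> (z, t)) * Re (dderiv (\<i>, 0) \<Phi> (z, t)) = 1"
proof (rule eq_limit_if_derivative_0[OF _ _ t])
  fix s :: real assume s: "0 < s"
  have flow: "(\<Phi> q, snd q) \<in> \<Omega>" "dderiv (0, 1) \<Phi> q = F (\<Phi> q, snd q)"
    if q: "q \<in> R \<times> {0<..}" for q
  proof -
    obtain w r where wr: "q = (w, r)" "w \<in> R" "0 < r" using q by auto
    show "(\<Phi> q, snd q) \<in> \<Omega>" using flow_in_\<Omega> wr by (simp add: \<Phi>_def)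
    have "((\<lambda>s. \<Phi> (w, s)) has_vector_derivative dderiv (0, 1) \<Phi> (w, r)) (at r)"
      by (rule time_slice_derivative[OF \<Phi>_smooth(3)]) (use q wr in simp)
    moreover have "((\<lambda>s. \<Phi> (w, s)) has_vector_derivative F (\<Phi> (w, r), r)) (at r)"
      using flow_derivative_at[OF wr(3,2)] by (simp add: \<Phi>_def)
    ultimately show "dderiv (0, 1) \<Phi> q = F (\<Phi> q, snd q)"
      unfolding wr(1) snd_conv by (rule vector_derivative_unique_at)
  qed
  show "((\<lambda>s. Re (dderiv (1, 0) \<Phi> (z, s)) * Im (dderiv (\<i>, 0) \<Phi> (z, s)) -
      Im (dderiv (1, 0) \<Phi> (z, s)) * Re (dderiv (\<i>, 0) \<Phi> (z, s))) has_real_derivative 0) (at s)"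
    by (rule liouville[OF open_\<Omega>(1) F_smooth(3) open_domain(1) \<Phi>_smooth(2) flow divergence_free])
      (use z s in auto)
next
  have lim: "(dderiv (v, 0) \<Phi> \<longlongrightarrow> v) (at (z, 0) within R \<times> {0<..})" for v
  proof -
    have "frechet_derivative (\<lambda>w. \<Phi> (w, 0)) (at z) = frechet_derivative (\<lambda>w. w) (at z)"
      by (rule frechet_derivative_eq_on_open[OF open_R(1) z]) (use flow_0 open_R(2) in \<open>auto simp: \<Phi>_def\<close>)
    then have "frechet_derivative (\<lambda>w. \<Phi> (w, 0)) (at z) v = v" by simp
    moreover have "(dderiv (v, 0) \<Phi> \<longlongrightarrow> frechet_derivative (\<lambda>w. \<Phi> (w, 0)) (at z) v)
        (at (z, 0) within R \<times> {0<..})"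
      by (rule slice_derivative_limit[OF \<Phi>_smooth(1) k_le(1) open_domain _ open_R(1) z])
        (use z open_R(2) in auto)
    ultimately show ?thesis by simp
  qed
  have fl: "filterlim (\<lambda>s :: real. (z, s)) (at (z, 0) within R \<times> {0<..}) (at_right 0)"
    unfolding filterlim_at
  proof
    show "((\<lambda>s :: real. (z, s)) \<longlongrightarrow> (z, 0)) (at_right 0)"
      by (intro tendsto_Pair tendsto_const tendsto_ident_at)
    show "\<forall>\<^sub>F s :: real in at_right 0. (z, s) \<in> R \<times> {0<..} \<and> (z, s) \<noteq> (z, 0)"
      by (rule eventually_at_rightI[of 0 1]) (use z in auto)
  qed
  have "((\<lambda>s. Re (dderiv (1, 0) \<Phi> (z, s)) * Im (dderiv (\<i>, 0) \<Phi> (z, s)) -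
      Im (dderiv (1, 0) \<Phi> (z, s)) * Re (dderiv (\<i>, 0) \<Phi> (z, s))) \<longlongrightarrow> Re 1 * Im \<i> - Im 1 * Re \<i>) (at_right 0)"
    by (intro tendsto_intros filterlim_compose[OF lim fl])
  then show "((\<lambda>s. Re (dderiv (1, 0) \<Phi> (z, s)) * Im (dderiv (\<i>, 0) \<Phi> (z, s)) -
      Im (dderiv (1, 0) \<Phi> (z, s)) * Re (dderiv (\<i>, 0) \<Phi> (z, s))) \<longlongrightarrow> 1) (at_right 0)"
    by simp
qed

section \<open>The vorticity as an invariant of the period map\<close>

lemma fluid_region_periodic: "M T = M 0"
proof -
  obtain \<sigma> where \<sigma>: "\<sigma> permutes {1..m}" "\<And>i t. i \<in> {1..m} \<Longrightarrow> 0 \<le> t \<Longrightarrow> \<alpha> i (t + T) = \<alpha> (\<sigma> i) t"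
    using periodic unfolding periodic_protocol_def by blast
  have "(\<Union>i\<in>{1..m}. ball (\<alpha> i T) \<epsilon>) = (\<Union>i\<in>{1..m}. ball (\<alpha> (\<sigma> i) 0) \<epsilon>)"
    using \<sigma>(2)[of _ 0] by auto
  also have "\<dots> = (\<Union>i\<in>\<sigma> ` {1..m}. ball (\<alpha> i 0) \<epsilon>)" by blast
  finally show ?thesis unfolding fluid_region_def permutes_image[OF \<sigma>(1)] by simp
qed

abbreviation "\<omega> \<equiv> curl (M 0) (X 0)"

text \<open>The partial derivatives of the initial vorticity on \<open>R\<close>, read off at time
  \<open>T\<close>: there \<open>(z, T)\<close> is interior to space-time, while
  \<open>(z, 0)\<close> is not.\<close>

definition \<omega>1 :: "complex \<Rightarrow> real" where
  "\<omega>1 z = Im (dderiv (1, 0) (dderiv (1, 0) F) (z, T)) - Re (dderiv (1, 0) (dderiv (\<i>, 0) F) (z, T))"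
definition \<omega>2 :: "complex \<Rightarrow> real" where
  "\<omega>2 z = Im (dderiv (\<i>, 0) (dderiv (1, 0) F) (z, T)) - Re (dderiv (\<i>, 0) (dderiv (\<i>, 0) F) (z, T))"

lemma R_period: "z \<in> R \<Longrightarrow> (z, T) \<in> \<Omega>"
  using interior_spacetime[OF T, of z] fluid_region_periodic unfolding \<Omega>_def R_def by simp

lemma \<omega>_eq:
  assumes z: "z \<in> R"
  shows "\<omega> z = \<zeta> (z, T)"
proof -
  have "at z within M 0 = at z" using z unfolding R_def by (rule at_within_interior)
  moreover have "frechet_derivative (X 0) (at z) = frechet_derivative (X T) (at z)"
    by (rule frechet_derivative_eq_on_open[OF open_R(1) z]) (use X_periodic[of 0] open_R(2) in auto)
  ultimately have "\<omega> z = curl (M T) (X T) z" unfolding curl_def fluid_region_periodic by simp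
  then show ?thesis using curl_eq[OF R_period[OF z]] by simp
qed

lemma \<omega>_derivative:
  assumes z: "z \<in> R"
  shows "(\<omega> has_derivative (\<lambda>h. \<omega>1 z * Re h + \<omega>2 z * Im h)) (at z)"
proof (rule has_derivative_transform_within_open[OF _ open_R(1) z \<omega>_eq[symmetric]])
  note q = R_period[OF z]
  have "((\<lambda>w. \<zeta> (w, T)) has_derivative
     (\<lambda>h. Im (dderiv (h, 0) (dderiv (1, 0) F) (z, T)) - Re (dderiv (h, 0) (dderiv (\<i>, 0) F) (z, T)))) (at z)"
    unfolding \<zeta>_def
    by (intro has_derivative_diff has_derivative_Im has_derivative_Re slice_derivative[OF F_smooth(4) q])
  moreover have "(\<lambda>h. Im (dderiv (h, 0) (dderiv (1, 0) F) (z, T)) - Re (dderiv (h, 0) (dderiv (\<i>, 0) F) (z, T))) =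
      (\<lambda>h. \<omega>1 z * Re h + \<omega>2 z * Im h)"
  proof
    fix h
    show "Im (dderiv (h, 0) (dderiv (1, 0) F) (z, T)) - Re (dderiv (h, 0) (dderiv (\<i>, 0) F) (z, T)) =
        \<omega>1 z * Re h + \<omega>2 z * Im h"
      unfolding dderiv_split[OF F_smooth(4) q, of _ h 0] \<omega>1_def \<omega>2_def by (simp add: algebra_simps)
  qed
  ultimately show "((\<lambda>w. \<zeta> (w, T)) has_derivative (\<lambda>h. \<omega>1 z * Re h + \<omega>2 z * Im h)) (at z)" by simp
qed

lemma \<omega>12_continuous: "continuous_on R \<omega>1" "continuous_on R \<omega>2"
proof -
  have "continuous_on R (\<lambda>z. dderiv v (dderiv w F) (z, T))" for v w
    by (rule continuous_on_compose2[OF F_smooth(5)]) (use R_period in \<open>auto intro!: continuous_intros\<close>)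
  then show "continuous_on R \<omega>1" "continuous_on R \<omega>2"
    unfolding \<omega>1_def \<omega>2_def by (auto intro!: continuous_intros)
qed

text \<open>The extensions give local bounds around every point of the closed region at time
  \<open>T\<close>, walls included, and compactness makes them uniform.\<close>

lemma \<omega>12_bounded: "\<exists>B. \<forall>z\<in>R. norm (Complex (- \<omega>2 z) (\<omega>1 z)) \<le> B"
proof -
  have bd: "\<exists>B. \<forall>z\<in>R. norm (dderiv v (dderiv w F) (z, T)) \<le> B" for v w
  proof -
    have "\<exists>U B. open U \<and> (x, T) \<in> U \<and> (\<forall>y\<in>U \<inter> \<Omega>. norm (dderiv v (dderiv w F) y) \<le> B)"
      if "x \<in> M 0" for x
    proof (rule Ck_on_bounded_second_derivative[OF F_smooth(1) k_le(3) open_\<Omega>])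
      show "(x, T) \<in> spacetime M"
        using that fluid_region_periodic T unfolding spacetime_def by auto
    qed
    then obtain U B where UB: "\<And>x. x \<in> M 0 \<Longrightarrow> open (U x)" "\<And>x. x \<in> M 0 \<Longrightarrow> (x, T) \<in> U x"
      "\<And>x y. x \<in> M 0 \<Longrightarrow> y \<in> U x \<inter> \<Omega> \<Longrightarrow> norm (dderiv v (dderiv w F) y) \<le> B x"
      by metis
    define W where "W x = (\<lambda>w. (w, T)) -` U x" for x
    have W: "open (W x)" if "x \<in> M 0" for x
      unfolding W_def by (intro continuous_open_vimage UB(1)[OF that]) (auto intro!: continuous_intros)
    have "M 0 \<subseteq> (\<Union>x\<in>M 0. W x)" using UB(2) unfolding W_def by auto
    then obtain D where D: "D \<subseteq> M 0" "finite D" "M 0 \<subseteq> (\<Union>x\<in>D. W x)"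
      using compactE_image[OF compact_fluid_region, of "M 0" W 0] W by metis
    have "norm (dderiv v (dderiv w F) (z, T)) \<le> (\<Sum>x\<in>D. \<bar>B x\<bar>)" if zR: "z \<in> R" for z
    proof -
      obtain x where x: "x \<in> D" "z \<in> W x" using D(3) zR open_R(2) by blast
      then have "norm (dderiv v (dderiv w F) (z, T)) \<le> B x"
        using UB(3)[of x "(z, T)"] R_period[OF zR] D(1) unfolding W_def by auto
      also have "\<dots> \<le> \<bar>B x\<bar>" by simp
      also have "\<dots> \<le> (\<Sum>x\<in>D. \<bar>B x\<bar>)" using D(2) x(1) by (intro member_le_sum) auto
      finally show ?thesis .
    qed
    then show ?thesis by blast
  qed
  define B where "B v w = (SOME b. \<forall>z\<in>R. norm (dderiv v (dderiv w F) (z, T)) \<le> b)" for v w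
  have B: "norm (dderiv v (dderiv w F) (z, T)) \<le> B v w" if "z \<in> R" for v w z
    using someI_ex[OF bd[where v = v and w = w]] that unfolding B_def by simp
  have "norm (Complex (- \<omega>2 z) (\<omega>1 z)) \<le> (B (\<i>, 0) (1, 0) + B (\<i>, 0) (\<i>, 0)) + (B (1, 0) (1, 0) + B (1, 0) (\<i>, 0))"
    if z: "z \<in> R" for z
  proof -
    have "\<bar>Im (dderiv v (dderiv w F) (z, T)) - Re (dderiv v (dderiv w' F) (z, T))\<bar> \<le> B v w + B v w'" for v w w'
      using abs_Im_le_cmod[of "dderiv v (dderiv w F) (z, T)"] abs_Re_le_cmod[of "dderiv v (dderiv w' F) (z, T)"]
        B[OF z, where v = v and w = w] B[OF z, where v = v and w = w'] by linarith
    then have "\<bar>\<omega>2 z\<bar> \<le> B (\<i>, 0) (1, 0) + B (\<i>, 0) (\<i>, 0)" "\<bar>\<omega>1 z\<bar> \<le> B (1, 0) (1, 0) + B (1, 0) (\<i>, 0)"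
      unfolding \<omega>1_def \<omega>2_def by blast+
    then show ?thesis using cmod_le[of "Complex (- \<omega>2 z) (\<omega>1 z)"] by simp
  qed
  then show ?thesis by blast
qed

lemma f_homeo: "continuous_on (M 0) f" "bij_betw f (M 0) (M 0)" "continuous_on (M 0) (inv_into (M 0) f)"
proof -
  note h = flow_homeo[OF less_imp_le[OF T], unfolded fluid_region_periodic]
  have fe: "\<phi> T z = f z" if "z \<in> M 0" for z using f_eq[OF that] by simp
  show "continuous_on (M 0) f" using h(2) fe by (rule continuous_on_eq)
  show "bij_betw f (M 0) (M 0)" using h(1) bij_betw_cong[of "M 0" "\<phi> T" f, OF fe] by simp
  \<comment> \<open>\<open>inv_into\<close> is defined by choice, and equal predicates give equal
    choices, even at points without a preimage.\<close>
  have "(\<lambda>y. y \<in> M 0 \<and> f y = z) = (\<lambda>y. y \<in> M 0 \<and> \<phi> T y = z)" for z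
    using fe by auto
  then have "inv_into (M 0) f = inv_into (M 0) (\<phi> T)"
    unfolding inv_into_def by simp
  then show "continuous_on (M 0) (inv_into (M 0) f)" using h(3) by simp
qed

lemma f_interior: "z \<in> R \<Longrightarrow> f z \<in> R"
  using flow_interior[of T z] T f_eq open_R(2) unfolding R_def fluid_region_periodic by auto

text \<open>The inverse of \<open>f\<close> also maps interior to interior by invariance of domain,
  so no boundary point can be sent into the interior.\<close>

lemma f_frontier: "f ` frontier (M 0) \<subseteq> frontier (M 0)"
proof
  have fr: "frontier (M 0) = M 0 - R"
    using compact_fluid_region compact_imp_closed closure_closed unfolding frontier_def R_def by metis
  fix y assume "y \<in> f ` frontier (M 0)"
  then obtain z where z: "y = f z" "z \<in> M 0" "z \<notin> R" using fr by blast
  let ?g = "inv_into (M 0) f"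
  have "inj_on ?g R"
    using inj_on_inv_into[of R f "M 0"] f_homeo(2) open_R(2) unfolding bij_betw_def by blast
  then have "open (?g ` R)"
    using invariance_of_domain[OF continuous_on_subset[OF f_homeo(3) open_R(2)] open_R(1)] by blast
  moreover have "?g ` R \<subseteq> M 0"
    using bij_betw_inv_into[OF f_homeo(2)] open_R(2) unfolding bij_betw_def by blast
  ultimately have gR: "?g ` R \<subseteq> R" unfolding R_def by (rule interior_maximal[rotated])
  have "?g y = z" using z f_homeo(2) unfolding bij_betw_def by (simp add: inv_into_f_f)
  then have "y \<notin> R" using gR z(3) by blast
  moreover have "y \<in> M 0" using z f_homeo(2) unfolding bij_betw_def by blast
  ultimately show "y \<in> frontier (M 0)" using fr by blast
qed

text \<open>At \<open>\<phi> T z\<close> the value of \<open>\<zeta>\<close> at time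
  \<open>T\<close> is the initial vorticity of \<open>z\<close> by conservation, and that of
  \<open>f z\<close> by periodicity.\<close>

lemma \<omega>_invariant: "z \<in> R \<Longrightarrow> \<omega> (f z) = \<omega> z"
  using vorticity_conserved[OF T, of z] \<omega>_eq[OF f_interior, of z] f_eq open_R(2) by auto

definition Df :: "complex \<Rightarrow> complex \<Rightarrow> complex" where "Df z h = dderiv (h, 0) \<Phi> (z, T)"

lemma f_derivative:
  assumes z: "z \<in> R"
  shows "(f has_derivative Df z) (at z)"
proof (rule has_derivative_transform_within_open[OF _ open_R(1) z])
  have "(z, T) \<in> R \<times> {0<..}" using z T by simp
  from slice_derivative[OF \<Phi>_smooth(3) this]
  show "(\<phi> T has_derivative Df z) (at z)" unfolding Df_def \<Phi>_def by simp
  show "\<phi> T w = f w" if "w \<in> R" for w using f_eq that open_R(2) by auto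
qed

text \<open>Differentiating the invariance of \<open>\<omega>\<close> relates the gradients by the
  transpose of \<open>Df\<close>; determinant 1 turns this into the rule for the rotated
  gradients.\<close>

lemma Df_invariance:
  assumes z: "z \<in> R"
  shows "Df z (Complex (- \<omega>2 z) (\<omega>1 z)) = Complex (- \<omega>2 (f z)) (\<omega>1 (f z))"
    and "Df z h = 0 \<Longrightarrow> h = 0"
proof -
  have zT: "(z, T) \<in> R \<times> {0<..}" using z T by simp
  define a1 a2 where "a1 = Df z 1" and "a2 = Df z \<i>"
  have split: "Df z h = Re h *\<^sub>R a1 + Im h *\<^sub>R a2" for h
    unfolding a1_def a2_def Df_def by (subst dderiv_split[OF \<Phi>_smooth(3) zT]) simp
  have det: "Re a1 * Im a2 - Im a1 * Re a2 = 1"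
    using flow_unimodular[OF T z] unfolding a1_def a2_def Df_def .
  have "((\<lambda>w. \<omega> (f w)) has_derivative (\<lambda>h. \<omega>1 (f z) * Re (Df z h) + \<omega>2 (f z) * Im (Df z h))) (at z)"
    by (rule has_derivative_compose[OF f_derivative[OF z] \<omega>_derivative[OF f_interior[OF z]]])
  from has_derivative_unique[OF has_derivative_transform_within_open[OF this open_R(1) z \<omega>_invariant]
      \<omega>_derivative[OF z]]
  have pull: "\<omega>1 (f z) * Re (Df z h) + \<omega>2 (f z) * Im (Df z h) = \<omega>1 z * Re h + \<omega>2 z * Im h" for h
    by metis
  have "(- \<omega>2 z) *\<^sub>R a1 + \<omega>1 z *\<^sub>R a2 = Complex (- \<omega>2 (f z)) (\<omega>1 (f z))"
    using pull[of 1] pull[of \<i>] unfolding a1_def[symmetric] a2_def[symmetric]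
    by (intro unimodular_hamiltonian_invariance[OF det]) auto
  then show "Df z (Complex (- \<omega>2 z) (\<omega>1 z)) = Complex (- \<omega>2 (f z)) (\<omega>1 (f z))"
    by (simp add: split)
  assume "Df z h = 0"
  then have 0: "Re h * Re a1 + Im h * Re a2 = 0" "Re h * Im a1 + Im h * Im a2 = 0"
    unfolding split by (simp_all add: complex_eq_iff)
  \<comment> \<open>Cramer's rule with determinant 1 gives injectivity.\<close>
  have "Re h * (Re a1 * Im a2 - Im a1 * Re a2) =
      (Re h * Re a1 + Im h * Re a2) * Im a2 - (Re h * Im a1 + Im h * Im a2) * Re a2"
    "Im h * (Re a1 * Im a2 - Im a1 * Re a2) =
      (Re h * Im a1 + Im h * Im a2) * Re a1 - (Re h * Re a1 + Im h * Re a2) * Im a1"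
    by (simp_all add: algebra_simps)
  then show "h = 0" unfolding det 0 by (simp add: complex_eq_iff)
qed

theorem topological_entropy_euler:
  assumes crit: "finite (critical_points (M 0) \<omega>)"
  shows "topological_entropy (M 0) f = 0"
proof (rule topological_entropy_eq_0)
  have fr: "frontier (M 0) = M 0 - R"
    using compact_fluid_region compact_imp_closed closure_closed unfolding frontier_def R_def by metis
  \<comment> \<open>Interior zeros of the Hamiltonian field; critical points on the boundary already
    belong to the frontier part of \<open>Z\<close>.\<close>
  define P where "P = {z \<in> R. \<omega>1 z = 0 \<and> \<omega>2 z = 0}"
  have V0: "Complex (- \<omega>2 z) (\<omega>1 z) = 0 \<longleftrightarrow> \<omega>1 z = 0 \<and> \<omega>2 z = 0" for z
    by (auto simp: complex_eq_iff)
  have "P \<subseteq> critical_points (M 0) \<omega>"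
  proof
    fix z assume z: "z \<in> P"
    then have "(\<omega> has_derivative (\<lambda>_. 0)) (at z)" using \<omega>_derivative[of z] unfolding P_def by simp
    then show "z \<in> critical_points (M 0) \<omega>"
      using z open_R(2) has_derivative_at_withinI unfolding critical_points_def P_def by blast
  qed
  then have P: "finite P" using crit finite_subset by blast
  define Z where "Z = frontier (M 0) \<union> P"
  have MZ: "M 0 - Z = R - P" unfolding Z_def fr using open_R(2) by blast
  have fM: "f ` M 0 \<subseteq> M 0" using f_homeo(2) unfolding bij_betw_def by blast
  have fP: "f z \<in> P" if "z \<in> P" for z
  proof -
    have z: "z \<in> R" "Complex (- \<omega>2 z) (\<omega>1 z) = 0" using that V0[of z] unfolding P_def by blast+
    have "Df z 0 = 0" using linear_0[OF has_derivative_linear[OF f_derivative[OF z(1)]]] .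
    then have "Complex (- \<omega>2 (f z)) (\<omega>1 (f z)) = 0" using Df_invariance(1)[OF z(1)] z(2) by simp
    then show ?thesis using f_interior[OF z(1)] V0 unfolding P_def by blast
  qed
  \<comment> \<open>Injectivity of \<open>Df\<close> carries a zero of the field at
    \<open>f z\<close> back to \<open>z\<close>, so the complement of \<open>Z\<close> is invariant
    too.\<close>
  have fRP: "f z \<in> R - P" if "z \<in> R - P" for z
  proof -
    have "f z \<notin> P"
    proof
      assume "f z \<in> P"
      then have "Df z (Complex (- \<omega>2 z) (\<omega>1 z)) = 0"
        using Df_invariance(1)[of z] that V0[of "f z"] unfolding P_def by simp
      then have "Complex (- \<omega>2 z) (\<omega>1 z) = 0" using Df_invariance(2)[of z] that by blast
      then show False using V0[of z] that unfolding P_def by blast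
    qed
    then show ?thesis using f_interior[of z] that by blast
  qed
  have Zf: "f ` Z \<subseteq> Z" using f_frontier fP unfolding Z_def by blast
  have "subexponential f (frontier (M 0))"
    by (rule subexponential_frontier)
      (use f_frontier f_homeo fr in \<open>auto intro: continuous_on_subset inj_on_subset simp: bij_betw_def\<close>)
  moreover have "subexponential f P"
  proof (rule subexponential_linear)
    fix \<delta> :: real assume "\<delta> > 0"
    then have "\<forall>n. orbit_coded f P n \<delta> (0 * n + card P)" using orbit_coded_finite[OF P] by simp
    then show "\<exists>a b. \<forall>n. orbit_coded f P n \<delta> (a * n + b)" by blast
  qed
  ultimately have "subexponential f Z"
    unfolding Z_def by (rule subexponential_Un)
  obtain B where B: "\<And>z. z \<in> R \<Longrightarrow> norm (Complex (- \<omega>2 z) (\<omega>1 z)) \<le> B"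
    using \<omega>12_bounded by blast
  show "subexponential f (M 0)"
  proof (rule subexponential_fibred[where Z = Z and w = \<omega>])
    show "closed Z" unfolding Z_def using P finite_imp_closed by (intro closed_Un frontier_closed) auto
    show "Z \<subseteq> M 0" unfolding Z_def fr P_def using open_R(2) by blast
    show "f ` (M 0 - Z) \<subseteq> M 0 - Z" unfolding MZ using fRP by blast
    show "continuous_on (M 0 - Z) \<omega>"
      unfolding MZ by (rule continuous_at_imp_continuous_on) (use \<omega>_derivative has_derivative_continuous in blast)
    show "\<omega> (f x) = \<omega> x" if "x \<in> M 0 - Z" for x using \<omega>_invariant that unfolding MZ by blast
    fix q and \<delta> :: real
    assume "q \<in> M 0 - Z" and \<delta>: "\<delta> > 0"
    then have q: "q \<in> R" "\<omega>1 q \<noteq> 0 \<or> \<omega>2 q \<noteq> 0" unfolding MZ P_def by auto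
    from level_set_stable[OF open_R(1) q(1) \<omega>_derivative \<omega>12_continuous q(2) f_interior f_derivative
        Df_invariance(1) B \<delta>]
    show "\<exists>W. open W \<and> q \<in> W \<and> (\<forall>x\<in>W \<inter> (M 0 - Z). \<omega> x = \<omega> q \<longrightarrow>
        (\<forall>i. dist ((f ^^ i) x) ((f ^^ i) q) \<le> \<delta>))" by blast
  qed (fact compact_fluid_region f_homeo(1) fM Zf \<open>subexponential f Z\<close>)+
  show "M 0 \<noteq> {}"
    using fr frontier_fluid_region[OF order_refl] by blast
qed

end

theorem proposition4:
  fixes k :: enat and c :: "real \<Rightarrow> complex" and \<epsilon> :: real and m :: nat
    and \<alpha> :: "nat \<Rightarrow> real \<Rightarrow> complex" and X :: "real \<Rightarrow> complex \<Rightarrow> complex"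
    and f :: "complex \<Rightarrow> complex"
  assumes "k \<ge> 3"
    and "euler_diffeomorphism k c \<epsilon> m \<alpha> X f"
    and "finite (critical_points (fluid_region c \<epsilon> m \<alpha> 0) (curl (fluid_region c \<epsilon> m \<alpha> 0) (X 0)))"
  shows "topological_entropy (fluid_region c \<epsilon> m \<alpha> 0) f = 0"
proof -
  obtain T \<phi> where "stirring_protocol c \<epsilon> m \<alpha>" "T > 0" "periodic_protocol T m \<alpha>"
    "fluid_motion k (fluid_region c \<epsilon> m \<alpha>) \<phi>" "velocity_field k (fluid_region c \<epsilon> m \<alpha>) \<phi> X"
    "incompressible (fluid_region c \<epsilon> m \<alpha>) X" "euler_equation k (fluid_region c \<epsilon> m \<alpha>) X"
    "\<forall>t\<ge>0. \<forall>z\<in>fluid_region c \<epsilon> m \<alpha> t. X (t + T) z = X t z"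
    "\<forall>z\<in>fluid_region c \<epsilon> m \<alpha> 0. f z = \<phi> T z"
    using assms(2) unfolding euler_diffeomorphism_def Let_def by blast
  then interpret euler_flow c \<epsilon> m \<alpha> k T \<phi> X f
    using assms(1) by unfold_locales auto
  show ?thesis by (rule topological_entropy_euler[OF assms(3)])
qed

end
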